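(* Let $F$ be an FCP specification satisfying the normal form assumptions below, and $N(F)$ its Petri net translation. Then the transition system $\mathcal{T}(F)=(\mathcal{R}(F)/_\equiv,\rightsquigarrow,[F])$ and the stable transition system $\mathcal{T}_{\mathit{stable}}(N(F))=(\mathcal{R}_{\mathit{stable}}(N(F)),\Rightarrow,M_0)$ are bisimilar, with the relation $\mathcal{R}$ defined below being a bisimulation: $([F],M_0)\in\mathcal{R}$, and for every $([G],M)\in\mathcal{R}$, every step $[G]\rightsquigarrow[G']$ is matched by some $M\Rightarrow M'$ with $([G'],M')\in\mathcal{R}$, and every $M\Rightarrow M'$ with $M'$ stable and reachable is matched by some $[G]\rightsquigarrow[G']$ with $([G'],M')\in\mathcal{R}$.
   Context: \textbf{Petri nets.} A Petri net is $N=(P,T,F,M_0)$ with disjoint places $P$ and transitions $T$, flow $F\subseteq(P\times T)\cup(T\times P)$, initial marking $M_0:P\to\mathbb{N}$. Transition $t$ is enabled at $M$ if $M(p)>0$ for all $p$ with $(p,t)\in F$; firing gives $M'(p)=M(p)-F(p,t)+F(t,p)$ (writing $M\rightarrow M'$). A "test" of place $p$ by $t$ means both arcs $(p,t),(t,p)$. $\mathcal{R}(N)$ is the set of reachable markings. \textbf{FCPs.} Prefixes: $\overline{a}\langle b\rangle$ (send $b$ on $a$), $a(x)$ (receive into $x$), $\tau$. Threads: $S::=K\lfloor\tilde a\rfloor\mid\sum_{i\in I}\pi_i.S_i\mid\nu r.S$, where each process identifier $K$ has a defining equation $K(\tilde f):=S$ with distinct formal parameters. An FCP is $\nu\tilde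 r.(S_1\mid\dots\mid S_n)$. Structural congruence $\equiv$ is the smallest congruence with $\alpha$-conversion of bound names, $\mid$ associative and commutative with unit $0$ (the empty sum), $\nu r.0\equiv0$, $\nu r_1.\nu r_2.P\equiv\nu r_2.\nu r_1.P$, $\nu r.(P_1\mid P_2)\equiv P_1\mid\nu r.P_2$ if $r\notin fn(P_1)$. The reaction relation $\rightarrow$ is generated by $\tau.S+\dots\rightarrow S$; $K\lfloor\tilde a\rfloor\rightarrow S\{\tilde a/\tilde f\}$ if $K(\tilde f):=S$; $x(y).S_1+\dots\mid\overline{x}\langle z\rangle.S_2+\dots\rightarrow S_1\{z/y\}\mid S_2$; closed under $\mid$, $\nu$, $\equiv$. $\mathcal{R}(F)$ is the set of processes reachable from $F$, and $[F_1]\rightsquigarrow[F_2]$ iff $F_1\rightarrow F_2$ ($[\cdot]$ = $\equiv$-class). \textbf{Normal form assumptions.} Names are partitioned into $\mathit{RESTR}$ (bound by $\nu$), $\mathit{INP}$ (bound by input), $\mathit{FRM}$ (formal parameters), $\mathit{PUB}$ (the rest); every name is bound at most once, these sets are disjoint, and substitutions never clash with bound names. Different threads call disjoint sets of identifiers; no defining equation calls its own identifier; for $K(\tilde f):=S$, $fn(S)=\tilde f$. $F=\nu\tilde r.(S_{init,1}\sigma_1\mid\dots\mid S_{init,n}\sigma_n)$ where $K_{init,i}(\tilde f_{init,i}):=S_{init,i}$ are defining equations, $S_{init,i}$ are choices or calls, $\sigma_i:\tilde f_{init,i}\to\tilde r\cup\mathit{PUB}$; $0$ does not occur; in $x(y).S$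 we have $y\in fn(S)$ and in $\nu r.S$ we have $r\in fn(S)$. $\mathit{NEW}$ is a set of fresh names with $|\mathit{NEW}|=|\mathit{RESTR}|+|\mathit{INP}|+|\mathit{FRM}|$. \textbf{Substitution net $N_{\mathit{subst}}$.} Places (no transitions): $[x=p]$ for $x\in\mathit{INP}\cup\mathit{FRM}$, $p\in\mathit{PUB}$; $[x=n]$ for $x\in\mathit{INP}\cup\mathit{FRM}\cup\mathit{RESTR}$, $n\in\mathit{NEW}$; $[x\neq n]$ for $x\in\mathit{INP}\cup\mathit{FRM}\cup\{r_*\}$, $n\in\mathit{NEW}$. A substitution marking $M$ satisfies: for all $n\in\mathit{NEW}$, $M([r_*\neq n])+\sum_{r\in\mathit{RESTR}}M([r=n])=1$; for all $x$, $\sum_{a}M([x=a])\le1$; for $x\in\mathit{INP}\cup\mathit{FRM}$, $n\in\mathit{NEW}$, $M([x=n])+M([x\neq n])=1$. Given $\sigma:(\mathit{INP}'\cup\mathit{FRM}'\to\mathit{PUB}\cup\tilde r)\cup(\mathit{RESTR}'\to\tilde r)$ (subsets of the respective sets, second part injective, $\tilde r$ names outside $\mathit{PUB}$), $M$ corresponds to $\sigma$ if: $M([x=a])=0$ for all $x\notin dom(\sigma)$ and all $a$; $M([x=\sigma(x)])=1$ if $\sigma(x)\in\mathit{PUB}$; if $\sigma(x)\in\tilde r$ there is $n\in\mathit{NEW}$ with $M([x=n])=1$; and for $x,y$ with $\sigma(x),\sigma(y)\in\tilde r$: $\sigma(x)=\sigma(y)$ iff $M([x=n])=M([y=n])$ for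 all $n\in\mathit{NEW}$ (missing places count as $0$). \textbf{Control flow nets.} Augmented processes are pairs $(S,\lambda)$, $S$ a thread, $\lambda$ a sequence of names. Transitions carry a label in $\{\tau,\mathit{send}(a,b),\mathit{rec}(a,b)\}$ and a set of commands $\mathit{map}(x,b),\mathit{unmap}(x,b),\mathit{test}[x=b]$ ($a,b\in\mathit{PUB}\cup\mathit{NEW}$): (ν) $(\nu r.S,\lambda)\to(S,\lambda)$, label $\tau$, commands $\{\mathit{map}(r,n)\}$, for each $n\in\mathit{NEW}$; (τ) $(\tau.S+\dots,\lambda)\to(S,\lambda\lambda')$, label $\tau$, no commands; (snd) $(\overline x\langle y\rangle.S+\dots,\lambda)\to(S,\lambda\lambda')$, label $\mathit{send}(a,b)$, commands $\{\mathit{test}[x=a],\mathit{test}[y=b]\}$, for all $a,b$; (rec) $(x(y).S+\dots,\lambda)\to(S,\lambda\lambda')$, label $\mathit{rec}(a,b)$, commands $\{\mathit{test}[x=a],\mathit{map}(y,b)\}$, for all $a,b$; where $\lambda'$ lists (in a fixed order) $fn$ of the choice minus $fn(S)$; (call1) for $K(f_1,\dots,f_k):=S$ and $m\ge1$: $(K\lfloor x_1..x_m\rfloor,\lambda)\to(K\lfloor x_1..x_{m-1}\rfloor,\lambda'')$, label $\tau$, commands $\{\mathit{test}[x_m=a],\mathit{map}(f_m,a)\}$, for each $a$, with $\lambda''=\lambda$ if $x_m\in\lambda$ else $\lambda\cdot x_m$; (call2) $(K\lfloor-\rfloor,x\lambda)\to(K\lfloor-\rfloor,\lambda)$, label $\tau$,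 commands $\{\mathit{unmap}(x,a)\}$, for each $a$; (call3) $(K\lfloor-\rfloor,\varepsilon)\to(S,\varepsilon)$, label $\tau$, no commands. $N(S_{init,i})$ has as places the augmented processes reachable from $(S_{init,i},\varepsilon)$, these transitions (one input, one output place each), and one token on $(S_{init,i},\varepsilon)$. \textbf{Composition.} Parallel composition of $N(S_{init,1}),\dots,N(S_{init,n})$: disjoint union plus, for each pair of transitions $t_1,t_2$ in different components with labels $\mathit{send}(a,b)$ and $\mathit{rec}(a,b)$, a new transition $(t_1,t_2)$ with the union of their pre- and postsets, label $\tau$, union of commands. Hiding removes all transitions not labelled $\tau$. $N(F)$ is obtained by placing $N_{\mathit{subst}}$ (initially marked with a substitution marking corresponding to $\sigma_1\cup\dots\cup\sigma_n$) next to the result and implementing commands of each transition $t$: $\mathit{test}[x=b]$: test $[x=b]$; $\mathit{map}(x,p)$, $p\in\mathit{PUB}$: arc $t\to[x=p]$; $\mathit{map}(x,n)$, $x\in\mathit{INP}\cup\mathit{FRM}$, $n\in\mathit{NEW}$: arcs $t\to[x=n]$, $[x\neq n]\to t$; $\mathit{map}(r,n)$, $r\in\mathit{RESTR}$: arcs $[r_*\neq n]\to t$, $t\to[r=n]$ and tests of $[x\neq n]$ for all $x\in\mathit{INP}\cup\mathit{FRM}$; $\mathit{unmap}(x,a)$: arc $[x=a]\to t$ and, if $a\in\mathit{NEW}$, arc $t\to[x\neq a]$ (for $x\in\mathit{INP}\cup\mathit{FRM}$) or $t\to[r_*\neq a]$ (for $x\in\mathit{RESTR}$). \textbf{Stability.}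 A place $(S,\lambda)$ of a control flow net is stable if $S$ is a choice or a call $K\lfloor\tilde x\rfloor$ with its full parameter list. A marking of $N(F)$ is stable if it marks a stable place in every control flow net; $\mathcal{R}_{\mathit{stable}}(N(F))$ is the set of reachable stable markings. A transition sequence $t_1\dots t_k$ from a stable marking $M$ to a stable marking $M'$ is race free if exactly one $t_i$ is a (τ)-transition, a synchronised pair $(t_1,t_2)$ of (snd)/(rec) transitions, or a (call3)-transition; then we write $M\Rightarrow M'$. \textbf{The relation $\mathcal{R}$.} $([G],M_1\cup M_2)\in\mathcal{R}$ (with $M_1$ the marking of $N_{\mathit{subst}}$ and $M_2$ the control flow marking, $M_1\cup M_2$ stable and reachable, $G$ reachable from $F$) iff $G\equiv\nu\tilde r.(S_1\sigma_1\mid\dots\mid S_n\sigma_n)$ where each $S_i$ is a choice or call derived from the body $S$ of some defining equation, i.e. $(S,\varepsilon)$ reaches $(S_i,\lambda_i)$ by control flow transitions with no intermediate process a call, each $\sigma_i:fn(S_i)\cup\lambda_i\to\tilde r\cup\mathit{PUB}$, $M_1$ corresponds to $\sigma_1\cup\dots\cup\sigma_n$, and $M_2((S_i,\lambda_i))=1$ for all $i$.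
   Formalization: For identifiers without parameters, a call whose names are already partly unmapped is kept apart from the full call and is not stable (read literally, it would be stable but outside R); the identifier K_init,i counts among those called by thread i. *)

theory Defs
  imports Main "HOL-Library.Infinite_Typeclass"
begin

section \<open>Processes, structural congruence and reaction\<close>

datatype 'n prefix = Out 'n 'n | Inp 'n 'n | Tau

text \<open>
  Structural congruence lives on all processes; threads are the processes without parallel
  composition. The list in \<open>Choice\<close> is the family \<open>\<pi>\<^sub>i.S\<^sub>i\<close> indexed by
  \<open>I = {0..<n}\<close>.
\<close>

datatype ('k, 'n) proc =
    Call 'k "'n list"
  | Choice "('n prefix \<times> ('k, 'n) proc) list"
  | Res 'n "('k, 'n) proc"
  | Par "('k, 'n) proc" "('k, 'n) proc"

abbreviation Nil0 :: "('k, 'n) proc" where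
  "Nil0 \<equiv> Choice []"

fun is_thread :: "('k, 'n) proc \<Rightarrow> bool" where
  "is_thread (Call K as) = True"
| "is_thread (Choice bs) = (\<forall>(\<pi>, P) \<in> set bs. is_thread P)"
| "is_thread (Res r P) = is_thread P"
| "is_thread (Par P Q) = False"

fun is_choice :: "('k, 'n) proc \<Rightarrow> bool" where
  "is_choice (Choice bs) = True"
| "is_choice _ = False"

fun is_call :: "('k, 'n) proc \<Rightarrow> bool" where
  "is_call (Call K as) = True"
| "is_call _ = False"

fun fn_prefixed :: "'n prefix \<Rightarrow> 'n set \<Rightarrow> 'n set" where
  "fn_prefixed (Out a b) X = {a, b} \<union> X"
| "fn_prefixed (Inp a x) X = {a} \<union> (X - {x})"
| "fn_prefixed Tau X = X"

fun fn :: "('k, 'n) proc \<Rightarrow> 'n set" where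
  "fn (Call K as) = set as"
| "fn (Choice bs) = (\<Union>(\<pi>, P) \<in> set bs. fn_prefixed \<pi> (fn P))"
| "fn (Res r P) = fn P - {r}"
| "fn (Par P Q) = fn P \<union> fn Q"

fun res_binders :: "('k, 'n) proc \<Rightarrow> 'n list" where
  "res_binders (Call K as) = []"
| "res_binders (Choice bs) = concat (map (\<lambda>(\<pi>, P). res_binders P) bs)"
| "res_binders (Res r P) = r # res_binders P"
| "res_binders (Par P Q) = res_binders P @ res_binders Q"

fun prefix_binders :: "'n prefix \<Rightarrow> 'n list" where
  "prefix_binders (Inp a x) = [x]"
| "prefix_binders _ = []"

fun inp_binders :: "('k, 'n) proc \<Rightarrow> 'n list" where
  "inp_binders (Call K as) = []"
| "inp_binders (Choice bs) = concat (map (\<lambda>(\<pi>, P). prefix_binders \<pi> @ inp_binders P) bs)"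
| "inp_binders (Res r P) = inp_binders P"
| "inp_binders (Par P Q) = inp_binders P @ inp_binders Q"

fun calls :: "('k, 'n) proc \<Rightarrow> ('k \<times> 'n list) set" where
  "calls (Call K as) = {(K, as)}"
| "calls (Choice bs) = (\<Union>(\<pi>, P) \<in> set bs. calls P)"
| "calls (Res r P) = calls P"
| "calls (Par P Q) = calls P \<union> calls Q"

definition avoid :: "'n::infinite \<Rightarrow> 'n set \<Rightarrow> 'n" where
  "avoid x X = (if x \<in> X then SOME y. y \<notin> X else x)"

text \<open>
  Simultaneous capture-avoiding substitution. A bound name is renamed only if it would
  capture; if nothing clashes, this is plain replacement of the free occurrences.
\<close>

fun subst :: "('n::infinite \<Rightarrow> 'n) \<Rightarrow> ('k, 'n) proc \<Rightarrow> ('k, 'n) proc" where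
  "subst \<theta> (Call K as) = Call K (map \<theta> as)"
| "subst \<theta> (Choice bs) = Choice (map (\<lambda>(\<pi>, P). case \<pi> of
      Out a b \<Rightarrow> (Out (\<theta> a) (\<theta> b), subst \<theta> P)
    | Inp a x \<Rightarrow> (Inp (\<theta> a) (avoid x (\<theta> ` (fn P - {x}))),
                  subst (\<theta>(x := avoid x (\<theta> ` (fn P - {x})))) P)
    | Tau \<Rightarrow> (Tau, subst \<theta> P)) bs)"
| "subst \<theta> (Res r P) = Res (avoid r (\<theta> ` (fn P - {r})))
                          (subst (\<theta>(r := avoid r (\<theta> ` (fn P - {r})))) P)"
| "subst \<theta> (Par P Q) = Par (subst \<theta> P) (subst \<theta> Q)"

definition app_map :: "('n \<rightharpoonup> 'n) \<Rightarrow> 'n \<Rightarrow> 'n" where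
  "app_map \<sigma> x = (case \<sigma> x of None \<Rightarrow> x | Some y \<Rightarrow> y)"

abbreviation msubst :: "('n::infinite \<rightharpoonup> 'n) \<Rightarrow> ('k, 'n) proc \<Rightarrow> ('k, 'n) proc" where
  "msubst \<sigma> \<equiv> subst (app_map \<sigma>)"

inductive scong :: "('k, 'n::infinite) proc \<Rightarrow> ('k, 'n) proc \<Rightarrow> bool" where
  sc_refl: "scong P P"
| sc_sym: "scong P Q \<Longrightarrow> scong Q P"
| sc_trans: "scong P Q \<Longrightarrow> scong Q R \<Longrightarrow> scong P R"
| sc_cong_choice: "scong P Q \<Longrightarrow> scong (Choice (bs @ (\<pi>, P) # cs)) (Choice (bs @ (\<pi>, Q) # cs))"
| sc_cong_res: "scong P Q \<Longrightarrow> scong (Res r P) (Res r Q)"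
| sc_cong_par: "scong P P' \<Longrightarrow> scong Q Q' \<Longrightarrow> scong (Par P Q) (Par P' Q')"
| sc_alpha_res: "r' \<notin> fn P \<Longrightarrow> scong (Res r P) (Res r' (msubst [r \<mapsto> r'] P))"
| sc_alpha_inp: "y' \<notin> fn P \<Longrightarrow>
    scong (Choice (bs @ (Inp a y, P) # cs)) (Choice (bs @ (Inp a y', msubst [y \<mapsto> y'] P) # cs))"
| sc_par_assoc: "scong (Par P (Par Q R)) (Par (Par P Q) R)"
| sc_par_comm: "scong (Par P Q) (Par Q P)"
| sc_par_unit: "scong (Par P Nil0) P"
| sc_res_nil: "scong (Res r Nil0) Nil0"
| sc_res_swap: "scong (Res r1 (Res r2 P)) (Res r2 (Res r1 P))"
| sc_scope: "r \<notin> fn P1 \<Longrightarrow> scong (Res r (Par P1 P2)) (Par P1 (Res r P2))"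

type_synonym ('k, 'n) eqns = "'k \<rightharpoonup> 'n list \<times> ('k, 'n) proc"

inductive react :: "('k, 'n::infinite) eqns \<Rightarrow> ('k, 'n) proc \<Rightarrow> ('k, 'n) proc \<Rightarrow> bool"
  for D :: "('k, 'n) eqns" where
  re_tau: "(Tau, S) \<in> set bs \<Longrightarrow> react D (Choice bs) S"
| re_call: "D K = Some (fs, S) \<Longrightarrow> length as = length fs \<Longrightarrow>
    react D (Call K as) (msubst (map_of (zip fs as)) S)"
| re_comm: "(Inp x y, S1) \<in> set bs \<Longrightarrow> (Out x z, S2) \<in> set cs \<Longrightarrow>
    react D (Par (Choice bs) (Choice cs)) (Par (msubst [y \<mapsto> z] S1) S2)"
| re_par: "react D P P' \<Longrightarrow> react D (Par P Q) (Par P' Q)"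
| re_res: "react D P P' \<Longrightarrow> react D (Res r P) (Res r P')"
| re_struct: "scong P P' \<Longrightarrow> react D P' Q' \<Longrightarrow> scong Q' Q \<Longrightarrow> react D P Q"

fun par_list :: "('k, 'n) proc list \<Rightarrow> ('k, 'n) proc" where
  "par_list [] = Nil0"
| "par_list [P] = P"
| "par_list (P # Q # Ps) = Par P (par_list (Q # Ps))"

definition res_list :: "'n list \<Rightarrow> ('k, 'n) proc \<Rightarrow> ('k, 'n) proc" where
  "res_list rs P = foldr Res rs P"


section \<open>FCP specifications in normal form\<close>

text \<open>
  The process is \<open>\<nu>r\<^sub>1\<dots>r\<^sub>m.(S\<^sub>1\<sigma>\<^sub>1 | \<dots> | S\<^sub>n\<sigma>\<^sub>n)\<close> with \<open>restricted = [r\<^sub>1,\<dots>,r\<^sub>m]\<close>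
  and \<open>inits = [(K\<^sub>1,\<sigma>\<^sub>1),\<dots>,(K\<^sub>n,\<sigma>\<^sub>n)]\<close>, where \<open>S\<^sub>i\<close> is the body of \<open>K\<^sub>i\<close>.
  \<open>PUB\<close> may be any finite set of unbound names that contains the free names of the process.
\<close>

record ('k, 'n) fcp_spec =
  eqs :: "('k, 'n) eqns"
  restricted :: "'n list"
  inits :: "('k \<times> ('n \<rightharpoonup> 'n)) list"
  PUB :: "'n set"
  NEW :: "'n set"

definition formals :: "('k, 'n) fcp_spec \<Rightarrow> 'k \<Rightarrow> 'n list" where
  "formals F K = fst (the (eqs F K))"

definition body :: "('k, 'n) fcp_spec \<Rightarrow> 'k \<Rightarrow> ('k, 'n) proc" where
  "body F K = snd (the (eqs F K))"

definition init_ident :: "('k, 'n) fcp_spec \<Rightarrow> nat \<Rightarrow> 'k" where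
  "init_ident F i = fst (inits F ! i)"

definition init_thread :: "('k, 'n) fcp_spec \<Rightarrow> nat \<Rightarrow> ('k, 'n) proc" where
  "init_thread F i = body F (init_ident F i)"

definition init_map :: "('k, 'n) fcp_spec \<Rightarrow> nat \<Rightarrow> ('n \<rightharpoonup> 'n)" where
  "init_map F i = snd (inits F ! i)"

abbreviation nthreads :: "('k, 'n) fcp_spec \<Rightarrow> nat" where
  "nthreads F \<equiv> length (inits F)"

definition fcp_proc :: "('k, 'n::infinite) fcp_spec \<Rightarrow> ('k, 'n) proc" where
  "fcp_proc F = res_list (restricted F)
     (par_list (map (\<lambda>i. msubst (init_map F i) (init_thread F i)) [0..<nthreads F]))"

definition RESTR :: "('k, 'n) fcp_spec \<Rightarrow> 'n set" where
  "RESTR F = set (restricted F) \<union> (\<Union>K \<in> dom (eqs F). set (res_binders (body F K)))"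

definition INP :: "('k, 'n) fcp_spec \<Rightarrow> 'n set" where
  "INP F = (\<Union>K \<in> dom (eqs F). set (inp_binders (body F K)))"

definition FRM :: "('k, 'n) fcp_spec \<Rightarrow> 'n set" where
  "FRM F = (\<Union>K \<in> dom (eqs F). set (formals F K))"

definition eqn_binders :: "('k, 'n) fcp_spec \<Rightarrow> 'k \<Rightarrow> 'n list" where
  "eqn_binders F K = formals F K @ res_binders (body F K) @ inp_binders (body F K)"

definition bound_once :: "('k, 'n) fcp_spec \<Rightarrow> bool" where
  "bound_once F \<longleftrightarrow>
     distinct (restricted F) \<and>
     (\<forall>K \<in> dom (eqs F). distinct (eqn_binders F K) \<and>
        set (eqn_binders F K) \<inter> set (restricted F) = {}) \<and>
     (\<forall>K \<in> dom (eqs F). \<forall>L \<in> dom (eqs F). K \<noteq> L \<longrightarrow>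
        set (eqn_binders F K) \<inter> set (eqn_binders F L) = {})"

definition call_graph :: "('k, 'n) fcp_spec \<Rightarrow> ('k \<times> 'k) set" where
  "call_graph F = {(K, L). K \<in> dom (eqs F) \<and> (\<exists>as. (L, as) \<in> calls (body F K))}"

text \<open>The identifiers a thread may ever run, including the one whose body it starts with.\<close>

definition thread_idents :: "('k, 'n) fcp_spec \<Rightarrow> nat \<Rightarrow> 'k set" where
  "thread_idents F i = (call_graph F)\<^sup>* `` {init_ident F i}"

text \<open>\<open>0\<close> does not occur, and every name bound by an input or a restriction is used.\<close>

fun binders_used :: "('k, 'n) proc \<Rightarrow> bool" where
  "binders_used (Call K as) = True"
| "binders_used (Choice bs) = (bs \<noteq> [] \<and>
     (\<forall>(\<pi>, P) \<in> set bs. set (prefix_binders \<pi>) \<subseteq> fn P \<and> binders_used P))"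
| "binders_used (Res r P) = (r \<in> fn P \<and> binders_used P)"
| "binders_used (Par P Q) = (binders_used P \<and> binders_used Q)"

definition normal_form :: "('k, 'n) fcp_spec \<Rightarrow> bool" where
  "normal_form F \<longleftrightarrow>
     finite (dom (eqs F)) \<and> inits F \<noteq> [] \<and>
     (\<forall>K \<in> dom (eqs F).
        is_thread (body F K) \<and> binders_used (body F K) \<and>
        fn (body F K) = set (formals F K) \<and>
        (\<forall>(L, as) \<in> calls (body F K).
           L \<noteq> K \<and> L \<in> dom (eqs F) \<and> length as = length (formals F L))) \<and>
     bound_once F \<and>
     finite (PUB F) \<and> PUB F \<inter> (RESTR F \<union> INP F \<union> FRM F) = {} \<and>
     (\<forall>i < nthreads F. init_ident F i \<in> dom (eqs F) \<and>
        (is_choice (init_thread F i) \<or> is_call (init_thread F i)) \<and>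
        dom (init_map F i) = set (formals F (init_ident F i)) \<and>
        ran (init_map F i) \<subseteq> set (restricted F) \<union> PUB F) \<and>
     (\<forall>i < nthreads F. \<forall>j < nthreads F. i \<noteq> j \<longrightarrow> thread_idents F i \<inter> thread_idents F j = {}) \<and>
     finite (NEW F) \<and> NEW F \<inter> (RESTR F \<union> INP F \<union> FRM F \<union> PUB F) = {} \<and>
     card (NEW F) = card (RESTR F) + card (INP F) + card (FRM F)"


section \<open>Petri nets\<close>

text \<open>The flow relation is split into its two parts, from places and from transitions.\<close>

record ('p, 't) petri =
  places :: "'p set"
  transitions :: "'t set"
  flow_pt :: "('p \<times> 't) set"
  flow_tp :: "('t \<times> 'p) set"
  initial :: "'p \<Rightarrow> nat"

definition enabled :: "('p, 't) petri \<Rightarrow> ('p \<Rightarrow> nat) \<Rightarrow> 't \<Rightarrow> bool" where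
  "enabled N M t \<longleftrightarrow> t \<in> transitions N \<and> (\<forall>p. (p, t) \<in> flow_pt N \<longrightarrow> M p > 0)"

definition fire :: "('p, 't) petri \<Rightarrow> ('p \<Rightarrow> nat) \<Rightarrow> 't \<Rightarrow> ('p \<Rightarrow> nat)" where
  "fire N M t = (\<lambda>p. M p - of_bool ((p, t) \<in> flow_pt N) + of_bool ((t, p) \<in> flow_tp N))"

inductive fires :: "('p, 't) petri \<Rightarrow> ('p \<Rightarrow> nat) \<Rightarrow> 't list \<Rightarrow> ('p \<Rightarrow> nat) \<Rightarrow> bool"
  for N :: "('p, 't) petri" where
  fires_Nil: "fires N M [] M"
| fires_Cons: "enabled N M t \<Longrightarrow> fires N (fire N M t) ts M' \<Longrightarrow> fires N M (t # ts) M'"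

definition reachable_markings :: "('p, 't) petri \<Rightarrow> ('p \<Rightarrow> nat) set" where
  "reachable_markings N = {M. \<exists>ts. fires N (initial N) ts M}"


section \<open>Control flow nets\<close>

datatype 'n label = LTau | LSend 'n 'n | LRec 'n 'n

datatype 'n command = Map 'n 'n | Unmap 'n 'n | Test 'n 'n

text \<open>
  \<open>Pend K xs\<close> is the call \<open>K\<lfloor>xs\<rfloor>\<close> after its processing has begun; in particular
  \<open>Pend K []\<close> is \<open>K\<lfloor>-\<rfloor>\<close>. For identifiers with at least one parameter the length of the
  argument list already separates the two constructors. For parameterless \<open>K\<close> it does not:
  the call with its full (empty) parameter list, which is stable, has to be kept apart from
  the same call with some names already unmapped, which is not.
\<close>

datatype ('k, 'n) ctrl = Thr "('k, 'n) proc" | Pend 'k "'n list"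

type_synonym ('k, 'n) aug = "('k, 'n) ctrl \<times> 'n list"

datatype rule = RNu | RTau | RSnd | RRec | RCall1 | RCall2 | RCall3

record ('k, 'n) cftrans =
  src :: "('k, 'n) aug"
  rl :: rule
  lab :: "'n label"
  cmds :: "'n command set"
  tgt :: "('k, 'n) aug"

definition dropped :: "('n::linorder prefix \<times> ('k, 'n) proc) list \<Rightarrow> ('k, 'n) proc \<Rightarrow> 'n list" where
  "dropped bs S = sorted_list_of_set (fn (Choice bs) - fn S)"

abbreviation vals :: "('k, 'n) fcp_spec \<Rightarrow> 'n set" where
  "vals F \<equiv> PUB F \<union> NEW F"

inductive_set cf_trans :: "('k, 'n::linorder) fcp_spec \<Rightarrow> ('k, 'n) cftrans set"
  for F :: "('k, 'n) fcp_spec" where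
  cf_nu: "n \<in> NEW F \<Longrightarrow>
    \<lparr>src = (Thr (Res r S), l), rl = RNu, lab = LTau, cmds = {Map r n}, tgt = (Thr S, l)\<rparr>
      \<in> cf_trans F"
| cf_tau: "(Tau, S) \<in> set bs \<Longrightarrow>
    \<lparr>src = (Thr (Choice bs), l), rl = RTau, lab = LTau, cmds = {},
     tgt = (Thr S, l @ dropped bs S)\<rparr> \<in> cf_trans F"
| cf_snd: "(Out x y, S) \<in> set bs \<Longrightarrow> a \<in> vals F \<Longrightarrow> b \<in> vals F \<Longrightarrow>
    \<lparr>src = (Thr (Choice bs), l), rl = RSnd, lab = LSend a b, cmds = {Test x a, Test y b},
     tgt = (Thr S, l @ dropped bs S)\<rparr> \<in> cf_trans F"
| cf_rec: "(Inp x y, S) \<in> set bs \<Longrightarrow> a \<in> vals F \<Longrightarrow> b \<in> vals F \<Longrightarrow>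
    \<lparr>src = (Thr (Choice bs), l), rl = RRec, lab = LRec a b, cmds = {Test x a, Map y b},
     tgt = (Thr S, l @ dropped bs S)\<rparr> \<in> cf_trans F"
| cf_call1: "c = Thr (Call K (xs @ [x])) \<or> c = Pend K (xs @ [x]) \<Longrightarrow>
    eqs F K = Some (fs, S) \<Longrightarrow> length xs < length fs \<Longrightarrow> a \<in> vals F \<Longrightarrow>
    \<lparr>src = (c, l), rl = RCall1, lab = LTau, cmds = {Test x a, Map (fs ! length xs) a},
     tgt = (Pend K xs, if x \<in> set l then l else l @ [x])\<rparr> \<in> cf_trans F"
| cf_call2: "c = Thr (Call K []) \<or> c = Pend K [] \<Longrightarrow> K \<in> dom (eqs F) \<Longrightarrow> a \<in> vals F \<Longrightarrow>
    \<lparr>src = (c, x # l), rl = RCall2, lab = LTau, cmds = {Unmap x a}, tgt = (Pend K [], l)\<rparr>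
      \<in> cf_trans F"
| cf_call3: "c = Thr (Call K []) \<or> c = Pend K [] \<Longrightarrow> eqs F K = Some (fs, S) \<Longrightarrow>
    \<lparr>src = (c, []), rl = RCall3, lab = LTau, cmds = {}, tgt = (Thr S, [])\<rparr> \<in> cf_trans F"

definition cf_step :: "('k, 'n::linorder) fcp_spec \<Rightarrow> (('k, 'n) aug \<times> ('k, 'n) aug) set" where
  "cf_step F = {(src t, tgt t) |t. t \<in> cf_trans F}"

definition cf_places :: "('k, 'n::linorder) fcp_spec \<Rightarrow> nat \<Rightarrow> ('k, 'n) aug set" where
  "cf_places F i = (cf_step F)\<^sup>* `` {(Thr (init_thread F i), [])}"

definition cf_net_trans :: "('k, 'n::linorder) fcp_spec \<Rightarrow> nat \<Rightarrow> ('k, 'n) cftrans set" where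
  "cf_net_trans F i = {t \<in> cf_trans F. src t \<in> cf_places F i}"


section \<open>The net of a specification\<close>

text \<open>
  \<open>Eq x a\<close>, \<open>Neq x n\<close> and \<open>NeqStar n\<close> are the places \<open>[x = a]\<close>, \<open>[x \<noteq> n]\<close> and
  \<open>[r\<^sub>* \<noteq> n]\<close>. The index in \<open>Ctrl i\<close> makes the union of the control flow nets disjoint.
\<close>

datatype ('k, 'n) place =
    Eq 'n 'n
  | Neq 'n 'n
  | NeqStar 'n
  | Ctrl nat "('k, 'n) aug"

type_synonym ('k, 'n) marking = "('k, 'n) place \<Rightarrow> nat"

definition subst_places :: "('k, 'n) fcp_spec \<Rightarrow> ('k, 'n) place set" where
  "subst_places F =
     {Eq x p |x p. x \<in> INP F \<union> FRM F \<and> p \<in> PUB F} \<union>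
     {Eq x n |x n. x \<in> INP F \<union> FRM F \<union> RESTR F \<and> n \<in> NEW F} \<union>
     {Neq x n |x n. x \<in> INP F \<union> FRM F \<and> n \<in> NEW F} \<union>
     {NeqStar n |n. n \<in> NEW F}"

definition subst_marking :: "('k, 'n) fcp_spec \<Rightarrow> ('k, 'n) marking \<Rightarrow> bool" where
  "subst_marking F M \<longleftrightarrow>
     (\<forall>p. p \<notin> subst_places F \<longrightarrow> M p = 0) \<and>
     (\<forall>n \<in> NEW F. M (NeqStar n) + (\<Sum>r \<in> RESTR F. M (Eq r n)) = 1) \<and>
     (\<forall>x \<in> INP F \<union> FRM F \<union> RESTR F. (\<Sum>a \<in> vals F. M (Eq x a)) \<le> 1) \<and>
     (\<forall>x \<in> INP F \<union> FRM F. \<forall>n \<in> NEW F. M (Eq x n) + M (Neq x n) = 1)"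

definition corresponds ::
  "('k, 'n) fcp_spec \<Rightarrow> 'n set \<Rightarrow> ('n \<rightharpoonup> 'n) \<Rightarrow> ('k, 'n) marking \<Rightarrow> bool" where
  "corresponds F rs \<sigma> M \<longleftrightarrow>
     subst_marking F M \<and>
     rs \<inter> PUB F = {} \<and>
     dom \<sigma> \<subseteq> INP F \<union> FRM F \<union> RESTR F \<and>
     (\<forall>x \<in> dom \<sigma> \<inter> (INP F \<union> FRM F). the (\<sigma> x) \<in> PUB F \<union> rs) \<and>
     (\<forall>x \<in> dom \<sigma> \<inter> RESTR F. the (\<sigma> x) \<in> rs) \<and>
     inj_on \<sigma> (dom \<sigma> \<inter> RESTR F) \<and>
     (\<forall>x a. x \<notin> dom \<sigma> \<longrightarrow> M (Eq x a) = 0) \<and>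
     (\<forall>x a. \<sigma> x = Some a \<and> a \<in> PUB F \<longrightarrow> M (Eq x a) = 1) \<and>
     (\<forall>x a. \<sigma> x = Some a \<and> a \<in> rs \<longrightarrow> (\<exists>n \<in> NEW F. M (Eq x n) = 1)) \<and>
     (\<forall>x y a b. \<sigma> x = Some a \<and> \<sigma> y = Some b \<and> a \<in> rs \<and> b \<in> rs \<longrightarrow>
        (a = b \<longleftrightarrow> (\<forall>n \<in> NEW F. M (Eq x n) = M (Eq y n))))"

text \<open>Only used for maps with pairwise disjoint domains.\<close>

definition map_union :: "('n \<rightharpoonup> 'n) list \<Rightarrow> ('n \<rightharpoonup> 'n)" where
  "map_union \<sigma>s = foldr (++) \<sigma>s Map.empty"

fun cmd_pre :: "('k, 'n) fcp_spec \<Rightarrow> 'n command \<Rightarrow> ('k, 'n) place set" where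
  "cmd_pre F (Test x b) = {Eq x b}"
| "cmd_pre F (Map x b) =
     (if b \<in> PUB F then {}
      else if x \<in> RESTR F then {NeqStar b} \<union> {Neq y b |y. y \<in> INP F \<union> FRM F}
      else {Neq x b})"
| "cmd_pre F (Unmap x b) = {Eq x b}"

fun cmd_post :: "('k, 'n) fcp_spec \<Rightarrow> 'n command \<Rightarrow> ('k, 'n) place set" where
  "cmd_post F (Test x b) = {Eq x b}"
| "cmd_post F (Map x b) =
     {Eq x b} \<union>
     (if b \<notin> PUB F \<and> x \<in> RESTR F then {Neq y b |y. y \<in> INP F \<union> FRM F} else {})"
| "cmd_post F (Unmap x b) =
     (if b \<in> PUB F then {} else if x \<in> RESTR F then {NeqStar b} else {Neq x b})"

datatype ('k, 'n) ntrans =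
    Single nat "('k, 'n) cftrans"
  | Sync nat "('k, 'n) cftrans" nat "('k, 'n) cftrans"

text \<open>The parallel composition of the control flow nets after hiding.\<close>

definition composed_trans :: "('k, 'n::linorder) fcp_spec \<Rightarrow> ('k, 'n) ntrans set" where
  "composed_trans F =
     {Single i t |i t. i < nthreads F \<and> t \<in> cf_net_trans F i \<and> lab t = LTau} \<union>
     {Sync i t j u |i t j u. i < nthreads F \<and> j < nthreads F \<and> i \<noteq> j \<and>
        t \<in> cf_net_trans F i \<and> u \<in> cf_net_trans F j \<and>
        (\<exists>a b. lab t = LSend a b \<and> lab u = LRec a b)}"

fun ctrl_pre :: "('k, 'n) ntrans \<Rightarrow> ('k, 'n) place set" where
  "ctrl_pre (Single i t) = {Ctrl i (src t)}"
| "ctrl_pre (Sync i t j u) = {Ctrl i (src t), Ctrl j (src u)}"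

fun ctrl_post :: "('k, 'n) ntrans \<Rightarrow> ('k, 'n) place set" where
  "ctrl_post (Single i t) = {Ctrl i (tgt t)}"
| "ctrl_post (Sync i t j u) = {Ctrl i (tgt t), Ctrl j (tgt u)}"

fun commands :: "('k, 'n) ntrans \<Rightarrow> 'n command set" where
  "commands (Single i t) = cmds t"
| "commands (Sync i t j u) = cmds t \<union> cmds u"

definition preset :: "('k, 'n) fcp_spec \<Rightarrow> ('k, 'n) ntrans \<Rightarrow> ('k, 'n) place set" where
  "preset F t = ctrl_pre t \<union> (\<Union>c \<in> commands t. cmd_pre F c)"

definition postset :: "('k, 'n) fcp_spec \<Rightarrow> ('k, 'n) ntrans \<Rightarrow> ('k, 'n) place set" where
  "postset F t = ctrl_post t \<union> (\<Union>c \<in> commands t. cmd_post F c)"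

definition net_places :: "('k, 'n::linorder) fcp_spec \<Rightarrow> ('k, 'n) place set" where
  "net_places F = subst_places F \<union> {Ctrl i p |i p. i < nthreads F \<and> p \<in> cf_places F i}"

text \<open>
  There are no places \<open>[r = p]\<close> with \<open>r\<close> in \<open>RESTR\<close> and \<open>p\<close> in \<open>PUB\<close>. A transition
  that would have to test or empty such a place, which counts as unmarked, can never fire
  and is left out.
\<close>

definition net_trans :: "('k, 'n::linorder) fcp_spec \<Rightarrow> ('k, 'n) ntrans set" where
  "net_trans F = {t \<in> composed_trans F. preset F t \<subseteq> net_places F}"

definition initial_marking ::
  "('k, 'n) fcp_spec \<Rightarrow> ('k, 'n) marking \<Rightarrow> ('k, 'n) marking" where
  "initial_marking F Ms p = (case p of
       Ctrl i q \<Rightarrow> of_bool (i < nthreads F \<and> q = (Thr (init_thread F i), []))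
     | _ \<Rightarrow> Ms p)"

definition net ::
  "('k, 'n::linorder) fcp_spec \<Rightarrow> ('k, 'n) marking \<Rightarrow> (('k, 'n) place, ('k, 'n) ntrans) petri" where
  "net F Ms =
     \<lparr>places = net_places F,
      transitions = net_trans F,
      flow_pt = {(p, t). t \<in> net_trans F \<and> p \<in> preset F t},
      flow_tp = {(t, p). t \<in> net_trans F \<and> p \<in> postset F t},
      initial = initial_marking F Ms\<rparr>"


section \<open>Stability and race-free sequences\<close>

fun stable_place :: "('k, 'n) fcp_spec \<Rightarrow> ('k, 'n) aug \<Rightarrow> bool" where
  "stable_place F (Thr (Choice bs), l) = True"
| "stable_place F (Thr (Call K xs), l) = (length xs = length (formals F K))"
| "stable_place F _ = False"

definition stable :: "('k, 'n::linorder) fcp_spec \<Rightarrow> ('k, 'n) marking \<Rightarrow> bool" where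
  "stable F M \<longleftrightarrow>
     (\<forall>i < nthreads F. \<exists>p \<in> cf_places F i. stable_place F p \<and> M (Ctrl i p) > 0)"

definition stable_reachable ::
  "('k, 'n::linorder) fcp_spec \<Rightarrow> ('k, 'n) marking \<Rightarrow> ('k, 'n) marking set" where
  "stable_reachable F Ms = {M \<in> reachable_markings (net F Ms). stable F M}"

fun main_trans :: "('k, 'n) ntrans \<Rightarrow> bool" where
  "main_trans (Single i t) = (rl t = RTau \<or> rl t = RCall3)"
| "main_trans (Sync i t j u) = True"

definition stable_step ::
  "('k, 'n::linorder) fcp_spec \<Rightarrow> ('k, 'n) marking \<Rightarrow> ('k, 'n) marking \<Rightarrow> ('k, 'n) marking \<Rightarrow> bool"
  where
  "stable_step F Ms M M' \<longleftrightarrow> stable F M \<and> stable F M' \<and>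
     (\<exists>ts. fires (net F Ms) M ts M' \<and> length (filter main_trans ts) = 1)"


section \<open>Transition systems and bisimulation\<close>

record 's tsys =
  states :: "'s set"
  steps :: "('s \<times> 's) set"
  start :: 's

definition bisimulation :: "'a tsys \<Rightarrow> 'b tsys \<Rightarrow> ('a \<times> 'b) set \<Rightarrow> bool" where
  "bisimulation A B R \<longleftrightarrow>
     R \<subseteq> states A \<times> states B \<and>
     (start A, start B) \<in> R \<and>
     (\<forall>(s, t) \<in> R.
        (\<forall>s'. (s, s') \<in> steps A \<longrightarrow> (\<exists>t'. (t, t') \<in> steps B \<and> (s', t') \<in> R)) \<and>
        (\<forall>t'. (t, t') \<in> steps B \<longrightarrow> (\<exists>s'. (s, s') \<in> steps A \<and> (s', t') \<in> R)))"

definition bisimilar :: "'a tsys \<Rightarrow> 'b tsys \<Rightarrow> bool" where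
  "bisimilar A B \<longleftrightarrow> (\<exists>R. bisimulation A B R)"

definition cls :: "('k, 'n::infinite) proc \<Rightarrow> ('k, 'n) proc set" where
  "cls P = {Q. scong P Q}"

definition reachable_procs :: "('k, 'n::infinite) fcp_spec \<Rightarrow> ('k, 'n) proc set" where
  "reachable_procs F = {G. (react (eqs F))\<^sup>*\<^sup>* (fcp_proc F) G}"

definition fcp_tsys :: "('k, 'n::infinite) fcp_spec \<Rightarrow> ('k, 'n) proc set tsys" where
  "fcp_tsys F =
     \<lparr>states = cls ` reachable_procs F,
      steps = {(cls G, cls G') |G G'. G \<in> reachable_procs F \<and> react (eqs F) G G'},
      start = cls (fcp_proc F)\<rparr>"

definition stable_tsys ::
  "('k, 'n::linorder) fcp_spec \<Rightarrow> ('k, 'n) marking \<Rightarrow> ('k, 'n) marking tsys" where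
  "stable_tsys F Ms =
     \<lparr>states = stable_reachable F Ms,
      steps = {(M, M'). M \<in> stable_reachable F Ms \<and> M' \<in> stable_reachable F Ms \<and>
                 stable_step F Ms M M'},
      start = initial (net F Ms)\<rparr>"


section \<open>The relation between process classes and markings\<close>

definition call_free_step :: "('k, 'n::linorder) fcp_spec \<Rightarrow> (('k, 'n) aug \<times> ('k, 'n) aug) set" where
  "call_free_step F = {((c, l), q). ((c, l), q) \<in> cf_step F \<and> (\<exists>S. c = Thr S \<and> \<not> is_call S)}"

definition derived :: "('k, 'n::linorder) fcp_spec \<Rightarrow> ('k, 'n) proc \<Rightarrow> 'n list \<Rightarrow> bool" where
  "derived F S l \<longleftrightarrow>
     (is_choice S \<or> is_call S) \<and>
     (\<exists>K \<in> dom (eqs F). ((Thr (body F K), []), (Thr S, l)) \<in> (call_free_step F)\<^sup>*)"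

definition subst_part :: "('k, 'n) fcp_spec \<Rightarrow> ('k, 'n) marking \<Rightarrow> ('k, 'n) marking" where
  "subst_part F M = (\<lambda>p. if p \<in> subst_places F then M p else 0)"

definition represents ::
  "('k, 'n::{infinite,linorder}) fcp_spec \<Rightarrow> ('k, 'n) proc \<Rightarrow> ('k, 'n) marking \<Rightarrow> bool" where
  "represents F G M \<longleftrightarrow>
     (\<exists>rs Ss ls \<sigma>s.
        length Ss = nthreads F \<and> length ls = nthreads F \<and> length \<sigma>s = nthreads F \<and>
        distinct rs \<and>
        scong G (res_list rs (par_list (map2 msubst \<sigma>s Ss))) \<and>
        (\<forall>i < nthreads F.
           derived F (Ss ! i) (ls ! i) \<and>
           dom (\<sigma>s ! i) = fn (Ss ! i) \<union> set (ls ! i) \<and>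
           ran (\<sigma>s ! i) \<subseteq> set rs \<union> PUB F \<and>
           M (Ctrl i (Thr (Ss ! i), ls ! i)) = 1) \<and>
        corresponds F (set rs) (map_union \<sigma>s) (subst_part F M))"

definition bisim_rel ::
  "('k, 'n::{infinite,linorder}) fcp_spec \<Rightarrow> ('k, 'n) marking \<Rightarrow>
     (('k, 'n) proc set \<times> ('k, 'n) marking) set" where
  "bisim_rel F Ms =
     {(cls G, M) |G M. G \<in> reachable_procs F \<and> M \<in> stable_reachable F Ms \<and> represents F G M}"

end

theory Submission
  imports Defs "HOL-Library.Multiset"
begin

text \<open>
  Every reachable marking is described by a control place for each thread together with a
  valuation of the mapped names in \<open>PUB \<union> NEW\<close>. Reading a half-processed call
  \<open>K\<lfloor>x\<^sub>1..x\<^sub>m\<rfloor>\<close> as the full call whose missing arguments are the formal parameters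
  \<open>f\<^sub>m\<^sub>+\<^sub>1..f\<^sub>k\<close> that already carry their values, each such state denotes a process
  \<open>\<nu>r.(S\<^sub>1\<sigma> | \<dots> | S\<^sub>n\<sigma>)\<close>. Transitions for \<open>\<nu>\<close>, parameter passing and unmapping leave this
  process unchanged up to structural congruence, whereas the transitions counted by race
  freedom are exactly the reactions. Conversely, a reaction of a process in this form
  comes from a redex among its threads, because structural congruence preserves the prenex
  form up to the choice of the restricted names; such a redex can be fired, the pending
  restrictions can then be resolved since \<open>NEW\<close> is large enough, and a stable marking is reached.
\<close>

section \<open>Substitution and structural congruence\<close>

text \<open>\<open>scong\<close> is closed under symmetry and transitivity, and \<alpha>-conversion
  may occur anywhere, so a reaction cannot be inverted by syntax alone. Besides, substitutions
  compose only up to congruence, since two renamings in succession may end at another binder than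
  the composed one. Processes are therefore read under an environment: names for unguarded
  restrictions are chosen outside the process, and guarded inputs are compared through their
  instances. On the net side, values in \<open>NEW\<close> are recycled by unmapping, whereas
  restricted names of the process only accumulate. As no fixed translation between them exists, a
  state carries two maps with one domain, \<open>\<sigma>\<close> into process names and
  \<open>ev\<close> into net values, tied together by having the same equalities between entries
  (\<open>agree\<close>). \<open>NEW\<close> is large enough because each name in
  \<open>INP\<close>, \<open>FRM\<close> and \<open>RESTR\<close> holds at most one value, and the
  restricted name about to be mapped holds none: live names of a thread belong to one body, plus the
  formal parameters of a call under way.\<close>

lemma proc_induct [case_names Call Choice Res Par]:
  assumes "\<And>K as. Q (Call K as)"
    and "\<And>bs. (\<And>\<pi> P. (\<pi>, P) \<in> set bs \<Longrightarrow> Q P) \<Longrightarrow> Q (Choice bs)"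
    and "\<And>r P. Q P \<Longrightarrow> Q (Res r P)"
    and "\<And>P P'. Q P \<Longrightarrow> Q P' \<Longrightarrow> Q (Par P P')"
  shows "Q P"
proof (induction P)
  case (Choice bs)
  then show ?case using assms(2)[of bs] by (metis snds.intros sndI)
qed (use assms in auto)

text \<open>A name for the anonymous function in the \<open>Choice\<close> clause of
  \<open>subst\<close>: substitution in a choice becomes a plain \<open>map\<close>, and branches
  can be compared one at a time.\<close>

fun subst_branch ::
  "('n::infinite \<Rightarrow> 'n) \<Rightarrow> 'n prefix \<times> ('k, 'n) proc \<Rightarrow> 'n prefix \<times> ('k, 'n) proc" where
  "subst_branch \<theta> (Out a b, P) = (Out (\<theta> a) (\<theta> b), subst \<theta> P)"
| "subst_branch \<theta> (Inp a x, P) = (Inp (\<theta> a) (avoid x (\<theta> ` (fn P - {x}))),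
                  subst (\<theta>(x := avoid x (\<theta> ` (fn P - {x})))) P)"
| "subst_branch \<theta> (Tau, P) = (Tau, subst \<theta> P)"

lemma subst_Choice: "subst \<theta> (Choice bs) = Choice (map (subst_branch \<theta>) bs)"
  by (auto split: prefix.splits)

declare subst.simps(2) [simp del]
declare subst_Choice [simp]

section \<open>Free names under substitution\<close>

lemma finite_fn [simp]: "finite (fn P)"
proof (induction P rule: proc_induct)
  case (Choice bs)
  have "finite (fn_prefixed \<pi> (fn P))" if "(\<pi>, P) \<in> set bs" for \<pi> P
    using Choice[OF that] by (cases \<pi>) auto
  then show ?case by auto
qed auto

lemma avoid_fresh: "finite X \<Longrightarrow> avoid x X \<notin> X"
  unfolding avoid_def by (metis (full_types) arb_element someI_ex)

lemma image_upd_diff: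
  assumes "u \<notin> \<theta> ` (X - {x})"
  shows "(\<theta>(x := u)) ` X - {u} = \<theta> ` (X - {x})"
proof
  show "(\<theta>(x := u)) ` X - {u} \<subseteq> \<theta> ` (X - {x})" by auto
  show "\<theta> ` (X - {x}) \<subseteq> (\<theta>(x := u)) ` X - {u}"
  proof
    fix y assume y: "y \<in> \<theta> ` (X - {x})"
    then obtain z where "z \<in> X" "z \<noteq> x" "y = \<theta> z" by blast
    then have "(\<theta>(x := u)) z = y" by simp
    then show "y \<in> (\<theta>(x := u)) ` X - {u}" using \<open>z \<in> X\<close> y assms by blast
  qed
qed

lemma fn_subst: "fn (subst \<theta> P) = \<theta> ` fn P"
proof (induction P arbitrary: \<theta> rule: proc_induct)
  case (Choice bs)
  have "fn_prefixed (fst (subst_branch \<theta> b)) (fn (snd (subst_branch \<theta> b)))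
      = \<theta> ` fn_prefixed (fst b) (fn (snd b))" if "b \<in> set bs" for b
  proof -
    obtain \<pi> P where b: "b = (\<pi>, P)" by force
    have IH: "fn (subst \<theta> P) = \<theta> ` fn P" for \<theta> using Choice that b by auto
    show ?thesis
    proof (cases \<pi>)
      case (Inp a x)
      have "avoid x (\<theta> ` (fn P - {x})) \<notin> \<theta> ` (fn P - {x})" by (rule avoid_fresh) simp
      from image_upd_diff[OF this] show ?thesis using Inp IH b by (simp add: image_Un)
    qed (auto simp: b IH)
  qed
  then show ?case by (auto simp: case_prod_beta)
next
  case (Res r P)
  have "avoid r (\<theta> ` (fn P - {r})) \<notin> \<theta> ` (fn P - {r})" by (rule avoid_fresh) simp
  from image_upd_diff[OF this] show ?case using Res by simp
qed auto

text \<open>Literal equality, not just congruence: the binder chosen by \<open>avoid\<close> depends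
  on the map only through its image of the free names, so maps agreeing on the free names rename
  alike.\<close>

lemma subst_cong:
  "(\<And>x. x \<in> fn P \<Longrightarrow> \<theta> x = \<theta>' x) \<Longrightarrow> subst \<theta> P = subst \<theta>' P"
proof (induction P arbitrary: \<theta> \<theta>' rule: proc_induct)
  case (Choice bs)
  have "subst_branch \<theta> b = subst_branch \<theta>' b" if "b \<in> set bs" for b
  proof -
    obtain \<pi> P where b: "b = (\<pi>, P)" by force
    have sub: "fn_prefixed \<pi> (fn P) \<subseteq> fn (Choice bs)" using that b by auto
    have IH: "subst \<theta> P = subst \<theta>' P" if "\<And>x. x \<in> fn P \<Longrightarrow> \<theta> x = \<theta>' x" for \<theta> \<theta>'
      by (rule Choice.IH[OF _ that]) (use \<open>b \<in> set bs\<close> b in simp_all)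
    have eqv: "\<theta> x = \<theta>' x" if "x \<in> fn_prefixed \<pi> (fn P)" for x
      using Choice.prems sub that by blast
    show ?thesis
    proof (cases \<pi>)
      case (Inp a x)
      have eq: "\<theta> ` (fn P - {x}) = \<theta>' ` (fn P - {x})"
        using eqv Inp by (intro image_cong) auto
      have "\<theta> a = \<theta>' a" using eqv Inp by auto
      moreover have "subst (\<theta>(x := y)) P = subst (\<theta>'(x := y)) P" for y
        using eqv Inp by (intro IH) auto
      ultimately show ?thesis unfolding b Inp by (simp add: eq)
    next
      case (Out a b')
      then show ?thesis using b eqv by (auto intro!: IH)
    next
      case Tau
      then show ?thesis using b eqv by (auto intro!: IH)
    qed
  qed
  then show ?case by simp
next
  case (Res r P)
  have eq: "\<theta> ` (fn P - {r}) = \<theta>' ` (fn P - {r})"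
    using Res.prems by (intro image_cong) auto
  have "subst (\<theta>(r := y)) P = subst (\<theta>'(r := y)) P" for y
    using Res.prems by (intro Res.IH) auto
  then show ?case by (simp add: eq)
next
  case (Par P Q)
  then show ?case by (metis Un_iff fn.simps(4) subst.simps(4))
qed auto

lemma avoid_id: "avoid x (X - {x}) = x"
  by (simp add: avoid_def)

lemma id_upd_same [simp]: "id(x := x) = id" "(\<lambda>a. a)(x := x) = (\<lambda>a. a)"
  by auto

text \<open>Relies on \<open>avoid\<close> keeping a binder that does not clash.\<close>

lemma subst_id [simp]: "subst id P = P"
proof (induction P rule: proc_induct)
  case (Choice bs)
  have "subst_branch id b = b" if "b \<in> set bs" for b
  proof -
    obtain \<pi> P where b: "b = (\<pi>, P)" by force
    have "subst id P = P" by (rule Choice) (use that b in simp)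
    then show ?thesis unfolding b by (cases \<pi>) (auto simp: avoid_id)
  qed
  then show ?case unfolding subst_Choice by (subst map_idI) simp_all
qed (auto simp: avoid_id)

section \<open>Congruence of branches and composition of substitutions\<close>

lemma app_map_single: "app_map [x \<mapsto> y] = id(x := y)"
  by (auto simp: app_map_def)

text \<open>A branch is not a process, so \<open>scong\<close> does not apply to it directly; two
  branches count as congruent if they can be exchanged inside every choice.\<close>

definition branch_cong ::
  "'n::infinite prefix \<times> ('k, 'n) proc \<Rightarrow> 'n prefix \<times> ('k, 'n) proc \<Rightarrow> bool" where
  "branch_cong b c \<longleftrightarrow> (\<forall>bs cs. scong (Choice (bs @ b # cs)) (Choice (bs @ c # cs)))"

lemma branch_cong_refl: "branch_cong b b"
  by (simp add: branch_cong_def sc_refl)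

lemma branch_cong_sym: "branch_cong b c \<Longrightarrow> branch_cong c b"
  by (meson branch_cong_def sc_sym)

lemma branch_cong_trans: "branch_cong b c \<Longrightarrow> branch_cong c d \<Longrightarrow> branch_cong b d"
  by (meson branch_cong_def sc_trans)

lemma branch_cong_cont: "scong P Q \<Longrightarrow> branch_cong (\<pi>, P) (\<pi>, Q)"
  by (simp add: branch_cong_def sc_cong_choice)

lemma scong_Choice:
  assumes "list_all2 branch_cong bs cs"
  shows "scong (Choice bs) (Choice cs)"
proof -
  \<comment> \<open>The congruence rules exchange one branch at a time; \<open>ds\<close> holds the
    branches already exchanged.\<close>
  have "scong (Choice (ds @ bs)) (Choice (ds @ cs))" for ds
    using assms
  proof (induction bs cs arbitrary: ds rule: list_all2_induct)
    case (Cons b bs c cs)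
    have "scong (Choice (ds @ b # bs)) (Choice (ds @ c # bs))"
      using Cons.hyps(1) by (simp add: branch_cong_def)
    moreover have "scong (Choice ((ds @ [c]) @ bs)) (Choice ((ds @ [c]) @ cs))"
      by (rule Cons.IH)
    ultimately show ?case by (auto intro: sc_trans)
  qed (simp add: sc_refl)
  from this[of "[]"] show ?thesis by simp
qed

text \<open>Equality fails: two renamings of a binder in succession may end at \<open>v\<close>
  where the composed map picks \<open>w\<close>. Both avoid the images of the other free names, so
  one \<alpha>-conversion from \<open>v\<close> to \<open>w\<close> closes the gap under each
  binder.\<close>

lemma scong_subst_comp:
  fixes P :: "('k, 'n::infinite) proc"
  shows "scong (subst \<rho> (subst \<theta> P)) (subst (\<rho> \<circ> \<theta>) P)"
proof (induction P arbitrary: \<rho> \<theta> rule: proc_induct)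
  case (Choice bs)
  have "branch_cong (subst_branch \<rho> (subst_branch \<theta> b)) (subst_branch (\<rho> \<circ> \<theta>) b)"
    if "b \<in> set bs" for b
  proof -
    obtain \<pi> P where b: "b = (\<pi>, P)" by force
    have IH: "scong (subst \<rho> (subst \<theta> P)) (subst (\<rho> \<circ> \<theta>) P)" for \<rho> \<theta>
      by (rule Choice) (use that b in simp)
    show ?thesis
    proof (cases \<pi>)
      case (Inp a x)
      define u where "u = avoid x (\<theta> ` (fn P - {x}))"
      define v where "v = avoid u (\<rho> ` (fn (subst (\<theta>(x := u)) P) - {u}))"
      define w where "w = avoid x ((\<rho> \<circ> \<theta>) ` (fn P - {x}))"
      have u: "u \<notin> \<theta> ` (fn P - {x})" unfolding u_def by (rule avoid_fresh) simp
      have v: "v \<notin> \<rho> ` (fn (subst (\<theta>(x := u)) P) - {u})" unfolding v_def by (rule avoid_fresh) simp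
      have w: "w \<notin> (\<rho> \<circ> \<theta>) ` (fn P - {x})" unfolding w_def by (rule avoid_fresh) simp
      let ?Q = "\<lambda>v. subst ((\<rho> \<circ> \<theta>)(x := v)) P"
      have eq: "subst (\<rho>(u := v) \<circ> \<theta>(x := u)) P = ?Q v"
        using u by (intro subst_cong) auto
      have 1: "branch_cong (Inp (\<rho> (\<theta> a)) v, subst (\<rho>(u := v)) (subst (\<theta>(x := u)) P)) (Inp (\<rho> (\<theta> a)) v, ?Q v)"
        using IH[of "\<rho>(u := v)" "\<theta>(x := u)"] by (simp add: eq branch_cong_cont)
      have v': "v \<notin> (\<rho> \<circ> \<theta>) ` (fn P - {x})"
        using v u unfolding fn_subst by (auto simp: image_iff)
      have 2: "branch_cong (Inp (\<rho> (\<theta> a)) v, ?Q v) (Inp (\<rho> (\<theta> a)) w, ?Q w)"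
      proof (cases "w = v")
        case False
        then have "w \<notin> fn (?Q v)" using w by (auto simp: fn_subst split: if_splits)
        then have 3: "branch_cong (Inp (\<rho> (\<theta> a)) v, ?Q v) (Inp (\<rho> (\<theta> a)) w, subst (id(v := w)) (?Q v))"
          unfolding branch_cong_def app_map_single[symmetric] using sc_alpha_inp by blast
        have 4: "subst (id(v := w) \<circ> (\<rho> \<circ> \<theta>)(x := v)) P = ?Q w"
          using v' by (intro subst_cong) auto
        have "scong (subst (id(v := w)) (?Q v)) (?Q w)"
          by (subst 4[symmetric]) (rule IH)
        from branch_cong_trans[OF 3 branch_cong_cont[OF this]] show ?thesis .
      qed (simp add: branch_cong_refl)
      have "(\<rho> \<circ> \<theta>) a = \<rho> (\<theta> a)" by simp
      then show ?thesis using branch_cong_trans[OF 1 2] unfolding b Inp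
        by (simp only: subst_branch.simps u_def[symmetric] v_def[symmetric] w_def[symmetric])
    qed (auto simp: b intro: IH branch_cong_cont)
  qed
  then show ?case unfolding subst_Choice
    by (intro scong_Choice) (simp only: list_all2_map1 list_all2_map2 list.rel_refl_strong)
next
  case (Res r P)
  define u where "u = avoid r (\<theta> ` (fn P - {r}))"
  define v where "v = avoid u (\<rho> ` (fn (subst (\<theta>(r := u)) P) - {u}))"
  define w where "w = avoid r ((\<rho> \<circ> \<theta>) ` (fn P - {r}))"
  have u: "u \<notin> \<theta> ` (fn P - {r})" unfolding u_def by (rule avoid_fresh) simp
  have v: "v \<notin> \<rho> ` (fn (subst (\<theta>(r := u)) P) - {u})" unfolding v_def by (rule avoid_fresh) simp
  have w: "w \<notin> (\<rho> \<circ> \<theta>) ` (fn P - {r})" unfolding w_def by (rule avoid_fresh) simp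
  let ?Q = "\<lambda>v. subst ((\<rho> \<circ> \<theta>)(r := v)) P"
  have eq: "subst (\<rho>(u := v) \<circ> \<theta>(r := u)) P = ?Q v"
    using u by (intro subst_cong) auto
  have 1: "scong (Res v (subst (\<rho>(u := v)) (subst (\<theta>(r := u)) P))) (Res v (?Q v))"
    unfolding eq[symmetric] by (intro sc_cong_res Res)
  have v': "v \<notin> (\<rho> \<circ> \<theta>) ` (fn P - {r})"
    using v u unfolding fn_subst by (auto simp: image_iff)
  have 2: "scong (Res v (?Q v)) (Res w (?Q w))"
  proof (cases "w = v")
    case False
    then have "w \<notin> fn (?Q v)" using w by (auto simp: fn_subst split: if_splits)
    then have 3: "scong (Res v (?Q v)) (Res w (subst (id(v := w)) (?Q v)))"
      unfolding app_map_single[symmetric] by (rule sc_alpha_res)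
    have 4: "subst (id(v := w) \<circ> (\<rho> \<circ> \<theta>)(r := v)) P = ?Q w"
      using v' by (intro subst_cong) auto
    have "scong (subst (id(v := w)) (?Q v)) (?Q w)"
      by (subst 4[symmetric]) (rule Res)
    from sc_trans[OF 3 sc_cong_res[OF this]] show ?thesis .
  qed (simp add: sc_refl)
  show ?case using sc_trans[OF 1 2]
    by (simp only: subst.simps u_def[symmetric] v_def[symmetric] w_def[symmetric])
qed (auto intro: sc_refl sc_cong_par)

text \<open>Instantiating a binder that has been renamed to \<open>u\<close> forgets
  \<open>u\<close> altogether. This is how the arbitrary choices of \<open>avoid\<close> drop out of
  \<alpha>-conversion, communication and prenex forms.\<close>

lemma scong_subst_upd_comp:
  assumes "u \<notin> \<phi> ` (fn P - {x})"
  shows "scong (subst (\<rho>(u := z)) (subst (\<phi>(x := u)) P)) (subst ((\<rho> \<circ> \<phi>)(x := z)) P)"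
proof -
  have "subst (\<rho>(u := z) \<circ> \<phi>(x := u)) P = subst ((\<rho> \<circ> \<phi>)(x := z)) P"
    using assms by (intro subst_cong) auto
  then show ?thesis using scong_subst_comp[of "\<rho>(u := z)" "\<phi>(x := u)" P] by simp
qed

text \<open>Replaces the binder chosen by \<open>avoid\<close> with any other fresh one, so that two
  restrictions can be brought to a common binder.\<close>

lemma scong_subst_Res:
  assumes "v \<notin> \<phi> ` (fn P - {r})"
  shows "scong (subst \<phi> (Res r P)) (Res v (subst (\<phi>(r := v)) P))"
proof -
  define u where "u = avoid r (\<phi> ` (fn P - {r}))"
  have u: "u \<notin> \<phi> ` (fn P - {r})" unfolding u_def by (rule avoid_fresh) simp
  have "scong (Res u (subst (\<phi>(r := u)) P)) (Res v (subst (\<phi>(r := v)) P))"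
  proof (cases "u = v")
    case False
    then have "v \<notin> fn (subst (\<phi>(r := u)) P)"
      using assms by (auto simp: fn_subst split: if_splits)
    then have "scong (Res u (subst (\<phi>(r := u)) P)) (Res v (subst (id(u := v)) (subst (\<phi>(r := u)) P)))"
      unfolding app_map_single[symmetric] by (rule sc_alpha_res)
    then show ?thesis
      using scong_subst_upd_comp[OF u, of id v] by (auto intro: sc_trans sc_cong_res)
  qed (simp add: sc_refl)
  then show ?thesis by (simp add: u_def)
qed

lemma branch_cong_subst_Inp:
  assumes "v \<notin> \<phi> ` (fn P - {x})"
  shows "branch_cong (subst_branch \<phi> (Inp a x, P)) (Inp (\<phi> a) v, subst (\<phi>(x := v)) P)"
proof -
  define u where "u = avoid x (\<phi> ` (fn P - {x}))"
  have u: "u \<notin> \<phi> ` (fn P - {x})" unfolding u_def by (rule avoid_fresh) simp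
  have "branch_cong (Inp (\<phi> a) u, subst (\<phi>(x := u)) P) (Inp (\<phi> a) v, subst (\<phi>(x := v)) P)"
  proof (cases "u = v")
    case False
    then have "v \<notin> fn (subst (\<phi>(x := u)) P)"
      using assms by (auto simp: fn_subst split: if_splits)
    then have "branch_cong (Inp (\<phi> a) u, subst (\<phi>(x := u)) P)
        (Inp (\<phi> a) v, subst (id(u := v)) (subst (\<phi>(x := u)) P))"
      unfolding branch_cong_def app_map_single[symmetric] using sc_alpha_inp by blast
    then show ?thesis
      using scong_subst_upd_comp[OF u, of id v] by (auto intro: branch_cong_trans branch_cong_cont)
  qed (simp add: branch_cong_refl)
  then show ?thesis by (simp add: u_def)
qed

lemma fn_scong: "scong P Q \<Longrightarrow> fn P = fn Q"
proof (induction rule: scong.induct)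
  case (sc_cong_choice P Q bs \<pi> cs)
  then show ?case by (cases \<pi>) auto
qed (auto simp: fn_subst app_map_single split: if_splits)

lemma scong_subst: "scong P Q \<Longrightarrow> scong (subst \<theta> P) (subst \<theta> Q)"
proof (induction arbitrary: \<theta> rule: scong.induct)
  case (sc_sym P Q)
  from scong.sc_sym[OF this(2)] show ?case .
next
  case (sc_trans P Q R)
  from scong.sc_trans[OF this(3,4)] show ?case .
next
  case (sc_cong_choice P Q bs \<pi> cs)
  have "branch_cong (subst_branch \<theta> (\<pi>, P)) (subst_branch \<theta> (\<pi>, Q))"
    using sc_cong_choice.IH fn_scong[OF sc_cong_choice.hyps]
    by (cases \<pi>) (auto intro: branch_cong_cont)
  then show ?case by (simp add: branch_cong_def)
next
  case (sc_cong_res P Q r)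
  then show ?case using fn_scong[OF sc_cong_res.hyps] by (auto intro: scong.sc_cong_res)
next
  case (sc_alpha_res r' P r)
  \<comment> \<open>A binder fresh for both sides: both substituted restrictions are renamed to it,
    after which only the two instances of \<open>P\<close> remain to be compared.\<close>
  obtain v where v: "v \<notin> \<theta> ` (fn P - {r}) \<union> \<theta> ` (fn (subst (id(r := r')) P) - {r'})"
    using arb_element[of "\<theta> ` (fn P - {r}) \<union> \<theta> ` (fn (subst (id(r := r')) P) - {r'})"] by auto
  have "scong (subst \<theta> (Res r P)) (Res v (subst (\<theta>(r := v)) P))"
    using v by (intro scong_subst_Res) auto
  moreover have "scong (subst \<theta> (Res r' (subst (id(r := r')) P)))
      (Res v (subst (\<theta>(r' := v)) (subst (id(r := r')) P)))"
    using v by (intro scong_subst_Res) auto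
  moreover have "scong (subst (\<theta>(r' := v)) (subst (id(r := r')) P)) (subst (\<theta>(r := v)) P)"
    using scong_subst_upd_comp[of r' id P r \<theta> v] sc_alpha_res by auto
  ultimately show ?case unfolding app_map_single
    by (meson scong.sc_cong_res scong.sc_sym scong.sc_trans)
next
  case (sc_alpha_inp y' P bs a y cs)
  let ?Q = "subst (id(y := y')) P"
  obtain v where v: "v \<notin> \<theta> ` (fn P - {y}) \<union> \<theta> ` (fn ?Q - {y'})"
    using arb_element[of "\<theta> ` (fn P - {y}) \<union> \<theta> ` (fn ?Q - {y'})"] by auto
  have "branch_cong (subst_branch \<theta> (Inp a y, P)) (Inp (\<theta> a) v, subst (\<theta>(y := v)) P)"
    using v by (intro branch_cong_subst_Inp) auto
  moreover have "branch_cong (subst_branch \<theta> (Inp a y', ?Q)) (Inp (\<theta> a) v, subst (\<theta>(y' := v)) ?Q)"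
    using v by (intro branch_cong_subst_Inp) auto
  moreover have "scong (subst (\<theta>(y' := v)) ?Q) (subst (\<theta>(y := v)) P)"
    using scong_subst_upd_comp[of y' id P y \<theta> v] sc_alpha_inp by auto
  ultimately have "branch_cong (subst_branch \<theta> (Inp a y, P)) (subst_branch \<theta> (Inp a y', ?Q))"
    by (meson branch_cong_cont branch_cong_sym branch_cong_trans)
  then show ?case unfolding app_map_single by (simp add: branch_cong_def del: subst_branch.simps)
next
  case (sc_res_nil r)
  then show ?case by (simp add: scong.sc_res_nil)
next
  case (sc_res_swap r1 r2 P)
  show ?case
  proof (cases "r1 = r2")
    case False
    \<comment> \<open>Two fresh names, the second also different from the first, so that exchanging
      the renamed binders captures nothing.\<close>
    obtain v1 where v1: "v1 \<notin> \<theta> ` fn P" using arb_element[of "\<theta> ` fn P"] by auto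
    obtain v2 where v2: "v2 \<notin> insert v1 (\<theta> ` fn P)"
      using arb_element[of "insert v1 (\<theta> ` fn P)"] by auto
    have 1: "scong (subst \<theta> (Res r1 (Res r2 P))) (Res v1 (subst (\<theta>(r1 := v1)) (Res r2 P)))"
      using v1 by (intro scong_subst_Res) auto
    have 2: "scong (subst (\<theta>(r1 := v1)) (Res r2 P)) (Res v2 (subst (\<theta>(r1 := v1, r2 := v2)) P))"
      using v2 by (intro scong_subst_Res) auto
    have 3: "scong (subst \<theta> (Res r2 (Res r1 P))) (Res v2 (subst (\<theta>(r2 := v2)) (Res r1 P)))"
      using v2 by (intro scong_subst_Res) auto
    have 4: "scong (subst (\<theta>(r2 := v2)) (Res r1 P)) (Res v1 (subst (\<theta>(r1 := v1, r2 := v2)) P))"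
      unfolding fun_upd_twist[OF False] using v1 v2 by (intro scong_subst_Res) auto
    show ?thesis
      using scong.sc_trans[OF 1 scong.sc_cong_res[OF 2]] scong.sc_trans[OF 3 scong.sc_cong_res[OF 4]]
      by (meson scong.sc_res_swap scong.sc_sym scong.sc_trans)
  qed (simp add: sc_refl)
next
  case (sc_scope r P1 P2)
  obtain v where v: "v \<notin> \<theta> ` fn P1 \<union> \<theta> ` fn P2"
    using arb_element[of "\<theta> ` fn P1 \<union> \<theta> ` fn P2"] by auto
  have 1: "scong (subst \<theta> (Res r (Par P1 P2))) (Res v (subst (\<theta>(r := v)) (Par P1 P2)))"
    using v by (intro scong_subst_Res) auto
  have 2: "scong (subst \<theta> (Res r P2)) (Res v (subst (\<theta>(r := v)) P2))"
    using v by (intro scong_subst_Res) auto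
  have 3: "subst (\<theta>(r := v)) P1 = subst \<theta> P1"
    using sc_scope by (intro subst_cong) auto
  have 4: "scong (Res v (Par (subst \<theta> P1) (subst (\<theta>(r := v)) P2)))
      (Par (subst \<theta> P1) (Res v (subst (\<theta>(r := v)) P2)))"
    using v by (intro scong.sc_scope) (auto simp: fn_subst)
  have "scong (subst \<theta> (Res r (Par P1 P2))) (Par (subst \<theta> P1) (Res v (subst (\<theta>(r := v)) P2)))"
    using scong.sc_trans[OF 1] 4 by (simp only: subst.simps(4) 3)
  then show ?case unfolding subst.simps(4)
    using 2 by (meson scong.sc_cong_par scong.sc_refl scong.sc_sym scong.sc_trans)
qed (simp_all add: scong.sc_refl scong.sc_cong_par scong.sc_par_assoc scong.sc_par_comm scong.sc_par_unit)

declare sc_trans [trans]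

section \<open>Parallel compositions and restrictions of lists\<close>

lemma scong_par_list_Cons: "scong (par_list (P # Ps)) (Par P (par_list Ps))"
  by (cases Ps) (auto intro: sc_refl sc_sym[OF sc_par_unit])

lemma scong_Nil_Par: "scong (Par Nil0 P) P"
  by (meson sc_par_comm sc_par_unit sc_trans)

lemma scong_par_list_append: "scong (par_list (As @ Bs)) (Par (par_list As) (par_list Bs))"
proof (induction As)
  case Nil
  then show ?case by (simp add: sc_sym[OF scong_Nil_Par])
next
  case (Cons A As)
  have "scong (par_list ((A # As) @ Bs)) (Par A (par_list (As @ Bs)))"
    using scong_par_list_Cons by simp
  also have "scong \<dots> (Par A (Par (par_list As) (par_list Bs)))"
    by (intro sc_cong_par sc_refl Cons)
  also have "scong \<dots> (Par (Par A (par_list As)) (par_list Bs))"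
    by (rule sc_par_assoc)
  also have "scong \<dots> (Par (par_list (A # As)) (par_list Bs))"
    by (intro sc_cong_par sc_refl sc_sym[OF scong_par_list_Cons])
  finally show ?case .
qed

lemma scong_par_left_comm: "scong (Par P (Par Q R)) (Par Q (Par P R))"
  by (meson sc_cong_par sc_par_assoc sc_par_comm sc_refl sc_sym sc_trans)

lemma scong_par_list_mset:
  "mset As = mset Bs \<Longrightarrow> scong (par_list As) (par_list Bs)"
proof (induction As arbitrary: Bs)
  case Nil
  then show ?case by (simp add: sc_refl)
next
  case (Cons A As)
  then have "A \<in> set Bs" by (metis list.set_intros(1) mset_eq_setD)
  then obtain Xs Ys where Bs: "Bs = Xs @ A # Ys" by (meson split_list)
  then have "mset As = mset (Xs @ Ys)" using Cons.prems by simp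
  from Cons.IH[OF this] have IH: "scong (par_list As) (par_list (Xs @ Ys))" .
  have "scong (par_list (A # As)) (Par A (par_list As))" by (rule scong_par_list_Cons)
  also have "scong \<dots> (Par A (Par (par_list Xs) (par_list Ys)))"
    using IH scong_par_list_append by (meson sc_cong_par sc_refl sc_trans)
  also have "scong \<dots> (Par (par_list Xs) (Par A (par_list Ys)))"
    by (rule scong_par_left_comm)
  also have "scong \<dots> (Par (par_list Xs) (par_list (A # Ys)))"
    by (intro sc_cong_par sc_refl sc_sym[OF scong_par_list_Cons])
  also have "scong \<dots> (par_list Bs)"
    unfolding Bs by (rule sc_sym[OF scong_par_list_append])
  finally show ?case .
qed

lemma scong_par_list_cong:
  "list_all2 scong As Bs \<Longrightarrow> scong (par_list As) (par_list Bs)"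
proof (induction rule: list_all2_induct)
  case (Cons A As B Bs)
  then show ?case
    by (meson sc_cong_par sc_sym sc_trans scong_par_list_Cons)
qed (simp add: sc_refl)

lemma scong_par_list_rel_mset:
  assumes "rel_mset scong (mset As) (mset Bs)"
  shows "scong (par_list As) (par_list Bs)"
proof -
  obtain xs ys where "mset xs = mset As" "mset ys = mset Bs" "list_all2 scong xs ys"
    using assms by (auto simp: rel_mset_def)
  then show ?thesis
    by (metis (no_types) sc_trans scong_par_list_cong scong_par_list_mset)
qed

lemma fn_par_list: "fn (par_list As) = (\<Union>A \<in> set As. fn A)"
  by (induction As rule: par_list.induct) auto

lemma res_list_simps [simp]:
  "res_list [] P = P"
  "res_list (r # rs) P = Res r (res_list rs P)"
  "res_list (rs @ rs') P = res_list rs (res_list rs' P)"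
  by (auto simp: res_list_def)

lemma fn_res_list: "fn (res_list rs P) = fn P - set rs"
  by (induction rs) auto

lemma scong_res_list_cong: "scong P Q \<Longrightarrow> scong (res_list rs P) (res_list rs Q)"
  by (induction rs) (auto intro: sc_cong_res)

text \<open>The rules of \<open>scong\<close> remove a restriction only in front of
  \<open>0\<close>. Adding \<open>0\<close> as a parallel unit gives the restriction a place to
  retreat to.\<close>

lemma scong_Res_unused:
  assumes "r \<notin> fn P"
  shows "scong (Res r P) P"
proof -
  have "scong (Res r P) (Res r (Par P Nil0))"
    by (intro sc_cong_res sc_sym[OF sc_par_unit])
  also have "scong \<dots> (Par P (Res r Nil0))" using assms by (rule sc_scope)
  also have "scong \<dots> (Par P Nil0)" by (intro sc_cong_par sc_refl sc_res_nil)
  also have "scong \<dots> P" by (rule sc_par_unit)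
  finally show ?thesis .
qed

lemma scong_Res_res_list: "scong (Res r (res_list rs P)) (res_list rs (Res r P))"
proof (induction rs)
  case (Cons s rs)
  have "scong (Res r (Res s (res_list rs P))) (Res s (Res r (res_list rs P)))"
    by (rule sc_res_swap)
  also have "scong \<dots> (Res s (res_list rs (Res r P)))"
    by (intro sc_cong_res Cons)
  finally show ?case by simp
qed (simp add: sc_refl)

lemma scong_res_list_mset:
  "mset rs = mset rs' \<Longrightarrow> scong (res_list rs P) (res_list rs' P)"
proof (induction rs arbitrary: rs')
  case (Cons r rs)
  then have "r \<in> set rs'" by (metis list.set_intros(1) mset_eq_setD)
  then obtain xs ys where rs': "rs' = xs @ r # ys" by (meson split_list)
  then have "mset rs = mset (xs @ ys)" using Cons.prems by simp
  from Cons.IH[OF this] have "scong (Res r (res_list rs P)) (Res r (res_list xs (res_list ys P)))"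
    by (simp add: sc_cong_res)
  also have "scong \<dots> (res_list xs (Res r (res_list ys P)))"
    by (rule scong_Res_res_list)
  finally show ?case unfolding rs' by simp
qed (simp add: sc_refl)

lemma scong_res_list_filter: "scong (res_list rs P) (res_list (filter (\<lambda>r. r \<in> fn P) rs) P)"
proof (induction rs)
  case (Cons r rs)
  then have *: "scong (res_list (r # rs) P) (Res r (res_list (filter (\<lambda>r. r \<in> fn P) rs) P))"
    by (simp add: sc_cong_res)
  show ?case
  proof (cases "r \<in> fn P")
    case False
    then have "scong (Res r (res_list (filter (\<lambda>r. r \<in> fn P) rs) P)) (res_list (filter (\<lambda>r. r \<in> fn P) rs) P)"
      by (intro scong_Res_unused) (simp add: fn_res_list)
    from sc_trans[OF * this] show ?thesis using False by simp
  qed (use * in simp)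
qed (simp add: sc_refl)

lemma scong_res_list_set:
  assumes "distinct rs" "distinct rs'" "set rs \<inter> fn P = set rs' \<inter> fn P"
  shows "scong (res_list rs P) (res_list rs' P)"
proof -
  have "set (filter (\<lambda>r. r \<in> fn P) rs) = set (filter (\<lambda>r. r \<in> fn P) rs')"
    using assms(3) by auto
  then have "mset (filter (\<lambda>r. r \<in> fn P) rs) = mset (filter (\<lambda>r. r \<in> fn P) rs')"
    using assms(1,2) by (simp only: set_eq_iff_mset_eq_distinct distinct_filter)
  from scong_res_list_mset[OF this] show ?thesis
    by (meson sc_sym sc_trans scong_res_list_filter)
qed

lemma scong_Par_res_list:
  "set rs \<inter> fn P = {} \<Longrightarrow> scong (Par P (res_list rs Q)) (res_list rs (Par P Q))"
proof (induction rs)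
  case (Cons r rs)
  have "scong (Par P (Res r (res_list rs Q))) (Res r (Par P (res_list rs Q)))"
    using Cons.prems by (intro sc_sym[OF sc_scope]) simp
  also have "scong \<dots> (Res r (res_list rs (Par P Q)))"
    using Cons by (intro sc_cong_res) auto
  finally show ?case by simp
qed (simp add: sc_refl)

text \<open>The side conditions are asymmetric because \<open>vs\<close> is pulled out first, past
  the still restricted \<open>res_list ws Q\<close>, and \<open>ws\<close> afterwards, past the bare
  \<open>P\<close>.\<close>

lemma scong_Par_res_lists:
  assumes "set vs \<inter> fn (res_list ws Q) = {}" "set ws \<inter> fn P = {}"
  shows "scong (Par (res_list vs P) (res_list ws Q)) (res_list (vs @ ws) (Par P Q))"
proof -
  have "scong (Par (res_list vs P) (res_list ws Q)) (Par (res_list ws Q) (res_list vs P))"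
    by (rule sc_par_comm)
  also have "scong \<dots> (res_list vs (Par (res_list ws Q) P))"
    using assms(1) by (rule scong_Par_res_list)
  also have "scong \<dots> (res_list vs (Par P (res_list ws Q)))"
    by (intro scong_res_list_cong sc_par_comm)
  also have "scong \<dots> (res_list vs (res_list ws (Par P Q)))"
    using assms(2) by (intro scong_res_list_cong scong_Par_res_list)
  finally show ?thesis by simp
qed

section \<open>Prenex forms\<close>

text \<open>Inputs are compared through all instances of the bound name. This makes the choice of
  binder invisible and is exactly the information that a communication uses.\<close>

fun branch_eqv ::
  "'n::infinite prefix \<times> ('k, 'n) proc \<Rightarrow> 'n prefix \<times> ('k, 'n) proc \<Rightarrow> bool" where
  "branch_eqv (Out a b, P) (Out a' b', Q) \<longleftrightarrow> a = a' \<and> b = b' \<and> scong P Q"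
| "branch_eqv (Inp a x, P) (Inp a' y, Q) \<longleftrightarrow>
     a = a' \<and> (\<forall>z. scong (subst (id(x := z)) P) (subst (id(y := z)) Q))"
| "branch_eqv (Tau, P) (Tau, Q) \<longleftrightarrow> scong P Q"
| "branch_eqv _ _ \<longleftrightarrow> False"

lemma branch_eqv_refl: "branch_eqv b b"
  by (cases "(b, b)" rule: branch_eqv.cases) (auto intro: sc_refl)

lemma branch_eqv_sym: "branch_eqv b c \<Longrightarrow> branch_eqv c b"
  by (induction b c rule: branch_eqv.induct) (auto intro: sc_sym)

lemma branch_eqv_trans:
  assumes "branch_eqv b c" "branch_eqv c d"
  shows "branch_eqv b d"
proof -
  obtain \<pi>1 P1 \<pi>2 P2 \<pi>3 P3 where "b = (\<pi>1, P1)" "c = (\<pi>2, P2)" "d = (\<pi>3, P3)"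
    by (metis surj_pair)
  then show ?thesis using assms
    by (cases \<pi>1; cases \<pi>2; cases \<pi>3; simp; meson sc_trans)
qed

lemma branch_eqv_imp_cong: "branch_eqv b c \<Longrightarrow> branch_cong b c"
proof (induction b c rule: branch_eqv.induct)
  case (2 a x P a' y Q)
  \<comment> \<open>A name fresh for both continuations is a legal new binder for both branches, and
    at this instance the continuations are congruent.\<close>
  obtain z where z: "z \<notin> fn P \<union> fn Q" using arb_element[of "fn P \<union> fn Q"] by auto
  have "branch_cong (Inp a x, P) (Inp a z, subst (id(x := z)) P)"
    using z unfolding branch_cong_def app_map_single[symmetric] by (blast intro: sc_alpha_inp)
  moreover have "branch_cong (Inp a y, Q) (Inp a z, subst (id(y := z)) Q)"
    using z unfolding branch_cong_def app_map_single[symmetric] by (blast intro: sc_alpha_inp)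
  moreover have "branch_cong (Inp a z, subst (id(x := z)) P) (Inp a z, subst (id(y := z)) Q)"
    using 2 by (intro branch_cong_cont) simp
  ultimately have "branch_cong (Inp a x, P) (Inp a y, Q)"
    by (meson branch_cong_sym branch_cong_trans)
  then show ?case using 2 by simp
qed (auto intro: branch_cong_cont)

text \<open>What remains of structural congruence on the components of a prenex form. Calls are
  rigid, and choices are matched position by position because no rule of \<open>scong\<close>
  permutes, adds or deletes branches.\<close>

inductive atom_cong :: "('k, 'n::infinite) proc \<Rightarrow> ('k, 'n) proc \<Rightarrow> bool" where
  atom_refl: "atom_cong P P"
| atom_choice: "list_all2 branch_eqv bs cs \<Longrightarrow> atom_cong (Choice bs) (Choice cs)"

lemma atom_cong_Call: "atom_cong (Call K as) B \<Longrightarrow> B = Call K as"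
  by (auto elim: atom_cong.cases)

lemma atom_cong_Choice:
  assumes "atom_cong (Choice bs) B"
  obtains cs where "B = Choice cs" "list_all2 branch_eqv bs cs"
  using assms
proof (cases rule: atom_cong.cases)
  case atom_refl
  then show ?thesis using that list.rel_refl[of branch_eqv, OF branch_eqv_refl] by blast
qed (use that in blast)

lemma atom_cong_sym: "atom_cong A B \<Longrightarrow> atom_cong B A"
proof (induction rule: atom_cong.induct)
  case (atom_choice bs cs)
  then have "list_all2 branch_eqv cs bs"
    by (metis branch_eqv_sym list_all2_conv_all_nth)
  then show ?case by (rule atom_cong.atom_choice)
qed (rule atom_refl)

lemma atom_cong_trans: "atom_cong A B \<Longrightarrow> atom_cong B C \<Longrightarrow> atom_cong A C"
proof (induction rule: atom_cong.induct)
  case (atom_choice bs cs)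
  obtain ds where ds: "C = Choice ds" "list_all2 branch_eqv cs ds"
    using atom_cong_Choice[OF atom_choice.prems] .
  have "list_all2 branch_eqv bs ds"
    using list_all2_trans[OF _ atom_choice.hyps ds(2)] branch_eqv_trans by blast
  then show ?case unfolding ds by (rule atom_cong.atom_choice)
qed

lemma atom_cong_imp_scong: "atom_cong A B \<Longrightarrow> scong A B"
proof (induction rule: atom_cong.induct)
  case (atom_choice bs cs)
  then show ?case
    by (auto intro!: scong_Choice elim!: list_all2_mono branch_eqv_imp_cong)
qed (rule sc_refl)

section \<open>Multisets of components up to congruence\<close>

lemma rel_mset_atom_cong_refl: "rel_mset atom_cong A A"
  by (simp add: multiset.rel_refl atom_refl)

lemma rel_mset_atom_cong_sym: "rel_mset atom_cong A B \<Longrightarrow> rel_mset atom_cong B A"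
  using multiset.rel_symp[of atom_cong] atom_cong_sym by (metis sympD sympI)

lemma rel_mset_atom_cong_trans:
  "rel_mset atom_cong A B \<Longrightarrow> rel_mset atom_cong B C \<Longrightarrow> rel_mset atom_cong A C"
  using multiset.rel_transp[of atom_cong] atom_cong_trans by (metis transpD transpI)

lemma rel_mset_union:
  assumes "rel_mset R A B" "rel_mset R A' B'"
  shows "rel_mset R (A + A') (B + B')"
proof -
  obtain xs ys xs' ys' where "mset xs = A" "mset ys = B" "list_all2 R xs ys"
    "mset xs' = A'" "mset ys' = B'" "list_all2 R xs' ys'"
    using assms by (auto simp: rel_mset_def)
  then have "mset (xs @ xs') = A + A'" "mset (ys @ ys') = B + B'" "list_all2 R (xs @ xs') (ys @ ys')"
    by (auto intro: list_all2_appendI)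
  then show ?thesis unfolding rel_mset_def by blast
qed

lemma rel_mset_list_all2: "list_all2 R xs ys \<Longrightarrow> rel_mset R (mset xs) (mset ys)"
  by (auto simp: rel_mset_def)

text \<open>
  \<open>prenex \<rho> P vs As\<close>: pulling the unguarded restrictions of \<open>P\<rho>\<close> to the front, with the
  restricted names chosen as \<open>vs\<close>, leaves the parallel components \<open>As\<close>. Working with an
  environment makes \<open>\<alpha>\<close>-conversion invisible.
\<close>

inductive prenex ::
  "('n::infinite \<Rightarrow> 'n) \<Rightarrow> ('k, 'n) proc \<Rightarrow> 'n list \<Rightarrow> ('k, 'n) proc list \<Rightarrow> bool" where
  px_call: "prenex \<rho> (Call K as) [] [Call K (map \<rho> as)]"
| px_nil: "prenex \<rho> (Choice []) [] []"
| px_choice: "bs \<noteq> [] \<Longrightarrow> prenex \<rho> (Choice bs) [] [Choice (map (subst_branch \<rho>) bs)]"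
| px_par: "prenex \<rho> P vs As \<Longrightarrow> prenex \<rho> Q ws Bs \<Longrightarrow> prenex \<rho> (Par P Q) (vs @ ws) (As @ Bs)"
| px_res: "prenex (\<rho>(r := v)) P vs As \<Longrightarrow> prenex \<rho> (Res r P) (v # vs) As"

inductive_cases prenex_CallE: "prenex \<rho> (Call K as) vs As"
inductive_cases prenex_ChoiceE: "prenex \<rho> (Choice bs) vs As"
inductive_cases prenex_ParE: "prenex \<rho> (Par P Q) vs As"
inductive_cases prenex_ResE: "prenex \<rho> (Res r P) vs As"

lemma prenex_cong:
  "prenex \<rho> P vs As \<Longrightarrow> (\<And>x. x \<in> fn P \<Longrightarrow> \<rho> x = \<rho>' x) \<Longrightarrow> prenex \<rho>' P vs As"
proof (induction arbitrary: \<rho>' rule: prenex.induct)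
  case (px_call \<rho> K as)
  then have "map \<rho> as = map \<rho>' as" by simp
  then show ?case by (metis prenex.px_call)
next
  case (px_choice bs \<rho>)
  have "subst \<rho> (Choice bs) = subst \<rho>' (Choice bs)" using px_choice.prems by (rule subst_cong)
  then have "map (subst_branch \<rho>) bs = map (subst_branch \<rho>') bs"
    by (simp only: subst_Choice proc.inject)
  then show ?case using prenex.px_choice[OF px_choice.hyps, of \<rho>'] by (simp only:)
next
  case (px_par \<rho> P vs As Q ws Bs)
  show ?case by (intro prenex.px_par px_par.IH) (auto intro: px_par.prems)
next
  case (px_res \<rho> r v P vs As)
  show ?case by (intro prenex.px_res px_res.IH) (auto intro: px_res.prems)
qed (rule prenex.px_nil)

lemma prenex_fn:
  "prenex \<rho> P vs As \<Longrightarrow> (\<Union>A \<in> set As. fn A) \<subseteq> \<rho> ` fn P \<union> set vs"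
proof (induction rule: prenex.induct)
  case (px_choice bs \<rho>)
  then show ?case using fn_subst[of \<rho> "Choice bs"] by simp
next
  case (px_res \<rho> r v P vs As)
  have "(\<rho>(r := v)) ` fn P \<subseteq> insert v (\<rho> ` (fn P - {r}))" by auto
  then show ?case using px_res.IH by (auto 0 3)
qed auto

text \<open>The rules of \<open>prenex\<close> put no freshness demands on the chosen names. Those
  needed for scope extrusion enter here: the names are distinct and differ from all names visible
  outside.\<close>

lemma scong_prenex:
  "prenex \<rho> P vs As \<Longrightarrow> distinct vs \<Longrightarrow> set vs \<inter> \<rho> ` fn P = {} \<Longrightarrow>
   scong (subst \<rho> P) (res_list vs (par_list As))"
proof (induction rule: prenex.induct)
  case (px_par \<rho> P vs As Q ws Bs)
  have 1: "scong (subst \<rho> P) (res_list vs (par_list As))"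
    and 2: "scong (subst \<rho> Q) (res_list ws (par_list Bs))"
    using px_par by auto
  have "scong (subst \<rho> (Par P Q)) (Par (res_list vs (par_list As)) (res_list ws (par_list Bs)))"
    using 1 2 by (simp add: sc_cong_par)
  also have "scong \<dots> (res_list (vs @ ws) (Par (par_list As) (par_list Bs)))"
  proof (rule scong_Par_res_lists)
    show "set vs \<inter> fn (res_list ws (par_list Bs)) = {}"
      unfolding fn_scong[OF 2, symmetric] fn_subst using px_par.prems by auto
    show "set ws \<inter> fn (par_list As) = {}"
    proof -
      have "set ws \<inter> (\<rho> ` fn P \<union> set vs) = {}" using px_par.prems by (auto simp: image_Un)
      then show ?thesis unfolding fn_par_list using prenex_fn[OF px_par.hyps(1)] by blast
    qed
  qed
  also have "scong \<dots> (res_list (vs @ ws) (par_list (As @ Bs)))"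
    by (intro scong_res_list_cong sc_sym[OF scong_par_list_append])
  finally show ?case .
next
  case (px_res \<rho> r v P vs As)
  have "scong (subst \<rho> (Res r P)) (Res v (subst (\<rho>(r := v)) P))"
    using px_res.prems by (intro scong_subst_Res) auto
  also have "scong \<dots> (Res v (res_list vs (par_list As)))"
    using px_res.prems by (intro sc_cong_res px_res.IH) auto
  finally show ?case by simp
qed (auto intro: sc_refl)

text \<open>Moves a substitution from the process into the environment and back. The list
  \<open>vs\<close> stays the same, since it is chosen by the derivation and not by
  \<open>avoid\<close>; only binders below prefixes may come out differently, which
  \<open>atom_cong\<close> absorbs.\<close>

lemma prenex_subst:
  fixes P :: "('k, 'n::infinite) proc"
  shows "(prenex \<rho> (subst \<theta> P) vs As \<longrightarrow>
            (\<exists>Bs. prenex (\<rho> \<circ> \<theta>) P vs Bs \<and> list_all2 atom_cong As Bs)) \<and>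
         (prenex (\<rho> \<circ> \<theta>) P vs As \<longrightarrow>
            (\<exists>Bs. prenex \<rho> (subst \<theta> P) vs Bs \<and> list_all2 atom_cong As Bs))"
proof (induction P arbitrary: \<rho> \<theta> vs As rule: proc_induct)
  case (Call K as)
  have "prenex \<rho> (subst \<theta> (Call K as)) [] [Call K (map (\<rho> \<circ> \<theta>) as)]"
    using prenex.px_call[of \<rho> K "map \<theta> as"] by simp
  then show ?case
    by (auto elim!: prenex_CallE simp: atom_refl intro: prenex.px_call simp del: o_apply)
next
  case (Choice bs)
  have eqv: "branch_eqv (subst_branch \<rho> (subst_branch \<theta> b)) (subst_branch (\<rho> \<circ> \<theta>) b)" for b :: "'n prefix \<times> ('k, 'n) proc"
  proof -
    obtain \<pi> P where b: "b = (\<pi>, P)" by force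
    show ?thesis
    proof (cases \<pi>)
      case (Inp a x)
      define u where "u = avoid x (\<theta> ` (fn P - {x}))"
      define v where "v = avoid u (\<rho> ` (fn (subst (\<theta>(x := u)) P) - {u}))"
      define w where "w = avoid x ((\<rho> \<circ> \<theta>) ` (fn P - {x}))"
      have u: "u \<notin> \<theta> ` (fn P - {x})" unfolding u_def by (rule avoid_fresh) simp
      have v: "v \<notin> \<rho> ` (fn (subst (\<theta>(x := u)) P) - {u})" unfolding v_def by (rule avoid_fresh) simp
      have w: "w \<notin> (\<rho> \<circ> \<theta>) ` (fn P - {x})" unfolding w_def by (rule avoid_fresh) simp
      have "scong (subst (id(v := z)) (subst (\<rho>(u := v)) (subst (\<theta>(x := u)) P)))
          (subst (id(w := z)) (subst ((\<rho> \<circ> \<theta>)(x := w)) P))" for z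
      proof -
        have "scong (subst (id(v := z)) (subst (\<rho>(u := v)) (subst (\<theta>(x := u)) P)))
            (subst ((id \<circ> \<rho>)(u := z)) (subst (\<theta>(x := u)) P))"
          by (rule scong_subst_upd_comp[OF v])
        also have "scong \<dots> (subst (((id \<circ> \<rho>) \<circ> \<theta>)(x := z)) P)"
          by (rule scong_subst_upd_comp[OF u])
        also have "scong \<dots> (subst (id(w := z)) (subst ((\<rho> \<circ> \<theta>)(x := w)) P))"
          using sc_sym[OF scong_subst_upd_comp[OF w, of id z]] by (simp add: o_assoc del: o_apply)
        finally show ?thesis .
      qed
      moreover have "(\<rho> \<circ> \<theta>) a = \<rho> (\<theta> a)" by simp
      ultimately show ?thesis unfolding b Inp
        by (simp only: subst_branch.simps branch_eqv.simps u_def[symmetric] v_def[symmetric] w_def[symmetric]) blast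
    qed (simp_all add: b scong_subst_comp del: o_apply, simp_all)
  qed
  have *: "list_all2 branch_eqv (map (subst_branch \<rho>) (map (subst_branch \<theta>) bs)) (map (subst_branch (\<rho> \<circ> \<theta>)) bs)"
    by (simp only: list_all2_map1 list_all2_map2 list.rel_refl_strong eqv)
  show ?case
  proof (cases "bs = []")
    case True
    then show ?thesis by (auto elim!: prenex_ChoiceE intro: prenex.px_nil)
  next
    case False
    have 1: "prenex \<rho> (subst \<theta> (Choice bs)) [] [Choice (map (subst_branch \<rho>) (map (subst_branch \<theta>) bs))]"
      using False unfolding subst_Choice by (intro prenex.px_choice) simp
    have 2: "prenex (\<rho> \<circ> \<theta>) (Choice bs) [] [Choice (map (subst_branch (\<rho> \<circ> \<theta>)) bs)]"
      using False by (rule prenex.px_choice)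
    have 3: "list_all2 atom_cong [Choice (map (subst_branch \<rho>) (map (subst_branch \<theta>) bs))]
       [Choice (map (subst_branch (\<rho> \<circ> \<theta>)) bs)]"
      using atom_choice[OF *] by simp
    have 4: "list_all2 atom_cong [Choice (map (subst_branch (\<rho> \<circ> \<theta>)) bs)]
       [Choice (map (subst_branch \<rho>) (map (subst_branch \<theta>) bs))]"
      using atom_cong_sym[OF atom_choice[OF *]] by simp
    show ?thesis
    proof (intro conjI impI)
      assume "prenex \<rho> (subst \<theta> (Choice bs)) vs As"
      then have "vs = []" "As = [Choice (map (subst_branch \<rho>) (map (subst_branch \<theta>) bs))]"
        using False unfolding subst_Choice by (auto elim!: prenex_ChoiceE)
      then show "\<exists>Bs. prenex (\<rho> \<circ> \<theta>) (Choice bs) vs Bs \<and> list_all2 atom_cong As Bs" using 2 3 by blast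
    next
      assume "prenex (\<rho> \<circ> \<theta>) (Choice bs) vs As"
      then have "vs = []" "As = [Choice (map (subst_branch (\<rho> \<circ> \<theta>)) bs)]"
        using False by (auto elim!: prenex_ChoiceE simp del: o_apply)
      then show "\<exists>Bs. prenex \<rho> (subst \<theta> (Choice bs)) vs Bs \<and> list_all2 atom_cong As Bs" using 1 4 by blast
    qed
  qed
next
  case (Res r P)
  define u where "u = avoid r (\<theta> ` (fn P - {r}))"
  have u: "u \<notin> \<theta> ` (fn P - {r})" unfolding u_def by (rule avoid_fresh) simp
  have su: "subst \<theta> (Res r P) = Res u (subst (\<theta>(r := u)) P)" by (simp add: u_def)
  have eq: "(\<rho>(u := v) \<circ> \<theta>(r := u)) x = ((\<rho> \<circ> \<theta>)(r := v)) x" if "x \<in> fn P" for x v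
    using u that by auto
  show ?case
  proof (intro conjI impI)
    assume "prenex \<rho> (subst \<theta> (Res r P)) vs As"
    then obtain v vs' where vs: "vs = v # vs'" and px: "prenex (\<rho>(u := v)) (subst (\<theta>(r := u)) P) vs' As"
      unfolding su by (auto elim: prenex_ResE)
    obtain Bs where "prenex (\<rho>(u := v) \<circ> \<theta>(r := u)) P vs' Bs" "list_all2 atom_cong As Bs"
      using Res[THEN conjunct1, rule_format, OF px] by blast
    moreover from prenex_cong[OF this(1) eq] have "prenex (\<rho> \<circ> \<theta>) (Res r P) vs Bs"
      unfolding vs by (rule prenex.px_res)
    ultimately show "\<exists>Bs. prenex (\<rho> \<circ> \<theta>) (Res r P) vs Bs \<and> list_all2 atom_cong As Bs"
      by blast
  next
    assume "prenex (\<rho> \<circ> \<theta>) (Res r P) vs As"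
    then obtain v vs' where vs: "vs = v # vs'" and px: "prenex ((\<rho> \<circ> \<theta>)(r := v)) P vs' As"
      by (auto elim: prenex_ResE)
    have "prenex (\<rho>(u := v) \<circ> \<theta>(r := u)) P vs' As"
      by (rule prenex_cong[OF px eq[symmetric]])
    from Res[THEN conjunct2, rule_format, OF this]
    obtain Bs where "prenex (\<rho>(u := v)) (subst (\<theta>(r := u)) P) vs' Bs" "list_all2 atom_cong As Bs"
      by blast
    then show "\<exists>Bs. prenex \<rho> (subst \<theta> (Res r P)) vs Bs \<and> list_all2 atom_cong As Bs"
      unfolding vs su by (blast intro: prenex.px_res)
  qed
next
  case (Par P Q)
  show ?case
  proof (intro conjI impI)
    assume "prenex \<rho> (subst \<theta> (Par P Q)) vs As"
    then obtain v1 v2 A1 A2 where *: "vs = v1 @ v2" "As = A1 @ A2"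
      and px: "prenex \<rho> (subst \<theta> P) v1 A1" "prenex \<rho> (subst \<theta> Q) v2 A2"
      by (auto elim: prenex_ParE)
    obtain B1 where "prenex (\<rho> \<circ> \<theta>) P v1 B1" "list_all2 atom_cong A1 B1"
      using Par.IH(1)[THEN conjunct1, rule_format, OF px(1)] by blast
    moreover obtain B2 where "prenex (\<rho> \<circ> \<theta>) Q v2 B2" "list_all2 atom_cong A2 B2"
      using Par.IH(2)[THEN conjunct1, rule_format, OF px(2)] by blast
    ultimately show "\<exists>Bs. prenex (\<rho> \<circ> \<theta>) (Par P Q) vs Bs \<and> list_all2 atom_cong As Bs"
      unfolding * by (blast intro: prenex.px_par list_all2_appendI)
  next
    assume "prenex (\<rho> \<circ> \<theta>) (Par P Q) vs As"
    then obtain v1 v2 A1 A2 where *: "vs = v1 @ v2" "As = A1 @ A2"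
      and px: "prenex (\<rho> \<circ> \<theta>) P v1 A1" "prenex (\<rho> \<circ> \<theta>) Q v2 A2"
      by (auto elim: prenex_ParE)
    obtain B1 where "prenex \<rho> (subst \<theta> P) v1 B1" "list_all2 atom_cong A1 B1"
      using Par.IH(1)[THEN conjunct2, rule_format, OF px(1)] by blast
    moreover obtain B2 where "prenex \<rho> (subst \<theta> Q) v2 B2" "list_all2 atom_cong A2 B2"
      using Par.IH(2)[THEN conjunct2, rule_format, OF px(2)] by blast
    ultimately show "\<exists>Bs. prenex \<rho> (subst \<theta> (Par P Q)) vs Bs \<and> list_all2 atom_cong As Bs"
      unfolding * subst.simps by (blast intro: prenex.px_par list_all2_appendI)
  qed
qed

text \<open>A simulation order on prenex forms. The finite set \<open>X\<close> of forbidden names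
  is part of it because a step such as \<open>Nil0\<close> to \<open>Res r Nil0\<close> has to
  invent a restricted name, which must stay clear of the names chosen elsewhere in the
  process.\<close>

definition prenex_le :: "('k, 'n::infinite) proc \<Rightarrow> ('k, 'n) proc \<Rightarrow> bool" where
  "prenex_le P Q \<longleftrightarrow> (\<forall>\<rho> vs As X. prenex \<rho> P vs As \<longrightarrow> distinct vs \<longrightarrow> finite X \<longrightarrow> set vs \<inter> X = {} \<longrightarrow>
     (\<exists>ws Bs. prenex \<rho> Q ws Bs \<and> distinct ws \<and> set ws \<inter> X = {} \<and>
        rel_mset atom_cong (mset As) (mset Bs)))"

lemma prenex_leI:
  assumes "\<And>\<rho> vs As X. prenex \<rho> P vs As \<Longrightarrow> distinct vs \<Longrightarrow> finite X \<Longrightarrow> set vs \<inter> X = {} \<Longrightarrow>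
     \<exists>ws Bs. prenex \<rho> Q ws Bs \<and> distinct ws \<and> set ws \<inter> X = {} \<and>
        rel_mset atom_cong (mset As) (mset Bs)"
  shows "prenex_le P Q"
  using assms by (auto simp: prenex_le_def)

lemma prenex_leE:
  assumes "prenex_le P Q" "prenex \<rho> P vs As" "distinct vs" "finite X" "set vs \<inter> X = {}"
  obtains ws Bs where "prenex \<rho> Q ws Bs" "distinct ws" "set ws \<inter> X = {}"
    "rel_mset atom_cong (mset As) (mset Bs)"
  using assms(1)[unfolded prenex_le_def, rule_format, OF assms(2-5)] that by blast

text \<open>For laws that only rearrange restrictions the same names can be kept, so
  \<open>X\<close> and distinctness are dealt with once and for all.\<close>

lemma prenex_leI_same:
  assumes "\<And>\<rho> vs As. prenex \<rho> P vs As \<Longrightarrow>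
     \<exists>ws Bs. prenex \<rho> Q ws Bs \<and> mset ws = mset vs \<and> rel_mset atom_cong (mset As) (mset Bs)"
  shows "prenex_le P Q"
proof (rule prenex_leI)
  fix \<rho> vs As X
  assume *: "prenex \<rho> P vs As" "distinct vs" "finite X" "set vs \<inter> X = {}"
  obtain ws Bs where ws: "prenex \<rho> Q ws Bs" "mset ws = mset vs" "rel_mset atom_cong (mset As) (mset Bs)"
    using assms[OF *(1)] by blast
  then have "set ws = set vs" "distinct ws"
    using *(2) by (auto dest: mset_eq_setD mset_eq_imp_distinct_iff)
  with ws * show "\<exists>ws Bs. prenex \<rho> Q ws Bs \<and> distinct ws \<and> set ws \<inter> X = {} \<and>
        rel_mset atom_cong (mset As) (mset Bs)" by blast
qed

lemma prenex_le_refl: "prenex_le P P"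
  by (rule prenex_leI_same) (use rel_mset_atom_cong_refl in blast)

lemma prenex_le_trans:
  assumes "prenex_le P Q" "prenex_le Q R"
  shows "prenex_le P R"
proof (rule prenex_leI)
  fix \<rho> vs As X
  assume *: "prenex \<rho> P vs As" "distinct vs" "finite X" "set vs \<inter> X = {}"
  obtain ws Bs where 1: "prenex \<rho> Q ws Bs" "distinct ws" "set ws \<inter> X = {}"
    "rel_mset atom_cong (mset As) (mset Bs)"
    using prenex_leE[OF assms(1) *] by blast
  obtain us Cs where "prenex \<rho> R us Cs" "distinct us" "set us \<inter> X = {}"
    "rel_mset atom_cong (mset Bs) (mset Cs)"
    using prenex_leE[OF assms(2) 1(1,2) *(3) 1(3)] by blast
  with 1(4) show "\<exists>ws Bs. prenex \<rho> R ws Bs \<and> distinct ws \<and> set ws \<inter> X = {} \<and>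
        rel_mset atom_cong (mset As) (mset Bs)"
    using rel_mset_atom_cong_trans by blast
qed

lemma prenex_le_Res:
  assumes "prenex_le P Q"
  shows "prenex_le (Res r P) (Res r Q)"
proof (rule prenex_leI)
  fix \<rho> vs As X
  assume *: "prenex \<rho> (Res r P) vs As" "distinct vs" "finite X" "set vs \<inter> X = {}"
  obtain v vs' where vs: "vs = v # vs'" "prenex (\<rho>(r := v)) P vs' As"
    using *(1) by (auto elim: prenex_ResE)
  obtain ws Bs where "prenex (\<rho>(r := v)) Q ws Bs" "distinct ws" "set ws \<inter> insert v X = {}"
    "rel_mset atom_cong (mset As) (mset Bs)"
    by (rule prenex_leE[OF assms vs(2), of "insert v X"]) (use * vs in auto)
  then show "\<exists>ws Bs. prenex \<rho> (Res r Q) ws Bs \<and> distinct ws \<and> set ws \<inter> X = {} \<and>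
        rel_mset atom_cong (mset As) (mset Bs)"
    using * vs(1) by (intro exI[of _ "v # ws"] exI[of _ Bs]) (auto intro: prenex.px_res)
qed

lemma prenex_le_Par:
  assumes "prenex_le P P'" "prenex_le Q Q'"
  shows "prenex_le (Par P Q) (Par P' Q')"
proof (rule prenex_leI)
  fix \<rho> vs As X
  assume *: "prenex \<rho> (Par P Q) vs As" "distinct vs" "finite X" "set vs \<inter> X = {}"
  obtain v1 v2 A1 A2 where vs: "vs = v1 @ v2" "As = A1 @ A2"
    and px: "prenex \<rho> P v1 A1" "prenex \<rho> Q v2 A2"
    using *(1) by (auto elim: prenex_ParE)
  \<comment> \<open>\<open>w1\<close> has to avoid \<open>v2\<close>, and afterwards
    \<open>w2\<close> has to avoid \<open>w1\<close>, so that the joint list of names stays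
    distinct.\<close>
  obtain w1 B1 where 1: "prenex \<rho> P' w1 B1" "distinct w1" "set w1 \<inter> (X \<union> set v2) = {}"
    "rel_mset atom_cong (mset A1) (mset B1)"
    by (rule prenex_leE[OF assms(1) px(1), of "X \<union> set v2"]) (use * vs in auto)
  obtain w2 B2 where 2: "prenex \<rho> Q' w2 B2" "distinct w2" "set w2 \<inter> (X \<union> set w1) = {}"
    "rel_mset atom_cong (mset A2) (mset B2)"
    by (rule prenex_leE[OF assms(2) px(2), of "X \<union> set w1"]) (use * vs 1 in auto)
  have "prenex \<rho> (Par P' Q') (w1 @ w2) (B1 @ B2)" using 1 2 by (auto intro: prenex.px_par)
  moreover have "distinct (w1 @ w2)" "set (w1 @ w2) \<inter> X = {}" using 1 2 by auto
  moreover have "rel_mset atom_cong (mset As) (mset (B1 @ B2))"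
    using 1 2 vs by (simp add: rel_mset_union)
  ultimately show "\<exists>ws Bs. prenex \<rho> (Par P' Q') ws Bs \<and> distinct ws \<and> set ws \<inter> X = {} \<and>
        rel_mset atom_cong (mset As) (mset Bs)" by blast
qed

lemma prenex_le_Choice:
  assumes "\<And>\<rho>. branch_eqv (subst_branch \<rho> b) (subst_branch \<rho> c)"
  shows "prenex_le (Choice (bs @ b # cs)) (Choice (bs @ c # cs))"
proof (rule prenex_leI_same)
  fix \<rho> vs As
  assume "prenex \<rho> (Choice (bs @ b # cs)) vs As"
  then have vs: "vs = []" "As = [Choice (map (subst_branch \<rho>) (bs @ b # cs))]"
    by (auto elim: prenex_ChoiceE)
  let ?B = "Choice (map (subst_branch \<rho>) (bs @ c # cs))"
  have "prenex \<rho> (Choice (bs @ c # cs)) [] [?B]" by (rule prenex.px_choice) simp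
  moreover have "list_all2 branch_eqv (map (subst_branch \<rho>) (bs @ b # cs)) (map (subst_branch \<rho>) (bs @ c # cs))"
    by (auto intro!: list_all2_appendI list.rel_refl branch_eqv_refl assms)
  then have "rel_mset atom_cong (mset As) (mset [?B])"
    unfolding vs by (intro rel_mset_list_all2) (auto intro: atom_choice)
  ultimately show "\<exists>ws Bs. prenex \<rho> (Choice (bs @ c # cs)) ws Bs \<and> mset ws = mset vs \<and>
      rel_mset atom_cong (mset As) (mset Bs)" using vs by blast
qed

lemma prenex_subst_Inp_alpha:
  assumes "y' \<notin> fn P"
  shows "branch_eqv (subst_branch \<rho> (Inp a y, P)) (subst_branch \<rho> (Inp a y', subst (id(y := y')) P))"
proof -
  let ?Q = "subst (id(y := y')) P"
  define u where "u = avoid y (\<rho> ` (fn P - {y}))"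
  define v where "v = avoid y' (\<rho> ` (fn ?Q - {y'}))"
  have u: "u \<notin> \<rho> ` (fn P - {y})" unfolding u_def by (rule avoid_fresh) simp
  have v: "v \<notin> \<rho> ` (fn ?Q - {y'})" unfolding v_def by (rule avoid_fresh) simp
  have y': "y' \<notin> id ` (fn P - {y})" using assms by auto
  have "scong (subst (id(u := z)) (subst (\<rho>(y := u)) P)) (subst (id(v := z)) (subst (\<rho>(y' := v)) ?Q))" for z
  proof -
    have "scong (subst (id(v := z)) (subst (\<rho>(y' := v)) ?Q)) (subst ((id \<circ> \<rho>)(y' := z)) ?Q)"
      by (rule scong_subst_upd_comp[OF v])
    also have "scong \<dots> (subst (((id \<circ> \<rho>) \<circ> id)(y := z)) P)"
      by (rule scong_subst_upd_comp[OF y'])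
    also have "scong \<dots> (subst (id(u := z)) (subst (\<rho>(y := u)) P))"
      using sc_sym[OF scong_subst_upd_comp[OF u, of id z]] by (simp del: o_apply)
    finally show ?thesis by (rule sc_sym)
  qed
  then show ?thesis
    by (simp only: subst_branch.simps branch_eqv.simps u_def[symmetric] v_def[symmetric]) blast
qed

text \<open>Both directions go through one induction because symmetry is itself a rule. Changes
  below a prefix never reach the list of restricted names; \<open>branch_eqv\<close> takes care of
  them.\<close>

lemma scong_imp_prenex_le: "scong P Q \<Longrightarrow> prenex_le P Q \<and> prenex_le Q P"
proof (induction rule: scong.induct)
  case (sc_cong_choice P Q bs \<pi> cs)
  have "branch_eqv (subst_branch \<rho> (\<pi>, P)) (subst_branch \<rho> (\<pi>, Q))" for \<rho>
    using fn_scong[OF sc_cong_choice.hyps] scong_subst[OF sc_cong_choice.hyps]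
    by (cases \<pi>) (auto intro: scong_subst)
  then show ?case by (intro conjI prenex_le_Choice) (auto intro: branch_eqv_sym)
next
  case (sc_alpha_inp y' P bs a y cs)
  show ?case unfolding app_map_single
    by (intro conjI prenex_le_Choice)
       (auto simp only: intro: branch_eqv_sym prenex_subst_Inp_alpha[OF sc_alpha_inp])
next
  case (sc_alpha_res r' P r)
  let ?Q = "subst (id(r := r')) P"
  \<comment> \<open>Under the environment the old and the new binder receive the same name
    \<open>v\<close>, and no other free name of \<open>P\<close> is affected since \<open>r'\<close>
    is not free in \<open>P\<close>.\<close>
  have eq: "(\<rho>(r' := v) \<circ> id(r := r')) x = (\<rho>(r := v)) x" if "x \<in> fn P" for x v and \<rho> :: "'b \<Rightarrow> 'b"
    using that sc_alpha_res by auto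
  have "prenex_le (Res r P) (Res r' ?Q)"
  proof (rule prenex_leI_same)
    fix \<rho> vs As assume "prenex \<rho> (Res r P) vs As"
    then obtain v vs' where vs: "vs = v # vs'" and px: "prenex (\<rho>(r := v)) P vs' As"
      by (auto elim: prenex_ResE)
    have "prenex (\<rho>(r' := v) \<circ> id(r := r')) P vs' As"
      by (rule prenex_cong[OF px eq[symmetric]])
    from prenex_subst[THEN conjunct2, rule_format, OF this]
    obtain Bs where "prenex (\<rho>(r' := v)) ?Q vs' Bs" "list_all2 atom_cong As Bs" by blast
    then show "\<exists>ws Bs. prenex \<rho> (Res r' ?Q) ws Bs \<and> mset ws = mset vs \<and>
        rel_mset atom_cong (mset As) (mset Bs)"
      unfolding vs by (blast intro: prenex.px_res rel_mset_list_all2)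
  qed
  moreover have "prenex_le (Res r' ?Q) (Res r P)"
  proof (rule prenex_leI_same)
    fix \<rho> vs As assume "prenex \<rho> (Res r' ?Q) vs As"
    then obtain v vs' where vs: "vs = v # vs'" and px: "prenex (\<rho>(r' := v)) ?Q vs' As"
      by (auto elim: prenex_ResE)
    from prenex_subst[THEN conjunct1, rule_format, OF px]
    obtain Bs where "prenex (\<rho>(r' := v) \<circ> id(r := r')) P vs' Bs" "list_all2 atom_cong As Bs" by blast
    moreover from prenex_cong[OF this(1) eq] have "prenex \<rho> (Res r P) vs Bs"
      unfolding vs by (rule prenex.px_res)
    ultimately show "\<exists>ws Bs. prenex \<rho> (Res r P) ws Bs \<and> mset ws = mset vs \<and>
        rel_mset atom_cong (mset As) (mset Bs)"
      by (blast intro: rel_mset_list_all2)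
  qed
  ultimately show ?case unfolding app_map_single by blast
next
  case (sc_par_assoc P Q R)
  have "prenex_le (Par P (Par Q R)) (Par (Par P Q) R)"
  proof (rule prenex_leI_same)
    fix \<rho> vs As assume "prenex \<rho> (Par P (Par Q R)) vs As"
    then obtain v1 v2 v3 A1 A2 A3 where *: "vs = v1 @ v2 @ v3" "As = A1 @ A2 @ A3"
      and px: "prenex \<rho> P v1 A1" "prenex \<rho> Q v2 A2" "prenex \<rho> R v3 A3"
      by (auto elim!: prenex_ParE)
    from prenex.px_par[OF prenex.px_par[OF px(1,2)] px(3)]
    show "\<exists>ws Bs. prenex \<rho> (Par (Par P Q) R) ws Bs \<and> mset ws = mset vs \<and>
        rel_mset atom_cong (mset As) (mset Bs)"
      unfolding * append_assoc using rel_mset_atom_cong_refl by blast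
  qed
  moreover have "prenex_le (Par (Par P Q) R) (Par P (Par Q R))"
  proof (rule prenex_leI_same)
    fix \<rho> vs As assume "prenex \<rho> (Par (Par P Q) R) vs As"
    then obtain v1 v2 v3 A1 A2 A3 where *: "vs = (v1 @ v2) @ v3" "As = (A1 @ A2) @ A3"
      and px: "prenex \<rho> P v1 A1" "prenex \<rho> Q v2 A2" "prenex \<rho> R v3 A3"
      by (auto elim!: prenex_ParE)
    from prenex.px_par[OF px(1) prenex.px_par[OF px(2,3)]]
    show "\<exists>ws Bs. prenex \<rho> (Par P (Par Q R)) ws Bs \<and> mset ws = mset vs \<and>
        rel_mset atom_cong (mset As) (mset Bs)"
      unfolding * append_assoc using rel_mset_atom_cong_refl by blast
  qed
  ultimately show ?case by blast
next
  case (sc_par_comm P Q)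
  have "prenex_le (Par P Q) (Par Q P)" for P Q :: "('a, 'b) proc"
  proof (rule prenex_leI_same)
    fix \<rho> vs As assume "prenex \<rho> (Par P Q) vs As"
    then obtain v1 v2 A1 A2 where *: "vs = v1 @ v2" "As = A1 @ A2"
      and px: "prenex \<rho> P v1 A1" "prenex \<rho> Q v2 A2"
      by (auto elim!: prenex_ParE)
    from prenex.px_par[OF px(2,1)]
    show "\<exists>ws Bs. prenex \<rho> (Par Q P) ws Bs \<and> mset ws = mset vs \<and>
        rel_mset atom_cong (mset As) (mset Bs)"
      by (intro exI[of _ "v2 @ v1"] exI[of _ "A2 @ A1"])
         (auto simp: * add.commute intro: rel_mset_atom_cong_refl)
  qed
  then show ?case by blast
next
  case (sc_par_unit P)
  have "prenex_le (Par P Nil0) P"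
    by (rule prenex_leI_same)
       (auto elim!: prenex_ParE prenex_ChoiceE, use rel_mset_atom_cong_refl in blast)
  moreover have "prenex_le P (Par P Nil0)"
  proof (rule prenex_leI_same)
    fix \<rho> vs As assume "prenex \<rho> P vs As"
    from prenex.px_par[OF this prenex.px_nil]
    show "\<exists>ws Bs. prenex \<rho> (Par P Nil0) ws Bs \<and> mset ws = mset vs \<and>
        rel_mset atom_cong (mset As) (mset Bs)"
      unfolding append_Nil2 using rel_mset_atom_cong_refl by blast
  qed
  ultimately show ?case by blast
next
  case (sc_res_nil r)
  have "prenex_le (Res r (Nil0 :: ('a, 'b) proc)) Nil0"
    by (rule prenex_leI) (auto elim!: prenex_ResE prenex_ChoiceE intro!: exI[of _ "[]"] prenex.px_nil)
  moreover have "prenex_le (Nil0 :: ('a, 'b) proc) (Res r Nil0)"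
  proof (rule prenex_leI)
    fix \<rho> vs and As :: "('a, 'b) proc list" and X :: "'b set"
    assume *: "prenex \<rho> Nil0 vs As" "finite X"
    \<comment> \<open>This law creates a restriction out of nothing; any permitted name will
      do.\<close>
    obtain v where "v \<notin> X" using arb_element[OF *(2)] by blast
    then show "\<exists>ws Bs. prenex \<rho> (Res r Nil0) ws Bs \<and> distinct ws \<and> set ws \<inter> X = {} \<and>
        rel_mset atom_cong (mset As) (mset Bs)"
      using * by (intro exI[of _ "[v]"] exI[of _ "[]"])
        (auto elim!: prenex_ChoiceE intro: prenex.px_res prenex.px_nil)
  qed
  ultimately show ?case by blast
next
  case (sc_res_swap r1 r2 P)
  have "prenex_le (Res r1 (Res r2 P)) (Res r2 (Res r1 P))" for r1 r2
  proof (cases "r1 = r2")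
    case False
    show ?thesis
    proof (rule prenex_leI_same)
      fix \<rho> vs As assume "prenex \<rho> (Res r1 (Res r2 P)) vs As"
      then obtain v1 v2 vs' where vs: "vs = v1 # v2 # vs'" "prenex (\<rho>(r1 := v1, r2 := v2)) P vs' As"
        by (auto elim!: prenex_ResE)
      then have "prenex \<rho> (Res r2 (Res r1 P)) (v2 # v1 # vs') As"
        by (intro prenex.px_res) (simp only: fun_upd_twist[OF False])
      then show "\<exists>ws Bs. prenex \<rho> (Res r2 (Res r1 P)) ws Bs \<and> mset ws = mset vs \<and>
          rel_mset atom_cong (mset As) (mset Bs)"
        unfolding vs(1)
        by (intro exI[of _ "v2 # v1 # vs'"] exI[of _ As]) (auto intro: rel_mset_atom_cong_refl)
    qed
  qed (simp add: prenex_le_refl)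
  then show ?case by blast
next
  case (sc_scope r P1 P2)
  have eq: "\<rho> x = (\<rho>(r := v)) x" if "x \<in> fn P1" for x v and \<rho> :: "'b \<Rightarrow> 'b"
    using that sc_scope by auto
  have "prenex_le (Res r (Par P1 P2)) (Par P1 (Res r P2))"
  proof (rule prenex_leI_same)
    fix \<rho> vs As assume "prenex \<rho> (Res r (Par P1 P2)) vs As"
    then obtain v v1 v2 A1 A2 where *: "vs = v # v1 @ v2" "As = A1 @ A2"
      and px: "prenex (\<rho>(r := v)) P1 v1 A1" "prenex (\<rho>(r := v)) P2 v2 A2"
      by (auto elim!: prenex_ResE prenex_ParE)
    have "prenex \<rho> P1 v1 A1" by (rule prenex_cong[OF px(1)]) (rule eq[symmetric])
    with px(2) have "prenex \<rho> (Par P1 (Res r P2)) (v1 @ (v # v2)) (A1 @ A2)"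
      by (intro prenex.px_par prenex.px_res)
    then show "\<exists>ws Bs. prenex \<rho> (Par P1 (Res r P2)) ws Bs \<and> mset ws = mset vs \<and>
        rel_mset atom_cong (mset As) (mset Bs)"
      unfolding * by (intro exI[of _ "v1 @ (v # v2)"] exI[of _ "A1 @ A2"]) (auto intro: rel_mset_atom_cong_refl)
  qed
  moreover have "prenex_le (Par P1 (Res r P2)) (Res r (Par P1 P2))"
  proof (rule prenex_leI_same)
    fix \<rho> vs As assume "prenex \<rho> (Par P1 (Res r P2)) vs As"
    then obtain v v1 v2 A1 A2 where *: "vs = v1 @ v # v2" "As = A1 @ A2"
      and px: "prenex \<rho> P1 v1 A1" "prenex (\<rho>(r := v)) P2 v2 A2"
      by (auto elim!: prenex_ResE prenex_ParE)
    have "prenex (\<rho>(r := v)) P1 v1 A1" by (rule prenex_cong[OF px(1)]) (rule eq)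
    with px(2) have "prenex \<rho> (Res r (Par P1 P2)) (v # v1 @ v2) (A1 @ A2)"
      by (intro prenex.px_par prenex.px_res)
    then show "\<exists>ws Bs. prenex \<rho> (Res r (Par P1 P2)) ws Bs \<and> mset ws = mset vs \<and>
        rel_mset atom_cong (mset As) (mset Bs)"
      unfolding * by (intro exI[of _ "v # v1 @ v2"] exI[of _ "A1 @ A2"]) (auto intro: rel_mset_atom_cong_refl)
  qed
  ultimately show ?case by blast
qed (simp_all add: prenex_le_refl prenex_le_Res prenex_le_Par, blast intro: prenex_le_trans)

section \<open>Inversion of reactions\<close>

text \<open>Reactions with structural congruence stripped away: the multiset stands for
  associativity and commutativity, and the restrictions are kept outside.\<close>

inductive redex :: "('k, 'n::infinite) eqns \<Rightarrow> ('k, 'n) proc multiset \<Rightarrow> ('k, 'n) proc multiset \<Rightarrow> bool"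
  for D :: "('k, 'n) eqns" where
  rx_tau: "(Tau, S) \<in> set bs \<Longrightarrow> redex D (add_mset (Choice bs) R) (add_mset S R)"
| rx_call: "D K = Some (fs, S) \<Longrightarrow> length as = length fs \<Longrightarrow>
    redex D (add_mset (Call K as) R) (add_mset (msubst (map_of (zip fs as)) S) R)"
| rx_comm: "(Inp x y, S1) \<in> set bs \<Longrightarrow> (Out x z, S2) \<in> set cs \<Longrightarrow>
    redex D (add_mset (Choice bs) (add_mset (Choice cs) R))
      (add_mset (subst (id(y := z)) S1) (add_mset S2 R))"

lemma redex_union: "redex D A B \<Longrightarrow> redex D (A + C) (B + C)"
proof (induction rule: redex.induct)
  case (rx_comm x y S1 bs z S2 cs R)
  then show ?case using redex.rx_comm[of x y S1 bs z S2 cs D "R + C"] by simp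
qed (auto intro: redex.intros)

text \<open>Makes reactions unable to create free names (\<open>redex_fn\<close>,
  \<open>react_fn\<close>), so that the side conditions of scope extrusion survive a
  reaction.\<close>

definition closed_eqns :: "('k, 'n) eqns \<Rightarrow> bool" where
  "closed_eqns D \<longleftrightarrow> (\<forall>K fs S. D K = Some (fs, S) \<longrightarrow> fn S \<subseteq> set fs)"

lemma closed_eqnsD: "closed_eqns D \<Longrightarrow> D K = Some (fs, S) \<Longrightarrow> fn S \<subseteq> set fs"
  by (simp add: closed_eqns_def)

lemma fn_Choice_branch: "(\<pi>, P) \<in> set bs \<Longrightarrow> fn_prefixed \<pi> (fn P) \<subseteq> fn (Choice bs)"
  by auto

lemma fn_msubst_zip:
  assumes "length as = length fs" "fn S \<subseteq> set fs"
  shows "fn (msubst (map_of (zip fs as)) S) \<subseteq> set as"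
proof -
  have "app_map (map_of (zip fs as)) x \<in> set as" if "x \<in> fn S" for x
  proof -
    have "x \<in> dom (map_of (zip fs as))" using that assms by auto
    then obtain a where a: "map_of (zip fs as) x = Some a" by blast
    from map_of_SomeD[OF this] have "a \<in> set as" by (rule set_zip_rightD)
    then show ?thesis using a by (simp add: app_map_def)
  qed
  then show ?thesis by (auto simp: fn_subst)
qed

lemma redex_fn:
  assumes "redex D A B" and closed: "closed_eqns D"
  shows "(\<Union>P \<in> set_mset B. fn P) \<subseteq> (\<Union>P \<in> set_mset A. fn P)"
  using assms(1)
proof (induction rule: redex.induct)
  case (rx_tau S bs R)
  then show ?case using fn_Choice_branch[OF rx_tau] by auto
next
  case (rx_call K fs S as R)
  then show ?case using fn_msubst_zip[OF rx_call(2) closed_eqnsD[OF closed rx_call(1)]] by auto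
next
  case (rx_comm x y S1 bs z S2 cs R)
  have "fn (subst (id(y := z)) S1) \<subseteq> fn (Choice bs) \<union> fn (Choice cs)"
    using fn_Choice_branch[OF rx_comm(1)] fn_Choice_branch[OF rx_comm(2)]
    unfolding fn_subst fn_prefixed.simps by (auto simp del: fn.simps)
  moreover have "fn S2 \<subseteq> fn (Choice cs)"
    using fn_Choice_branch[OF rx_comm(2)] by (auto simp del: fn.simps)
  ultimately show ?case by (auto simp del: fn.simps)
qed

lemma list_all2_memE:
  assumes "list_all2 R xs ys" "x \<in> set xs"
  obtains y where "y \<in> set ys" "R x y"
  using assms by (metis in_set_conv_nth list_all2_conv_all_nth)

lemma branch_eqv_Tau:
  assumes "list_all2 branch_eqv bs cs" "(Tau, S) \<in> set bs"
  obtains S' where "(Tau, S') \<in> set cs" "scong S S'"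
proof -
  obtain c where c: "c \<in> set cs" "branch_eqv (Tau, S) c" using list_all2_memE[OF assms] .
  obtain \<pi> S' where "c = (\<pi>, S')" by (cases c)
  then show ?thesis using that c by (cases \<pi>) auto
qed

lemma branch_eqv_Out:
  assumes "list_all2 branch_eqv bs cs" "(Out a b, S) \<in> set bs"
  obtains S' where "(Out a b, S') \<in> set cs" "scong S S'"
proof -
  obtain c where c: "c \<in> set cs" "branch_eqv (Out a b, S) c" using list_all2_memE[OF assms] .
  obtain \<pi> S' where "c = (\<pi>, S')" by (cases c)
  then show ?thesis using that c by (cases \<pi>) auto
qed

lemma branch_eqv_Inp:
  assumes "list_all2 branch_eqv bs cs" "(Inp a x, S) \<in> set bs"
  obtains y S' where "(Inp a y, S') \<in> set cs"
    "\<And>z. scong (subst (id(x := z)) S) (subst (id(y := z)) S')"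
proof -
  obtain c where c: "c \<in> set cs" "branch_eqv (Inp a x, S) c" using list_all2_memE[OF assms] .
  obtain \<pi> S' where "c = (\<pi>, S')" by (cases c)
  then show ?thesis using that c by (cases \<pi>) auto
qed

text \<open>Related choices offer the same prefixes up to the bound name of an input. For a received
  name \<open>z\<close> the input clause of \<open>branch_eqv\<close> is used at the instance
  \<open>z\<close>, which makes the continuations congruent.\<close>

lemma redex_atom_cong:
  assumes "redex D A A'" "rel_mset atom_cong A B"
  obtains B' where "redex D B B'" "rel_mset scong A' B'"
proof -
  have rs: "rel_mset scong R R'" if "rel_mset atom_cong R R'" for R R' :: "('a, 'b) proc multiset"
    using that by (rule multiset.rel_mono_strong) (rule atom_cong_imp_scong)
  show thesis using assms(1)
  proof (cases rule: redex.cases)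
    case (rx_tau S bs R)
    obtain B1 b where B: "B = add_mset b B1" "atom_cong (Choice bs) b" "rel_mset atom_cong R B1"
      using msed_rel_invL[of atom_cong "Choice bs" R B] assms(2) rx_tau(1) by blast
    obtain cs where cs: "b = Choice cs" "list_all2 branch_eqv bs cs" using atom_cong_Choice[OF B(2)] .
    obtain S' where "(Tau, S') \<in> set cs" "scong S S'" using branch_eqv_Tau[OF cs(2) rx_tau(3)] .
    then show thesis using B cs(1) rx_tau(2) rs
      by (intro that[of "add_mset S' B1"]) (auto intro: redex.rx_tau rel_mset_Plus)
  next
    case (rx_call K fs S as R)
    obtain B1 b where B: "B = add_mset b B1" "atom_cong (Call K as) b" "rel_mset atom_cong R B1"
      using msed_rel_invL[of atom_cong "Call K as" R B] assms(2) rx_call(1) by blast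
    then show thesis using rx_call(2-4) atom_cong_Call[OF B(2)] rs
      by (intro that[of "add_mset (msubst (map_of (zip fs as)) S) B1"])
         (auto intro: redex.rx_call rel_mset_Plus sc_refl)
  next
    case (rx_comm x y S1 bs z S2 cs R)
    obtain B0 b where B: "B = add_mset b B0" "atom_cong (Choice bs) b" "rel_mset atom_cong (add_mset (Choice cs) R) B0"
      using msed_rel_invL[of atom_cong "Choice bs" "add_mset (Choice cs) R" B] assms(2) rx_comm(1) by blast
    obtain B1 c where C: "B0 = add_mset c B1" "atom_cong (Choice cs) c" "rel_mset atom_cong R B1"
      using msed_rel_invL[of atom_cong "Choice cs" R B0] B(3) by blast
    obtain bs' where bs': "b = Choice bs'" "list_all2 branch_eqv bs bs'" using atom_cong_Choice[OF B(2)] .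
    obtain cs' where cs': "c = Choice cs'" "list_all2 branch_eqv cs cs'" using atom_cong_Choice[OF C(2)] .
    obtain y' S1' where 1: "(Inp x y', S1') \<in> set bs'"
      "\<And>z. scong (subst (id(y := z)) S1) (subst (id(y' := z)) S1')"
      using branch_eqv_Inp[OF bs'(2) rx_comm(3)] by blast
    obtain S2' where 2: "(Out x z, S2') \<in> set cs'" "scong S2 S2'"
      using branch_eqv_Out[OF cs'(2) rx_comm(4)] .
    show thesis
    proof (rule that)
      show "redex D B (add_mset (subst (id(y' := z)) S1') (add_mset S2' B1))"
        unfolding B(1) C(1) bs'(1) cs'(1) by (rule redex.rx_comm[OF 1(1) 2(1)])
      show "rel_mset scong A' (add_mset (subst (id(y' := z)) S1') (add_mset S2' B1))"
        unfolding rx_comm(2) by (intro rel_mset_Plus 1(2) 2(2) rs C(3))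
    qed
  qed
qed

lemma app_map_zip_comp:
  assumes "length as = length fs" "x \<in> set fs"
  shows "app_map (map_of (zip fs (map \<rho> as))) x = \<rho> (app_map (map_of (zip fs as)) x)"
proof -
  obtain a where "map_of (zip fs as) x = Some a"
    using assms by (metis map_of_zip_is_Some)
  moreover have "map_of (zip fs (map \<rho> as)) = map_option \<rho> \<circ> map_of (zip fs as)"
    by (simp add: zip_map2 map_of_map)
  ultimately show ?thesis by (simp add: app_map_def)
qed

lemma scong_subst_call:
  assumes "length as = length fs" "fn S \<subseteq> set fs"
  shows "scong (subst \<rho> (msubst (map_of (zip fs as)) S)) (msubst (map_of (zip fs (map \<rho> as))) S)"
proof -
  have "subst (\<rho> \<circ> app_map (map_of (zip fs as))) S = msubst (map_of (zip fs (map \<rho> as))) S"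
    using assms app_map_zip_comp[OF assms(1)] by (intro subst_cong) auto
  then show ?thesis using scong_subst_comp[of \<rho> "app_map (map_of (zip fs as))" S] by (simp only:)
qed

lemma react_fn:
  assumes "react D P Q" and closed: "closed_eqns D"
  shows "fn Q \<subseteq> fn P"
  using assms(1)
proof (induction rule: react.induct)
  case (re_tau S bs)
  then show ?case using fn_Choice_branch[OF re_tau] by simp
next
  case (re_call K fs S as)
  then show ?case using fn_msubst_zip[OF re_call(2) closed_eqnsD[OF closed re_call(1)]] by simp
next
  case (re_comm x y S1 bs z S2 cs)
  then show ?case using redex_fn[OF redex.rx_comm[OF re_comm, of D "{#}"] closed]
    by (simp add: app_map_single del: fn.simps(2))
next
  case (re_struct P P' Q' Q)
  then show ?case using fn_scong by metis
qed auto

text \<open>The reaction is located in a prenex form fixed beforehand, whose names \<open>vs\<close>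
  stay in front afterwards. The induction varies the environment for the sake of the restriction
  rule and the prenex form for the sake of the congruence rule.\<close>

lemma react_prenex:
  fixes D :: "('k, 'n::infinite) eqns"
  assumes "react D P Q" and closed: "closed_eqns D"
    and "prenex \<rho> P vs As" "distinct vs" "set vs \<inter> \<rho> ` fn P = {}"
  shows "\<exists>Cs. redex D (mset As) (mset Cs) \<and> scong (subst \<rho> Q) (res_list vs (par_list Cs))"
  using assms(1,3-)
proof (induction arbitrary: \<rho> vs As rule: react.induct)
  case (re_tau S bs)
  then have vs: "vs = []" "As = [Choice (map (subst_branch \<rho>) bs)]"
    by (auto elim: prenex_ChoiceE)
  have "(Tau, subst \<rho> S) \<in> set (map (subst_branch \<rho>) bs)"
    using re_tau(1) by force
  from redex.rx_tau[OF this, of D "{#}"] show ?case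
    unfolding vs by (intro exI[of _ "[subst \<rho> S]"]) (simp add: sc_refl)
next
  case (re_call K fs S as)
  then have vs: "vs = []" "As = [Call K (map \<rho> as)]"
    by (auto elim: prenex_CallE)
  have "redex D {#Call K (map \<rho> as)#} {#msubst (map_of (zip fs (map \<rho> as))) S#}"
    using redex.rx_call[where D = D, OF re_call(1), of "map \<rho> as" "{#}"] re_call(2) by simp
  then show ?case
    using scong_subst_call[OF re_call(2) closed_eqnsD[OF closed re_call(1)], of \<rho>] unfolding vs
    by (intro exI[of _ "[msubst (map_of (zip fs (map \<rho> as))) S]"]) simp
next
  case (re_comm x y S1 bs z S2 cs)
  then have "bs \<noteq> []" "cs \<noteq> []" by auto
  then have vs: "vs = []" "As = [Choice (map (subst_branch \<rho>) bs), Choice (map (subst_branch \<rho>) cs)]"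
    using re_comm.prems(1) by (auto elim!: prenex_ChoiceE prenex_ParE)
  define u where "u = avoid y (\<rho> ` (fn S1 - {y}))"
  have u: "u \<notin> \<rho> ` (fn S1 - {y})" unfolding u_def by (rule avoid_fresh) simp
  have "(Inp (\<rho> x) u, subst (\<rho>(y := u)) S1) \<in> set (map (subst_branch \<rho>) bs)"
    using re_comm.hyps(1) unfolding u_def by force
  moreover have "(Out (\<rho> x) (\<rho> z), subst \<rho> S2) \<in> set (map (subst_branch \<rho>) cs)"
    using re_comm.hyps(2) by force
  ultimately have "redex D (mset As) (mset [subst (id(u := \<rho> z)) (subst (\<rho>(y := u)) S1), subst \<rho> S2])"
    unfolding vs using redex.rx_comm[of "\<rho> x" u _ _ "\<rho> z" _ _ D "{#}"] by simp
  moreover have "scong (subst \<rho> (subst (id(y := z)) S1)) (subst (id(u := \<rho> z)) (subst (\<rho>(y := u)) S1))"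
  proof -
    have "scong (subst \<rho> (subst (id(y := z)) S1)) (subst (\<rho> \<circ> id(y := z)) S1)"
      by (rule scong_subst_comp)
    also have "\<rho> \<circ> id(y := z) = (id \<circ> \<rho>)(y := \<rho> z)" by auto
    also have "scong (subst \<dots> S1) (subst (id(u := \<rho> z)) (subst (\<rho>(y := u)) S1))"
      by (rule sc_sym[OF scong_subst_upd_comp[OF u]])
    finally show ?thesis .
  qed
  then have "scong (subst \<rho> (Par (msubst [y \<mapsto> z] S1) S2))
      (res_list vs (par_list [subst (id(u := \<rho> z)) (subst (\<rho>(y := u)) S1), subst \<rho> S2]))"
    unfolding vs app_map_single by (simp add: sc_cong_par sc_refl)
  ultimately show ?case by blast
next
  case (re_par P P' Q)
  obtain v1 v2 A1 A2 where vs: "vs = v1 @ v2" "As = A1 @ A2"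
    and px: "prenex \<rho> P v1 A1" "prenex \<rho> Q v2 A2"
    using re_par.prems(1) by (auto elim: prenex_ParE)
  have disj: "distinct v1" "distinct v2" "set v1 \<inter> set v2 = {}"
    "set v1 \<inter> \<rho> ` fn P = {}" "set v1 \<inter> \<rho> ` fn Q = {}" "set v2 \<inter> \<rho> ` fn P = {}" "set v2 \<inter> \<rho> ` fn Q = {}"
    using re_par.prems vs by (auto simp: image_Un)
  obtain Cs where C: "redex D (mset A1) (mset Cs)" "scong (subst \<rho> P') (res_list v1 (par_list Cs))"
    using re_par.IH[OF px(1) disj(1,4)] by blast
  have Q: "scong (subst \<rho> Q) (res_list v2 (par_list A2))"
    using scong_prenex[OF px(2) disj(2,7)] .
  have "scong (subst \<rho> (Par P' Q)) (Par (res_list v1 (par_list Cs)) (res_list v2 (par_list A2)))"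
    using C(2) Q by (simp add: sc_cong_par)
  also have "scong \<dots> (res_list (v1 @ v2) (Par (par_list Cs) (par_list A2)))"
  proof (rule scong_Par_res_lists)
    show "set v1 \<inter> fn (res_list v2 (par_list A2)) = {}"
      unfolding fn_scong[OF Q, symmetric] fn_subst using disj by blast
    have "fn (par_list Cs) \<subseteq> \<rho> ` fn P \<union> set v1"
      using redex_fn[OF C(1) closed] prenex_fn[OF px(1)] unfolding fn_par_list by simp
    then show "set v2 \<inter> fn (par_list Cs) = {}" using disj by blast
  qed
  also have "scong \<dots> (res_list vs (par_list (Cs @ A2)))"
    unfolding vs by (intro scong_res_list_cong sc_sym[OF scong_par_list_append])
  finally show ?case
    using redex_union[OF C(1), of "mset A2"] unfolding vs(2)
    by (intro exI[of _ "Cs @ A2"]) simp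
next
  case (re_res P P' r)
  obtain v vs' where vs: "vs = v # vs'" and px: "prenex (\<rho>(r := v)) P vs' As"
    using re_res.prems(1) by (auto elim: prenex_ResE)
  have 1: "set vs' \<inter> (\<rho>(r := v)) ` fn P = {}" and 2: "distinct vs'" using re_res.prems vs by auto
  obtain Cs where C: "redex D (mset As) (mset Cs)"
    "scong (subst (\<rho>(r := v)) P') (res_list vs' (par_list Cs))"
    using re_res.IH[OF px 2 1] by blast
  have "v \<notin> \<rho> ` (fn P - {r})" using re_res.prems(3) vs by auto
  then have "v \<notin> \<rho> ` (fn P' - {r})" using react_fn[OF re_res.hyps closed] by blast
  then have "scong (subst \<rho> (Res r P')) (Res v (subst (\<rho>(r := v)) P'))" by (rule scong_subst_Res)
  also have "scong \<dots> (Res v (res_list vs' (par_list Cs)))" by (rule sc_cong_res[OF C(2)])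
  finally show ?case using C(1) vs by auto
next
  case (re_struct P P' Q' Q)
  have fnP: "fn P' = fn P" using fn_scong[OF re_struct.hyps(1)] by simp
  obtain ws Bs where B: "prenex \<rho> P' ws Bs" "distinct ws" "set ws \<inter> \<rho> ` fn P' = {}"
    "rel_mset atom_cong (mset As) (mset Bs)"
    by (rule prenex_leE[OF scong_imp_prenex_le[OF re_struct.hyps(1), THEN conjunct1] re_struct.prems(1,2),
          of "\<rho> ` fn P'"]) (use re_struct.prems fnP in auto)
  obtain Cs where C: "redex D (mset Bs) (mset Cs)" "scong (subst \<rho> Q') (res_list ws (par_list Cs))"
    using re_struct.IH[OF B(1-3)] by blast
  obtain A' where A': "redex D (mset As) A'" "rel_mset scong (mset Cs) A'"
    using redex_atom_cong[OF C(1) rel_mset_atom_cong_sym[OF B(4)]] .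
  obtain Ds where Ds: "A' = mset Ds" by (metis ex_mset)
  have CD: "scong (par_list Cs) (par_list Ds)" using A'(2) unfolding Ds by (rule scong_par_list_rel_mset)
  \<comment> \<open>The form of \<open>P'\<close> may use other names \<open>ws\<close>. As
    reactions create no names, the free names of \<open>Ds\<close> are bounded through both forms;
    \<open>vs\<close> and \<open>ws\<close> both avoid the visible names, so they bind the same
    names in \<open>Ds\<close>.\<close>
  have "fn (par_list Ds) \<subseteq> \<rho> ` fn P \<union> set vs"
    using redex_fn[OF A'(1)[unfolded Ds] closed] prenex_fn[OF re_struct.prems(1)] unfolding fn_par_list by simp
  moreover have "fn (par_list Ds) \<subseteq> \<rho> ` fn P \<union> set ws"
    using redex_fn[OF C(1) closed] prenex_fn[OF B(1)] fn_scong[OF CD] unfolding fn_par_list fnP by simp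
  ultimately have "set ws \<inter> fn (par_list Ds) = set vs \<inter> fn (par_list Ds)"
    using re_struct.prems(3) B(3) unfolding fnP by blast
  from scong_res_list_set[OF B(2) re_struct.prems(2) this]
  have "scong (res_list ws (par_list Ds)) (res_list vs (par_list Ds))" .
  moreover have "scong (subst \<rho> Q) (subst \<rho> Q')" by (rule scong_subst[OF sc_sym[OF re_struct.hyps(3)]])
  ultimately have "scong (subst \<rho> Q) (res_list vs (par_list Ds))"
    using C(2) scong_res_list_cong[OF CD] by (meson sc_trans)
  then show ?case using A'(1) Ds by blast
qed

text \<open>The empty choice is excluded because its prenex form has no component at all.\<close>

lemma prenex_atom:
  assumes "is_call A \<or> is_choice A \<and> A \<noteq> Nil0"
  shows "prenex id A [] [A]"
proof (cases A)
  case (Call K as)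
  then show ?thesis using prenex.px_call[of id K as] by (simp only: list.map_id)
next
  case (Choice bs)
  have "map (subst_branch id) bs = bs" using subst_id[of "Choice bs"] by (simp only: subst_Choice proc.inject)
  then show ?thesis using prenex.px_choice[of bs id] assms Choice by (simp only: proc.inject) auto
qed (use assms in auto)

lemma prenex_par_list:
  assumes "\<And>A. A \<in> set As \<Longrightarrow> is_call A \<or> is_choice A \<and> A \<noteq> Nil0"
  shows "prenex id (par_list As) [] As"
  using assms
proof (induction As rule: par_list.induct)
  case (2 P)
  then show ?case unfolding par_list.simps by (intro prenex_atom) simp
next
  case (3 P Q Ps)
  have "prenex id P [] [P]" using "3.prems"[of P] by (intro prenex_atom) simp
  moreover have "prenex id (par_list (Q # Ps)) [] (Q # Ps)" by (intro "3.IH" "3.prems") auto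
  ultimately show ?case using prenex.px_par[of id P "[]" "[P]" "par_list (Q # Ps)" "[]" "Q # Ps"]
    by (simp only: par_list.simps append.simps)
qed (simp add: prenex.px_nil)

lemma prenex_res_list: "prenex id P [] As \<Longrightarrow> prenex id (res_list rs P) rs As"
  by (induction rs) (auto intro!: prenex.px_res)

lemma react_inversion:
  assumes "react D P Q" and "closed_eqns D"
    and "scong P (res_list rs (par_list As))" "distinct rs"
    and "\<And>A. A \<in> set As \<Longrightarrow> is_call A \<or> is_choice A \<and> A \<noteq> Nil0"
  obtains Cs where "redex D (mset As) (mset Cs)" "scong Q (res_list rs (par_list Cs))"
proof -
  have "react D (res_list rs (par_list As)) Q"
    using re_struct[OF sc_sym[OF assms(3)] assms(1) sc_refl] .
  moreover have "prenex id (res_list rs (par_list As)) rs As"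
    using assms(5) by (intro prenex_res_list prenex_par_list)
  \<comment> \<open>The names \<open>rs\<close> serve as their own choice in the identity
    environment, since they are not free in the restricted process.\<close>
  moreover have "set rs \<inter> id ` fn (res_list rs (par_list As)) = {}" by (auto simp: fn_res_list)
  ultimately show thesis
    using react_prenex[OF _ assms(2) _ assms(4), of _ Q id As] that unfolding subst_id by blast
qed

text \<open>Redexes by position rather than by content: equal threads cannot be told apart in a
  multiset, but the net has to know which components fire.\<close>

inductive redex_at :: "('k, 'n::infinite) eqns \<Rightarrow> ('k, 'n) proc list \<Rightarrow> ('k, 'n) proc list \<Rightarrow> bool"
  for D :: "('k, 'n) eqns" and As where
  at_tau: "i < length As \<Longrightarrow> As ! i = Choice bs \<Longrightarrow> (Tau, S) \<in> set bs \<Longrightarrow> redex_at D As (As[i := S])"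
| at_call: "i < length As \<Longrightarrow> As ! i = Call K as \<Longrightarrow> D K = Some (fs, S) \<Longrightarrow> length as = length fs \<Longrightarrow>
    redex_at D As (As[i := msubst (map_of (zip fs as)) S])"
| at_comm: "i < length As \<Longrightarrow> j < length As \<Longrightarrow> i \<noteq> j \<Longrightarrow> As ! i = Choice bs \<Longrightarrow> As ! j = Choice cs \<Longrightarrow>
    (Out x z, S1) \<in> set bs \<Longrightarrow> (Inp x y, S2) \<in> set cs \<Longrightarrow>
    redex_at D As (As[i := S1, j := subst (id(y := z)) S2])"

lemma mset_split_nth: "i < length As \<Longrightarrow> mset As = add_mset (As ! i) (mset As - {#As ! i#})"
  by simp

lemma redex_at_imp_redex: "redex_at D As Cs \<Longrightarrow> redex D (mset As) (mset Cs)"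
proof (induction rule: redex_at.induct)
  case (at_tau i bs S)
  define R where "R = mset As - {#As ! i#}"
  have "mset As = add_mset (Choice bs) R" "mset (As[i := S]) = add_mset S R"
    using at_tau mset_split_nth[OF at_tau(1)] by (simp_all add: R_def mset_update)
  then show ?case using redex.rx_tau[OF at_tau(3), of D R] by (simp only:)
next
  case (at_call i K as fs S)
  define R where "R = mset As - {#As ! i#}"
  let ?S = "msubst (map_of (zip fs as)) S"
  have "mset As = add_mset (Call K as) R" "mset (As[i := ?S]) = add_mset ?S R"
    using at_call mset_split_nth[OF at_call(1)] by (simp_all add: R_def mset_update)
  then show ?case using redex.rx_call[where D = D, OF at_call(3,4), of R] by (simp only:)
next
  case (at_comm i j bs cs x z S1 y S2)
  define R1 where "R1 = mset As - {#Choice bs#}"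
  have 1: "mset As = add_mset (Choice bs) R1"
    using mset_split_nth[OF at_comm(1)] at_comm(4) by (simp add: R1_def)
  have upd: "mset (As[i := X]) = add_mset X R1" for X
    using at_comm(1,4) by (simp add: mset_update R1_def)
  \<comment> \<open>A call as placeholder at position \<open>i\<close> cannot be confused with a
    choice, so the second choice is found in the remainder even if it equals the first.\<close>
  have "As[i := Call undefined []] ! j = Choice cs" using at_comm by simp
  then have "Choice cs \<in> set (As[i := Call undefined []])"
    using at_comm(2) by (metis length_list_update nth_mem)
  then have "Choice cs \<in># add_mset (Call undefined []) R1" unfolding upd[symmetric] by simp
  then have cs: "Choice cs \<in># R1" by simp
  define R where "R = R1 - {#Choice cs#}"
  have 2: "R1 = add_mset (Choice cs) R" using cs by (simp add: R_def)
  let ?S = "subst (id(y := z)) S2"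
  have "As[i := S1] ! j = Choice cs" using at_comm by simp
  then have "mset (As[i := S1, j := ?S]) = add_mset ?S (add_mset S1 R)"
    using at_comm(2) by (subst mset_update) (simp_all add: upd 2)
  moreover have "mset As = add_mset (Choice cs) (add_mset (Choice bs) R)"
    unfolding 1 2 by (rule add_mset_commute)
  ultimately show ?case using redex.rx_comm[OF at_comm(7,6), of D R] by (simp only:)
qed

lemma mset_nthE:
  assumes "a \<in># mset As"
  obtains i where "i < length As" "As ! i = a"
  using assms by (metis in_set_conv_nth set_mset_mset)

lemma redex_imp_redex_at:
  assumes "redex D (mset As) C"
  obtains Cs where "redex_at D As Cs" "C = mset Cs"
  using assms
proof (cases rule: redex.cases)
  case (rx_tau S bs R)
  then have "Choice bs \<in># mset As" by simp
  then obtain i where i: "i < length As" "As ! i = Choice bs" by (rule mset_nthE)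
  have "C = mset (As[i := S])" using i rx_tau by (simp add: mset_update)
  then show thesis using that at_tau[OF i rx_tau(3)] by blast
next
  case (rx_call K fs S as R)
  then have "Call K as \<in># mset As" by simp
  then obtain i where i: "i < length As" "As ! i = Call K as" by (rule mset_nthE)
  have "C = mset (As[i := msubst (map_of (zip fs as)) S])" using i rx_call by (simp add: mset_update)
  then show thesis using that at_call[where D = D, OF i rx_call(3,4)] by blast
next
  case (rx_comm x y S1 bs z S2 cs R)
  then have "Choice cs \<in># mset As" by simp
  then obtain i where i: "i < length As" "As ! i = Choice cs" by (rule mset_nthE)
  \<comment> \<open>The placeholder forces the position \<open>j\<close> found below to differ from
    \<open>i\<close>, also when both choices are equal.\<close>
  define As' where "As' = As[i := Call undefined []]"
  have As': "mset As' = add_mset (Call undefined []) (add_mset (Choice bs) R)"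
    using i rx_comm by (simp add: mset_update As'_def)
  then have "Choice bs \<in># mset As'" by simp
  then obtain j where j: "j < length As'" "As' ! j = Choice bs" by (rule mset_nthE)
  have ij: "i \<noteq> j" using j i by (auto simp: As'_def)
  then have j': "j < length As" "As ! j = Choice bs" using j by (auto simp: As'_def)
  have "mset (As[i := S2]) = add_mset S2 (add_mset (Choice bs) R)"
    using i rx_comm by (simp add: mset_update)
  then have "C = mset (As[i := S2, j := subst (id(y := z)) S1])"
    using j' ij rx_comm(2) by (simp add: mset_update add_mset_commute)
  then show thesis using that at_comm[OF i(1) j'(1) ij i(2) j'(2) rx_comm(4,3)] by blast
qed

lemma redex_imp_react:
  assumes "redex D (mset As) (mset Cs)"
  shows "react D (res_list rs (par_list As)) (res_list rs (par_list Cs))"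
proof -
  have res: "react D (res_list rs P) (res_list rs Q)" if "react D P Q" for P Q
    using that by (induction rs) (auto intro: re_res)
  have Par: "react D (par_list As) (par_list Cs)"
    if eq: "mset As = mset (As' @ Bs)" "mset Cs = mset (Cs' @ Bs)" and r: "react D (par_list As') (par_list Cs')"
    for As' Cs' Bs
  proof (rule re_struct)
    show "scong (par_list As) (Par (par_list As') (par_list Bs))"
      using scong_par_list_mset[OF eq(1)] scong_par_list_append by (rule sc_trans)
    show "react D (Par (par_list As') (par_list Bs)) (Par (par_list Cs') (par_list Bs))"
      using r by (rule re_par)
    show "scong (Par (par_list Cs') (par_list Bs)) (par_list Cs)"
      using scong_par_list_mset[OF eq(2)] scong_par_list_append by (meson sc_sym sc_trans)
  qed
  have "react D (par_list As) (par_list Cs)" using assms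
  proof (cases rule: redex.cases)
    case (rx_tau S bs R)
    obtain Bs where "R = mset Bs" by (metis ex_mset)
    then show ?thesis using rx_tau by (intro Par[of "[Choice bs]" Bs "[S]"]) (auto intro: re_tau)
  next
    case (rx_call K fs S as R)
    obtain Bs where "R = mset Bs" by (metis ex_mset)
    then show ?thesis using rx_call
      by (intro Par[of "[Call K as]" Bs "[msubst (map_of (zip fs as)) S]"]) (auto intro: re_call)
  next
    case (rx_comm x y S1 bs z S2 cs R)
    obtain Bs where "R = mset Bs" by (metis ex_mset)
    then show ?thesis using rx_comm re_comm[OF rx_comm(3,4), of D]
      by (intro Par[of "[Choice bs, Choice cs]" Bs "[subst (id(y := z)) S1, S2]"]) (auto simp: app_map_single)
  qed
  then show ?thesis by (rule res)
qed

section \<open>Names in scope along the control flow\<close>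

locale fcp =
  fixes F :: "('k, 'n::{infinite,linorder}) fcp_spec"
  assumes nf: "normal_form F"
begin

lemma finite_dom: "finite (dom (eqs F))"
  and bound_once: "bound_once F"
  and finite_PUB: "finite (PUB F)"
  and finite_NEW: "finite (NEW F)"
  and NEW_fresh: "NEW F \<inter> (RESTR F \<union> INP F \<union> FRM F \<union> PUB F) = {}"
  and card_NEW: "card (NEW F) = card (RESTR F) + card (INP F) + card (FRM F)"
  and eqn_ok: "\<forall>K \<in> dom (eqs F).
        is_thread (body F K) \<and> binders_used (body F K) \<and>
        fn (body F K) = set (formals F K) \<and>
        (\<forall>(L, as) \<in> calls (body F K).
           L \<noteq> K \<and> L \<in> dom (eqs F) \<and> length as = length (formals F L))"
  and init_ok: "\<forall>i < nthreads F. init_ident F i \<in> dom (eqs F) \<and>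
        (is_choice (init_thread F i) \<or> is_call (init_thread F i)) \<and>
        dom (init_map F i) = set (formals F (init_ident F i)) \<and>
        ran (init_map F i) \<subseteq> set (restricted F) \<union> PUB F"
  and idents_ok: "\<forall>i < nthreads F. \<forall>j < nthreads F. i \<noteq> j \<longrightarrow>
        thread_idents F i \<inter> thread_idents F j = {}"
  using nf unfolding normal_form_def by simp_all

lemma
  assumes "K \<in> dom (eqs F)"
  shows body_thread: "is_thread (body F K)"
    and body_binders_used: "binders_used (body F K)"
    and fn_body: "fn (body F K) = set (formals F K)"
  using bspec[OF eqn_ok assms] by simp_all

lemma calls_body:
  assumes "K \<in> dom (eqs F)" "(L, as) \<in> calls (body F K)"
  shows "L \<noteq> K" "L \<in> dom (eqs F)" "length as = length (formals F L)"
  using bspec[OF eqn_ok assms(1)] assms(2) by blast+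

lemma
  assumes "i < nthreads F"
  shows init_ident_dom: "init_ident F i \<in> dom (eqs F)"
    and init_thread_stable: "is_choice (init_thread F i) \<or> is_call (init_thread F i)"
    and dom_init_map: "dom (init_map F i) = set (formals F (init_ident F i))"
  using init_ok[rule_format, OF assms] by simp_all

lemma thread_idents_disjoint:
  "i < nthreads F \<Longrightarrow> j < nthreads F \<Longrightarrow> i \<noteq> j \<Longrightarrow> thread_idents F i \<inter> thread_idents F j = {}"
  using idents_ok by blast

lemma eqs_SomeD:
  assumes "eqs F K = Some (fs, S)"
  shows "K \<in> dom (eqs F)" "formals F K = fs" "body F K = S"
  using assms by (auto simp: formals_def body_def)

lemma eqs_Some: "K \<in> dom (eqs F) \<Longrightarrow> eqs F K = Some (formals F K, body F K)"
  by (auto simp: formals_def body_def)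

lemma closed_eqs: "closed_eqns (eqs F)"
  unfolding closed_eqns_def using eqs_SomeD fn_body by fastforce

section \<open>Name classes and the identifiers of a thread\<close>

abbreviation binders :: "'k \<Rightarrow> 'n set" where
  "binders K \<equiv> set (eqn_binders F K)"

abbreviation vars :: "'n set" where
  "vars \<equiv> INP F \<union> FRM F \<union> RESTR F"

lemma distinct_eqn_binders: "K \<in> dom (eqs F) \<Longrightarrow> distinct (eqn_binders F K)"
  using bound_once unfolding bound_once_def by blast

lemma binders_disjoint:
  "K \<in> dom (eqs F) \<Longrightarrow> L \<in> dom (eqs F) \<Longrightarrow> K \<noteq> L \<Longrightarrow> binders K \<inter> binders L = {}"
  using bound_once unfolding bound_once_def by blast

lemma formals_FRM: "K \<in> dom (eqs F) \<Longrightarrow> set (formals F K) \<subseteq> FRM F"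
  by (auto simp: FRM_def)

lemma res_binders_RESTR: "K \<in> dom (eqs F) \<Longrightarrow> set (res_binders (body F K)) \<subseteq> RESTR F"
  by (auto simp: RESTR_def)

lemma inp_binders_INP: "K \<in> dom (eqs F) \<Longrightarrow> set (inp_binders (body F K)) \<subseteq> INP F"
  by (auto simp: INP_def)

lemma finite_vars: "finite (INP F)" "finite (FRM F)" "finite (RESTR F)"
  using finite_dom by (auto simp: INP_def FRM_def RESTR_def)

text \<open>Not a conjunct of \<open>normal_form\<close>, but a consequence of every name being
  bound at most once. The case distinction on \<open>RESTR\<close> in \<open>cmd_pre\<close> and
  \<open>cmd_post\<close> is unambiguous because of it.\<close>

lemma RESTR_disjoint: "(INP F \<union> FRM F) \<inter> RESTR F = {}"
proof -
  have False if x: "x \<in> INP F \<union> FRM F" "x \<in> RESTR F" for x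
  proof -
    obtain K where K: "K \<in> dom (eqs F)" "x \<in> set (inp_binders (body F K)) \<or> x \<in> set (formals F K)"
      using x(1) by (auto simp: INP_def FRM_def)
    then have xK: "x \<in> binders K" by (auto simp: eqn_binders_def)
    show False
    proof (cases "x \<in> set (restricted F)")
      case True
      then show False using xK K(1) bound_once unfolding bound_once_def by blast
    next
      case False
      then obtain L where L: "L \<in> dom (eqs F)" "x \<in> set (res_binders (body F L))"
        using x(2) by (auto simp: RESTR_def)
      then have "x \<in> binders L" by (auto simp: eqn_binders_def)
      then have "K = L" using binders_disjoint[OF K(1) L(1)] xK by blast
      then show False using distinct_eqn_binders[OF K(1)] K(2) L(2) by (auto simp: eqn_binders_def)
    qed
  qed
  then show ?thesis by blast
qed

lemma thread_idents_dom: "i < nthreads F \<Longrightarrow> K \<in> thread_idents F i \<Longrightarrow> K \<in> dom (eqs F)"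
proof -
  assume i: "i < nthreads F" and "K \<in> thread_idents F i"
  then have "(init_ident F i, K) \<in> (call_graph F)\<^sup>*" by (simp add: thread_idents_def)
  then show ?thesis
  proof (cases rule: rtranclE)
    case base
    then show ?thesis using init_ident_dom[OF i] by simp
  next
    case (step L)
    then show ?thesis using calls_body(2) unfolding call_graph_def by blast
  qed
qed

lemma thread_idents_call:
  assumes "i < nthreads F" "K \<in> thread_idents F i" "(L, as) \<in> calls (body F K)"
  shows "L \<in> thread_idents F i"
proof -
  have "(K, L) \<in> call_graph F"
    using assms thread_idents_dom by (auto simp: call_graph_def)
  then show ?thesis using assms(2) unfolding thread_idents_def by auto
qed

text \<open>Name hygiene at a position inside the body of \<open>K\<close>. The names of
  \<open>fn S\<close> and \<open>l\<close> are those already in scope, with \<open>l\<close> waiting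
  to be unmapped; the binders still ahead are distinct from all of these and from each
  other.\<close>

definition scoped :: "'k \<Rightarrow> ('k, 'n) proc \<Rightarrow> 'n list \<Rightarrow> bool" where
  "scoped K S l \<longleftrightarrow> is_thread S \<and> binders_used S \<and> calls S \<subseteq> calls (body F K) \<and>
     distinct l \<and> set l \<inter> fn S = {} \<and>
     distinct (res_binders S) \<and> distinct (inp_binders S) \<and>
     set (res_binders S) \<inter> set (inp_binders S) = {} \<and>
     (set (res_binders S) \<union> set (inp_binders S)) \<inter> (fn S \<union> set l) = {} \<and>
     fn S \<union> set l \<subseteq> binders K \<and>
     set (res_binders S) \<subseteq> set (res_binders (body F K)) \<and>
     set (inp_binders S) \<subseteq> set (inp_binders (body F K))"

lemma scopedD:
  assumes "scoped K S l"
  shows "is_thread S" "binders_used S" "calls S \<subseteq> calls (body F K)"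
    "distinct l" "set l \<inter> fn S = {}"
    "distinct (res_binders S)" "distinct (inp_binders S)"
    "set (res_binders S) \<inter> set (inp_binders S) = {}"
    "(set (res_binders S) \<union> set (inp_binders S)) \<inter> (fn S \<union> set l) = {}"
    "fn S \<union> set l \<subseteq> binders K"
    "set (res_binders S) \<subseteq> set (res_binders (body F K))"
    "set (inp_binders S) \<subseteq> set (inp_binders (body F K))"
  using assms unfolding scoped_def by simp_all

lemma scoped_body: "K \<in> dom (eqs F) \<Longrightarrow> scoped K (body F K) []"
  using distinct_eqn_binders[of K]
  by (auto simp: scoped_def eqn_binders_def body_thread body_binders_used fn_body)

lemma scoped_Res:
  assumes "scoped K (Res r S) l"
  shows "scoped K S l" "r \<in> fn S" "r \<notin> fn (Res r S) \<union> set l" "r \<in> set (res_binders (body F K))"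
proof -
  have "r \<in> binders K" using assms by (auto simp: scoped_def eqn_binders_def)
  have r: "r \<notin> set l" "r \<notin> set (res_binders S)" "r \<notin> set (inp_binders S)"
    using assms by (auto simp: scoped_def)
  have "set l \<inter> (fn S - {r}) = {}" using assms by (simp add: scoped_def)
  then have 1: "set l \<inter> fn S = {}" using r by blast
  have "(set (res_binders S) \<union> set (inp_binders S)) \<inter> (fn S - {r} \<union> set l) = {}"
    using assms by (auto simp: scoped_def)
  then have 2: "(set (res_binders S) \<union> set (inp_binders S)) \<inter> (fn S \<union> set l) = {}" using r by blast
  have "fn S - {r} \<union> set l \<subseteq> binders K" using assms by (simp add: scoped_def)
  then have 3: "fn S \<union> set l \<subseteq> binders K" using \<open>r \<in> binders K\<close> by blast
  show "scoped K S l" using assms 1 2 3 by (simp add: scoped_def)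
qed (use assms in \<open>auto simp: scoped_def\<close>)

lemma set_dropped: "set (dropped bs S) = fn (Choice bs) - fn S" "distinct (dropped bs S)"
proof -
  have "finite (fn (Choice bs) - fn S)" by (intro finite_Diff finite_fn)
  then show "set (dropped bs S) = fn (Choice bs) - fn S" "distinct (dropped bs S)"
    unfolding dropped_def by (auto simp del: fn.simps)
qed

lemma scoped_Choice:
  assumes sc: "scoped K (Choice bs) l" and mem: "(\<pi>, S) \<in> set bs"
  shows "scoped K S (l @ dropped bs S)"
    and "set (prefix_binders \<pi>) \<subseteq> fn S"
    and "set (prefix_binders \<pi>) \<inter> (fn (Choice bs) \<union> set l) = {}"
    and "set (prefix_binders \<pi>) \<subseteq> set (inp_binders (body F K))"
proof -
  let ?p = "set (prefix_binders \<pi>)"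
  have rb: "set (res_binders S) \<subseteq> set (res_binders (Choice bs))"
    and ib: "set (inp_binders S) \<subseteq> set (inp_binders (Choice bs))" "?p \<subseteq> set (inp_binders (Choice bs))"
    and cl: "calls S \<subseteq> calls (Choice bs)"
    using mem by force+
  have "distinct (concat (map (\<lambda>(\<pi>, P). res_binders P) bs))"
    and di: "distinct (concat (map (\<lambda>(\<pi>, P). prefix_binders \<pi> @ inp_binders P) bs))"
    using sc by (simp_all add: scoped_def)
  then have d1: "distinct (res_binders S)" using mem by (force simp: distinct_concat_iff)
  have d2: "distinct (prefix_binders \<pi> @ inp_binders S)"
    using di mem by (force simp: distinct_concat_iff simp del: distinct_append)
  note sc' = scopedD[OF sc]
  show p1: "?p \<subseteq> fn S" using sc'(2) mem by auto
  show p2: "?p \<inter> (fn (Choice bs) \<union> set l) = {}" using sc'(9) ib(2) by blast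
  show p3: "?p \<subseteq> set (inp_binders (body F K))" using sc'(12) ib(2) by blast
  have fnS: "fn S \<subseteq> fn (Choice bs) \<union> ?p"
    using fn_Choice_branch[OF mem] by (cases \<pi>) auto
  have th: "is_thread S" "binders_used S" using sc'(1,2) mem by auto
  have p4: "?p \<inter> set (res_binders S) = {}" using sc'(8) rb ib(2) by blast
  have p5: "?p \<inter> set (inp_binders S) = {}" "distinct (inp_binders S)" using d2 by auto
  have p6: "?p \<subseteq> binders K" using p3 by (auto simp: eqn_binders_def)
  have 1: "set l \<inter> fn S = {}" using sc'(5) fnS p2 by blast
  have 2: "distinct (l @ dropped bs S)"
    unfolding distinct_append set_dropped(1) using sc'(4,5) set_dropped(2) by blast
  have "(set (res_binders S) \<union> set (inp_binders S)) \<inter> (fn (Choice bs) \<union> set l) = {}"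
    using sc'(9) rb ib(1) by blast
  then have 3: "(set (res_binders S) \<union> set (inp_binders S)) \<inter> (fn S \<union> set (l @ dropped bs S)) = {}"
    unfolding set_append set_dropped(1) using fnS p4 p5(1) by blast
  have 4: "fn S \<union> set (l @ dropped bs S) \<subseteq> binders K"
    unfolding set_append set_dropped(1) using sc'(10) fnS p6 by blast
  have 5: "set (l @ dropped bs S) \<inter> fn S = {}" unfolding set_append set_dropped(1) using 1 by blast
  have 6: "set (res_binders S) \<inter> set (inp_binders S) = {}" using sc'(8) rb ib(1) by blast
  have 7: "calls S \<subseteq> calls (body F K)" "set (res_binders S) \<subseteq> set (res_binders (body F K))"
    "set (inp_binders S) \<subseteq> set (inp_binders (body F K))"
    using cl sc'(3) rb sc'(11) ib(1) sc'(12) by (meson subset_trans)+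
  show "scoped K S (l @ dropped bs S)"
    unfolding scoped_def using th 2 3 4 5 6 7 d1 p5(2) by (intro conjI)
qed

fun residual :: "('k, 'n) ctrl \<Rightarrow> ('k, 'n) proc" where
  "residual (Thr S) = S"
| "residual (Pend K xs) = Call K (xs @ drop (length xs) (formals F K))"

text \<open>The names that carry a value while the token is on this place: those of the denoted
  thread together with those in \<open>l\<close> that wait to be unmapped.\<close>

fun live :: "('k, 'n) aug \<Rightarrow> 'n set" where
  "live (c, l) = fn (residual c) \<union> set l"

text \<open>The call-free derivation is kept because \<open>derived\<close> in the bisimulation
  relation asks for it. A call under way lies between two bodies: its arguments and waiting names
  belong to the caller \<open>K\<close>, its formal parameters to the callee
  \<open>L\<close>.\<close>

fun place_ok :: "nat \<Rightarrow> ('k, 'n) aug \<Rightarrow> bool" where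
  "place_ok i (Thr S, l) \<longleftrightarrow> (\<exists>K \<in> thread_idents F i. scoped K S l \<and>
     ((Thr (body F K), []), (Thr S, l)) \<in> (call_free_step F)\<^sup>*)"
| "place_ok i (Pend L xs, l) \<longleftrightarrow> (\<exists>K \<in> thread_idents F i. (\<exists>as. (L, as) \<in> calls (body F K)) \<and>
     length xs \<le> length (formals F L) \<and> distinct l \<and> set xs \<union> set l \<subseteq> binders K)"

definition thread_vars :: "nat \<Rightarrow> 'n set" where
  "thread_vars i = (\<Union>K \<in> thread_idents F i. binders K)"

text \<open>Threads run disjoint sets of identifiers, and different identifiers bind disjoint sets
  of names.\<close>

lemma thread_vars_disjoint:
  "i < nthreads F \<Longrightarrow> j < nthreads F \<Longrightarrow> i \<noteq> j \<Longrightarrow> thread_vars i \<inter> thread_vars j = {}"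
  unfolding thread_vars_def
  using thread_idents_disjoint[of i j] thread_idents_dom binders_disjoint by blast

text \<open>Lets the call rules treat both constructors alike: for a call with its full argument
  list the dropped part of the formal parameters is empty, so both have the same residual.\<close>

lemma call_place:
  assumes "i < nthreads F" "place_ok i (c, l)" "c = Thr (Call L xs) \<or> c = Pend L xs"
  obtains K as where "K \<in> thread_idents F i" "(L, as) \<in> calls (body F K)"
    "length xs \<le> length (formals F L)" "distinct l" "set xs \<union> set l \<subseteq> binders K"
    "residual c = Call L (xs @ drop (length xs) (formals F L))"
  using assms(3)
proof
  assume c: "c = Thr (Call L xs)"
  then obtain K where K: "K \<in> thread_idents F i" "scoped K (Call L xs) l"
    using assms(2) by auto
  then have "(L, xs) \<in> calls (body F K)" by (auto simp: scoped_def)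
  moreover have "length xs = length (formals F L)"
    using calls_body(3)[OF thread_idents_dom[OF assms(1) K(1)] calculation] .
  ultimately show thesis using that[of K xs] K c by (auto simp: scoped_def)
qed (use assms(2) that in auto)

lemma live_thread_vars:
  assumes "i < nthreads F" "place_ok i q"
  shows "live q \<subseteq> thread_vars i"
proof -
  obtain c l where q: "q = (c, l)" by force
  show ?thesis
  proof (cases c)
    case (Thr S)
    then obtain K where "K \<in> thread_idents F i" "scoped K S l" using assms q by auto
    then show ?thesis using q Thr by (auto simp: scoped_def thread_vars_def)
  next
    case (Pend L xs)
    then obtain K as where K: "K \<in> thread_idents F i" "(L, as) \<in> calls (body F K)"
      "set xs \<union> set l \<subseteq> binders K" using assms q by auto
    have "L \<in> thread_idents F i" using thread_idents_call[OF assms(1) K(1,2)] .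
    moreover have "set (formals F L) \<subseteq> binders L" by (auto simp: eqn_binders_def)
    ultimately show ?thesis using q Pend K(1,3) by (auto simp: thread_vars_def dest: in_set_dropD)
  qed
qed

lemma call_free_stepI:
  assumes "t \<in> cf_trans F" "src t = (Thr S, l)" "\<not> is_call S"
  shows "((Thr S, l), tgt t) \<in> call_free_step F"
proof -
  have "((Thr S, l), tgt t) \<in> cf_step F" unfolding cf_step_def using assms(1,2) by force
  then show ?thesis using assms(3) unfolding call_free_step_def by simp
qed

lemma place_ok_step:
  assumes i: "i < nthreads F" and t: "t \<in> cf_trans F" and ok: "place_ok i (src t)"
  shows "place_ok i (tgt t)"
  using t
proof cases
  case (cf_nu n r S l)
  then obtain K where K: "K \<in> thread_idents F i" "scoped K (Res r S) l"
    "((Thr (body F K), []), (Thr (Res r S), l)) \<in> (call_free_step F)\<^sup>*" using ok by auto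
  have "((Thr (Res r S), l), tgt t) \<in> call_free_step F"
    by (rule call_free_stepI[OF t]) (simp_all add: cf_nu)
  with K show ?thesis using scoped_Res(1)[OF K(2)] cf_nu(1) by (auto intro: rtrancl.rtrancl_into_rtrancl)
next
  case (cf_tau S bs l)
  then obtain K where K: "K \<in> thread_idents F i" "scoped K (Choice bs) l"
    "((Thr (body F K), []), (Thr (Choice bs), l)) \<in> (call_free_step F)\<^sup>*" using ok by auto
  have "((Thr (Choice bs), l), tgt t) \<in> call_free_step F"
    by (rule call_free_stepI[OF t]) (simp_all add: cf_tau)
  with K show ?thesis using scoped_Choice(1)[OF K(2) cf_tau(2)] cf_tau(1) by (auto intro: rtrancl.rtrancl_into_rtrancl)
next
  case (cf_snd x y S bs a b l)
  then obtain K where K: "K \<in> thread_idents F i" "scoped K (Choice bs) l"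
    "((Thr (body F K), []), (Thr (Choice bs), l)) \<in> (call_free_step F)\<^sup>*" using ok by auto
  have "((Thr (Choice bs), l), tgt t) \<in> call_free_step F"
    by (rule call_free_stepI[OF t]) (simp_all add: cf_snd)
  with K show ?thesis using scoped_Choice(1)[OF K(2) cf_snd(2)] cf_snd(1) by (auto intro: rtrancl.rtrancl_into_rtrancl)
next
  case (cf_rec x y S bs a b l)
  then obtain K where K: "K \<in> thread_idents F i" "scoped K (Choice bs) l"
    "((Thr (body F K), []), (Thr (Choice bs), l)) \<in> (call_free_step F)\<^sup>*" using ok by auto
  have "((Thr (Choice bs), l), tgt t) \<in> call_free_step F"
    by (rule call_free_stepI[OF t]) (simp_all add: cf_rec)
  with K show ?thesis using scoped_Choice(1)[OF K(2) cf_rec(2)] cf_rec(1) by (auto intro: rtrancl.rtrancl_into_rtrancl)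
next
  case (cf_call1 c L xs x fs S a l)
  have pl: "place_ok i (c, l)" using ok cf_call1(1) by simp
  obtain K as where "K \<in> thread_idents F i" "(L, as) \<in> calls (body F K)"
    "length (xs @ [x]) \<le> length (formals F L)" "distinct l" "set (xs @ [x]) \<union> set l \<subseteq> binders K"
    using call_place[OF i pl cf_call1(2)] by blast
  then show ?thesis using cf_call1(1) by auto
next
  case (cf_call2 c L a x l)
  have pl: "place_ok i (c, x # l)" using ok cf_call2(1) by simp
  obtain K as where "K \<in> thread_idents F i" "(L, as) \<in> calls (body F K)"
    "distinct (x # l)" "set (x # l) \<subseteq> binders K"
    using call_place[OF i pl cf_call2(2)] by (metis Un_subset_iff)
  then show ?thesis using cf_call2(1) by auto
next
  case (cf_call3 c L fs S)
  have pl: "place_ok i (c, [])" using ok cf_call3(1) by simp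
  obtain K as where K: "K \<in> thread_idents F i" "(L, as) \<in> calls (body F K)"
    using call_place[OF i pl cf_call3(2)] by blast
  then have L: "L \<in> thread_idents F i" using thread_idents_call[OF i] by blast
  moreover have "S = body F L" using eqs_SomeD(3)[OF cf_call3(3)] by simp
  \<comment> \<open>Unfolding restarts the call-free derivation at the body of the callee, which
    reaches itself in no step.\<close>
  ultimately show ?thesis using cf_call3(1) scoped_body[OF thread_idents_dom[OF i L]] by auto
qed

section \<open>Markings as control states with valuations\<close>

text \<open>The \<open>Neq\<close> and \<open>NeqStar\<close> places are complements of
  \<open>Eq\<close> places, so a valuation carries all the information in a marking of the
  substitution net.\<close>

fun val_marking :: "('n \<rightharpoonup> 'n) \<Rightarrow> ('k, 'n) marking" where
  "val_marking ev (Eq x a) = of_bool (ev x = Some a)"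
| "val_marking ev (Neq x n) = of_bool (x \<in> INP F \<union> FRM F \<and> n \<in> NEW F \<and> ev x \<noteq> Some n)"
| "val_marking ev (NeqStar n) = of_bool (n \<in> NEW F \<and> (\<forall>r \<in> RESTR F. ev r \<noteq> Some n))"
| "val_marking ev (Ctrl i q) = 0"

fun state_marking :: "(nat \<Rightarrow> ('k, 'n) aug) \<Rightarrow> ('n \<rightharpoonup> 'n) \<Rightarrow> ('k, 'n) marking" where
  "state_marking c ev (Ctrl i q) = of_bool (i < nthreads F \<and> c i = q)"
| "state_marking c ev p = val_marking ev p"

fun is_ctrl :: "('k, 'n) place \<Rightarrow> bool" where
  "is_ctrl (Ctrl i q) = True"
| "is_ctrl _ = False"

lemma state_marking_val: "\<not> is_ctrl p \<Longrightarrow> state_marking c ev p = val_marking ev p"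
  by (cases p) auto

text \<open>The part of \<open>subst_marking\<close> that remains to be demanded once a marking is
  written as \<open>val_marking ev\<close>. Injectivity on \<open>RESTR\<close> reflects the single
  token shared by \<open>NeqStar n\<close> and the places \<open>Eq r n\<close>.\<close>

definition valuation :: "('n \<rightharpoonup> 'n) \<Rightarrow> bool" where
  "valuation ev \<longleftrightarrow> dom ev \<subseteq> vars \<and> ran ev \<subseteq> vals F \<and>
     (\<forall>r \<in> RESTR F. \<forall>a. ev r = Some a \<longrightarrow> a \<in> NEW F) \<and> inj_on ev (dom ev \<inter> RESTR F)"

lemma valuationD:
  assumes "valuation ev"
  shows "ev x = Some a \<Longrightarrow> x \<in> vars" "ev x = Some a \<Longrightarrow> a \<in> vals F"
    "r \<in> RESTR F \<Longrightarrow> ev r = Some a \<Longrightarrow> a \<in> NEW F"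
    "r \<in> RESTR F \<Longrightarrow> r' \<in> RESTR F \<Longrightarrow> ev r = Some a \<Longrightarrow> ev r' = Some a \<Longrightarrow> r = r'"
  using assms unfolding valuation_def by (blast, blast intro: ranI, blast, metis IntI domI inj_onD)

lemma NEW_PUB: "a \<in> NEW F \<Longrightarrow> a \<notin> PUB F"
  using NEW_fresh by blast

section \<open>Effect of commands on valuations\<close>

lemma cmd_pre_not_ctrl: "p \<in> cmd_pre F c \<Longrightarrow> \<not> is_ctrl p"
  by (cases c) (auto split: if_splits)

lemma cmd_post_not_ctrl: "p \<in> cmd_post F c \<Longrightarrow> \<not> is_ctrl p"
  by (cases c) (auto split: if_splits)

definition cmds_pre :: "'n command set \<Rightarrow> ('k, 'n) place set" where
  "cmds_pre C = (\<Union>c \<in> C. cmd_pre F c)"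

definition cmds_post :: "'n command set \<Rightarrow> ('k, 'n) place set" where
  "cmds_post C = (\<Union>c \<in> C. cmd_post F c)"

text \<open>Speaks of the substitution places alone, since commands never touch control places;
  single and synchronised transitions then share the same computations.\<close>

definition cmd_effect :: "'n command set \<Rightarrow> ('n \<rightharpoonup> 'n) \<Rightarrow> ('n \<rightharpoonup> 'n) \<Rightarrow> bool" where
  "cmd_effect C ev ev' \<longleftrightarrow>
     (\<forall>p \<in> cmds_pre C. val_marking ev p > 0) \<and>
     (\<forall>p. val_marking ev' p =
        val_marking ev p - of_bool (p \<in> cmds_pre C) + of_bool (p \<in> cmds_post C))"

lemma cmd_effect_none: "cmd_effect {} ev ev"
  by (simp add: cmd_effect_def cmds_pre_def cmds_post_def)

text \<open>The preset consists of \<open>NeqStar n\<close> and all \<open>Neq y n\<close>, which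
  are jointly marked exactly when no name carries \<open>n\<close>. The places
  \<open>Neq y n\<close> keep their tokens, as only a restricted name changes its value.\<close>

lemma cmd_effect_new:
  assumes "r \<in> RESTR F" "n \<in> NEW F" "ev r = None" "n \<notin> ran ev"
  shows "cmd_effect {Map r n} ev (ev(r \<mapsto> n))"
proof -
  have n: "n \<notin> PUB F" using assms(2) by (rule NEW_PUB)
  have ev: "ev x \<noteq> Some n" for x using assms(4) by (auto intro: ranI)
  have rn: "r \<notin> INP F" "r \<notin> FRM F" using RESTR_disjoint assms(1) by blast+
  have pre: "cmds_pre {Map r n} = insert (NeqStar n) {Neq y n |y. y \<in> INP F \<union> FRM F}"
    using n assms(1) by (simp add: cmds_pre_def)
  have post: "cmds_post {Map r n} = insert (Eq r n) {Neq y n |y. y \<in> INP F \<union> FRM F}"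
    using n assms(1) by (simp add: cmds_post_def)
  have "val_marking (ev(r \<mapsto> n)) p =
        val_marking ev p - of_bool (p \<in> cmds_pre {Map r n}) + of_bool (p \<in> cmds_post {Map r n})" for p
    unfolding pre post using assms ev rn by (cases p) (auto, metis option.distinct(1))
  moreover have "\<forall>p \<in> cmds_pre {Map r n}. val_marking ev p > 0"
    unfolding pre using assms ev by auto
  ultimately show ?thesis unfolding cmd_effect_def by blast
qed

text \<open>\<open>T\<close> holds the accompanying tests, one for parameter passing and three for a
  synchronisation. They concern names that have a value, whereas \<open>y\<close> has none, so tests
  and mapping touch different places.\<close>

lemma cmd_effect_map:
  assumes "C = insert (Map y b) (case_prod Test ` T)"
    and "y \<in> INP F \<union> FRM F" "b \<in> vals F" "ev y = None" "\<And>x a. (x, a) \<in> T \<Longrightarrow> ev x = Some a"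
  shows "cmd_effect C ev (ev(y \<mapsto> b))"
proof -
  have y: "y \<notin> RESTR F" using RESTR_disjoint assms(2) by blast
  let ?T = "case_prod Eq ` T :: ('k, 'n) place set"
  have pre: "cmds_pre C = ?T \<union> (if b \<in> PUB F then {} else {Neq y b})"
    using y unfolding assms(1) by (auto simp: cmds_pre_def)
  have post: "cmds_post C = insert (Eq y b) ?T"
    using y unfolding assms(1) by (auto simp: cmds_post_def)
  have T: "val_marking ev p = 1" "p \<noteq> Eq y b" "p \<noteq> Neq y b" "val_marking (ev(y \<mapsto> b)) p = 1" if "p \<in> ?T" for p
    using that assms(4,5) by force+
  have nT: "Neq y b \<notin> ?T" "Eq y b \<notin> ?T" using T by blast+
  have "val_marking (ev(y \<mapsto> b)) p =
        val_marking ev p - of_bool (p \<in> cmds_pre C) + of_bool (p \<in> cmds_post C)" for p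
  proof (cases "p \<in> ?T")
    case True
    then show ?thesis unfolding pre post using T[OF True] by auto
  next
    case False
    then show ?thesis unfolding pre post using assms(2-4) y NEW_PUB by (cases p) auto
  qed
  moreover have "\<forall>p \<in> cmds_pre C. val_marking ev p > 0"
    unfolding pre using assms(2-4) T(1) by auto
  ultimately show ?thesis unfolding cmd_effect_def by blast
qed

lemma cmd_effect_unmap:
  assumes "valuation ev" "ev x = Some a"
  shows "cmd_effect {Unmap x a} ev (ev(x := None))"
proof -
  have x: "x \<in> vars" "a \<in> vals F" using valuationD[OF assms(1)] assms(2) by blast+
  have inj: "ev r = Some a \<Longrightarrow> r = x" if "x \<in> RESTR F" "r \<in> RESTR F" for r
    using valuationD(4)[OF assms(1)] assms(2) that by blast
  have new: "x \<in> RESTR F \<Longrightarrow> a \<in> NEW F" using valuationD(3)[OF assms(1)] assms(2) by blast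
  have pre: "cmds_pre {Unmap x a} = {Eq x a}" by (simp add: cmds_pre_def)
  have post: "cmds_post {Unmap x a} = (if a \<in> PUB F then {} else if x \<in> RESTR F then {NeqStar a} else {Neq x a})"
    by (simp add: cmds_post_def)
  have "val_marking (ev(x := None)) p =
        val_marking ev p - of_bool (p \<in> cmds_pre {Unmap x a}) + of_bool (p \<in> cmds_post {Unmap x a})" for p
  proof (cases p)
    case (Eq y b)
    then show ?thesis unfolding pre post using assms(2) by auto
  next
    case (Neq y b)
    then show ?thesis unfolding pre post using assms(2) x NEW_PUB RESTR_disjoint by auto
  next
    case (NeqStar b)
    show ?thesis
    proof (cases "x \<in> RESTR F \<and> b = a")
      case True
      \<comment> \<open>\<open>ev\<close> is injective on \<open>RESTR\<close>, so \<open>x\<close>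
        was the only restricted name with value \<open>a\<close>, and the token returned to
        \<open>NeqStar a\<close> is correct.\<close>
      then have "(ev(x := None)) r \<noteq> Some b" if "r \<in> RESTR F" for r
        using inj[OF _ that] by auto
      then show ?thesis unfolding pre post using NeqStar True new NEW_PUB assms(2) by auto
    next
      case False
      then have "(\<forall>r \<in> RESTR F. (ev(x := None)) r \<noteq> Some b) \<longleftrightarrow> (\<forall>r \<in> RESTR F. ev r \<noteq> Some b)"
        using assms(2) by (metis fun_upd_apply option.distinct(1) option.inject)
      then show ?thesis unfolding pre post using NeqStar False by auto
    qed
  qed (auto simp: pre post)
  then show ?thesis unfolding cmd_effect_def using assms(2) by (simp add: pre)
qed

lemma valuation_map:
  assumes "valuation ev" "y \<in> INP F \<union> FRM F" "b \<in> vals F"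
  shows "valuation (ev(y \<mapsto> b))"
proof -
  have y: "y \<notin> RESTR F" using RESTR_disjoint assms(2) by blast
  have "dom (ev(y \<mapsto> b)) \<subseteq> vars" using assms(1,2) by (auto simp: valuation_def)
  moreover have "ran (ev(y \<mapsto> b)) \<subseteq> vals F"
    using assms(1,3) by (auto simp: valuation_def ran_def)
  moreover have "\<forall>r \<in> RESTR F. \<forall>a. (ev(y \<mapsto> b)) r = Some a \<longrightarrow> a \<in> NEW F"
    using y valuationD(3)[OF assms(1)] by auto
  moreover have "inj_on (ev(y \<mapsto> b)) (dom (ev(y \<mapsto> b)) \<inter> RESTR F)"
    using y valuationD(4)[OF assms(1)] by (auto simp: inj_on_def split: if_splits)
  ultimately show ?thesis unfolding valuation_def by (intro conjI)
qed

lemma valuation_new: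
  assumes "valuation ev" "r \<in> RESTR F" "n \<in> NEW F" "n \<notin> ran ev"
  shows "valuation (ev(r \<mapsto> n))"
proof -
  have ev: "ev x \<noteq> Some n" for x using assms(4) by (auto intro: ranI)
  have "dom (ev(r \<mapsto> n)) \<subseteq> vars" using assms(1,2) by (auto simp: valuation_def)
  moreover have "ran (ev(r \<mapsto> n)) \<subseteq> vals F"
    using assms(1,3) by (auto simp: valuation_def ran_def)
  moreover have "\<forall>r' \<in> RESTR F. \<forall>a. (ev(r \<mapsto> n)) r' = Some a \<longrightarrow> a \<in> NEW F"
    using assms(3) valuationD(3)[OF assms(1)] by auto
  moreover have "inj_on (ev(r \<mapsto> n)) (dom (ev(r \<mapsto> n)) \<inter> RESTR F)"
    using ev valuationD(4)[OF assms(1)] by (auto simp: inj_on_def split: if_splits)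
  ultimately show ?thesis unfolding valuation_def by (intro conjI)
qed

lemma valuation_unmap:
  assumes "valuation ev"
  shows "valuation (ev(x := None))"
proof -
  have "dom (ev(x := None)) \<subseteq> vars" using assms by (auto simp: valuation_def)
  moreover have "ran (ev(x := None)) \<subseteq> vals F"
    using assms by (auto simp: valuation_def ran_def)
  moreover have "\<forall>r' \<in> RESTR F. \<forall>a. (ev(x := None)) r' = Some a \<longrightarrow> a \<in> NEW F"
    using valuationD(3)[OF assms(1)] by auto
  moreover have "inj_on (ev(x := None)) (dom (ev(x := None)) \<inter> RESTR F)"
    using valuationD(4)[OF assms(1)] by (auto simp: inj_on_def split: if_splits)
  ultimately show ?thesis unfolding valuation_def by (intro conjI)
qed

text \<open>This is what the size of \<open>NEW\<close> is for.\<close>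

lemma fresh_value:
  assumes "valuation ev" "r \<in> RESTR F" "ev r = None"
  obtains n where "n \<in> NEW F" "n \<notin> ran ev"
proof -
  have fin: "finite vars" using finite_vars by blast
  have dom: "dom ev \<subseteq> vars - {r}" using assms unfolding valuation_def by blast
  have "ran ev = (\<lambda>x. the (ev x)) ` dom ev" by (force simp: ran_def dom_def)
  then have "card (ran ev) \<le> card (dom ev)"
    by (metis card_image_le dom fin finite_Diff finite_subset)
  also have "\<dots> < card vars"
    using dom assms(2) fin by (intro psubset_card_mono) auto
  also have "card vars \<le> card (INP F) + card (FRM F) + card (RESTR F)"
    by (meson add_le_mono card_Un_le order_refl order_trans)
  finally have "card (ran ev) < card (NEW F)" unfolding card_NEW by simp
  moreover have "finite (ran ev)" using dom fin by (meson finite_Diff finite_ran finite_subset)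
  ultimately have "\<not> NEW F \<subseteq> ran ev" using card_mono by (metis leD)
  then show thesis using that by blast
qed

text \<open>The only link between process names and net values that can be maintained: a value in
  \<open>NEW\<close> may be reused for a different restricted name later on, so just the pattern of
  equalities is compared. Public names stand for themselves.\<close>

definition agree :: "'n set \<Rightarrow> ('n \<rightharpoonup> 'n) \<Rightarrow> ('n \<rightharpoonup> 'n) \<Rightarrow> bool" where
  "agree rs \<sigma> ev \<longleftrightarrow> dom \<sigma> = dom ev \<and>
     (\<forall>x a b. \<sigma> x = Some a \<longrightarrow> ev x = Some b \<longrightarrow> a \<in> PUB F \<and> b = a \<or> a \<in> rs \<and> b \<in> NEW F) \<and>
     (\<forall>x \<in> dom \<sigma>. \<forall>y \<in> dom \<sigma>. \<sigma> x = \<sigma> y \<longleftrightarrow> ev x = ev y)"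

lemma agreeD:
  assumes "agree rs \<sigma> ev"
  shows "dom \<sigma> = dom ev"
    "\<sigma> x = Some a \<Longrightarrow> ev x = Some b \<Longrightarrow> a \<in> PUB F \<and> b = a \<or> a \<in> rs \<and> b \<in> NEW F"
    "x \<in> dom \<sigma> \<Longrightarrow> y \<in> dom \<sigma> \<Longrightarrow> \<sigma> x = \<sigma> y \<longleftrightarrow> ev x = ev y"
  using assms unfolding agree_def by blast+

lemma agree_ran:
  assumes "agree rs \<sigma> ev" "\<sigma> x = Some a"
  shows "a \<in> rs \<union> PUB F"
proof -
  have "x \<in> dom ev" using agreeD(1)[OF assms(1)] assms(2) by (metis domI)
  then obtain b where "ev x = Some b" by blast
  then show ?thesis using agreeD(2)[OF assms] by blast
qed

text \<open>\<open>y\<close> repeats the entry of \<open>x\<close> in both maps and so acquires the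
  same equalities on both sides. Input and parameter passing are of this kind.\<close>

lemma agree_copy:
  assumes ag: "agree rs \<sigma> ev" and x: "\<sigma> x = Some a" "ev x = Some b" and y: "\<sigma> y = None" "ev y = None"
  shows "agree rs (\<sigma>(y \<mapsto> a)) (ev(y \<mapsto> b))"
proof -
  have "x \<noteq> y" using x y by auto
  have ab: "\<sigma> z = Some a \<longleftrightarrow> ev z = Some b" if "z \<in> dom \<sigma>" for z
    using agreeD(3)[OF ag that, of x] x by auto
  have "dom (\<sigma>(y \<mapsto> a)) = dom (ev(y \<mapsto> b))" using agreeD(1)[OF ag] by simp
  moreover have "a' \<in> PUB F \<and> b' = a' \<or> a' \<in> rs \<and> b' \<in> NEW F"
    if "(\<sigma>(y \<mapsto> a)) z = Some a'" "(ev(y \<mapsto> b)) z = Some b'" for z a' b'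
    using that agreeD(2)[OF ag] x by (auto split: if_splits)
  moreover have "(\<sigma>(y \<mapsto> a)) z = (\<sigma>(y \<mapsto> a)) z' \<longleftrightarrow> (ev(y \<mapsto> b)) z = (ev(y \<mapsto> b)) z'"
    if "z \<in> dom (\<sigma>(y \<mapsto> a))" "z' \<in> dom (\<sigma>(y \<mapsto> a))" for z z'
  proof -
    have *: "z = y \<or> z \<noteq> y \<and> z \<in> dom \<sigma>" "z' = y \<or> z' \<noteq> y \<and> z' \<in> dom \<sigma>" using that by auto
    then show ?thesis using agreeD(3)[OF ag] ab by (elim disjE conjE) (simp_all, metis+)
  qed
  ultimately show ?thesis unfolding agree_def by blast
qed

text \<open>Both new entries are fresh in their own map, so neither side gains an equality with an
  older entry.\<close>

lemma agree_new:
  assumes ag: "agree rs \<sigma> ev" and v: "v \<notin> rs \<union> PUB F" and n: "n \<in> NEW F" "n \<notin> ran ev"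
    and r: "\<sigma> r = None" "ev r = None"
  shows "agree (insert v rs) (\<sigma>(r \<mapsto> v)) (ev(r \<mapsto> n))"
proof -
  have \<sigma>v: "\<sigma> z \<noteq> Some v" for z using agree_ran[OF ag] v by blast
  have evn: "ev z \<noteq> Some n" for z using n(2) by (auto intro: ranI)
  have "dom (\<sigma>(r \<mapsto> v)) = dom (ev(r \<mapsto> n))" using agreeD(1)[OF ag] by simp
  moreover have "a' \<in> PUB F \<and> b' = a' \<or> a' \<in> insert v rs \<and> b' \<in> NEW F"
    if "(\<sigma>(r \<mapsto> v)) z = Some a'" "(ev(r \<mapsto> n)) z = Some b'" for z a' b'
    using that agreeD(2)[OF ag] n(1) by (auto split: if_splits)
  moreover have "(\<sigma>(r \<mapsto> v)) z = (\<sigma>(r \<mapsto> v)) z' \<longleftrightarrow> (ev(r \<mapsto> n)) z = (ev(r \<mapsto> n)) z'"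
    if "z \<in> dom (\<sigma>(r \<mapsto> v))" "z' \<in> dom (\<sigma>(r \<mapsto> v))" for z z'
  proof -
    have *: "z = r \<or> z \<noteq> r \<and> z \<in> dom \<sigma>" "z' = r \<or> z' \<noteq> r \<and> z' \<in> dom \<sigma>" using that by auto
    then show ?thesis using agreeD(3)[OF ag] \<sigma>v evn by (elim disjE conjE) (simp_all, metis+)
  qed
  ultimately show ?thesis unfolding agree_def by blast
qed

lemma agree_unmap:
  assumes ag: "agree rs \<sigma> ev"
  shows "agree rs (\<sigma>(x := None)) (ev(x := None))"
proof -
  have "dom (\<sigma>(x := None)) = dom (ev(x := None))" using agreeD(1)[OF ag] by simp
  moreover have "a' \<in> PUB F \<and> b' = a' \<or> a' \<in> rs \<and> b' \<in> NEW F"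
    if "(\<sigma>(x := None)) z = Some a'" "(ev(x := None)) z = Some b'" for z a' b'
    using that agreeD(2)[OF ag] by (auto split: if_splits)
  moreover have "(\<sigma>(x := None)) z = (\<sigma>(x := None)) z' \<longleftrightarrow> (ev(x := None)) z = (ev(x := None)) z'"
    if "z \<in> dom (\<sigma>(x := None))" "z' \<in> dom (\<sigma>(x := None))" for z z'
    using that agreeD(3)[OF ag, of z z'] by auto
  ultimately show ?thesis unfolding agree_def by blast
qed

text \<open>The bound on the sum over all values makes the value of a name unique and its place hold
  at most one token; the sums for \<open>NeqStar\<close> and \<open>Neq\<close> then determine these
  places as complements and give injectivity on \<open>RESTR\<close>.\<close>

lemma subst_marking_valuation:
  assumes M: "subst_marking F M"
  obtains ev where "valuation ev" "\<And>p. M p = val_marking ev p"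
proof -
  have out: "M p = 0" if "p \<notin> subst_places F" for p using M that by (simp add: subst_marking_def)
  have fin: "finite (vals F)" using finite_PUB finite_NEW by blast
  have sum1: "(\<Sum>a \<in> vals F. M (Eq x a)) \<le> 1" if "x \<in> vars" for x
    using M that by (simp add: subst_marking_def)
  have star: "M (NeqStar n) + (\<Sum>r \<in> RESTR F. M (Eq r n)) = 1" if "n \<in> NEW F" for n
    using M that by (simp add: subst_marking_def)
  have neq: "M (Eq x n) + M (Neq x n) = 1" if "x \<in> INP F \<union> FRM F" "n \<in> NEW F" for x n
    using M that unfolding subst_marking_def by blast
  have dom: "x \<in> vars" "a \<in> vals F" "x \<in> RESTR F \<Longrightarrow> a \<in> NEW F" if "M (Eq x a) > 0" for x a
  proof -
    have "Eq x a \<in> subst_places F" using out[of "Eq x a"] that by auto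
    then show "x \<in> vars" "a \<in> vals F" "x \<in> RESTR F \<Longrightarrow> a \<in> NEW F"
      using RESTR_disjoint by (auto simp: subst_places_def)
  qed
  have le1: "M (Eq x a) \<le> 1" for x a
  proof (cases "M (Eq x a) > 0")
    case True
    have "M (Eq x a) \<le> (\<Sum>a \<in> vals F. M (Eq x a))"
      using dom(2)[OF True] fin by (intro member_le_sum) auto
    then show ?thesis using sum1[OF dom(1)[OF True]] by simp
  qed simp
  have uniq: "a = b" if "M (Eq x a) > 0" "M (Eq x b) > 0" for x a b
  proof (rule ccontr)
    assume "a \<noteq> b"
    then have "M (Eq x a) + M (Eq x b) = (\<Sum>a \<in> {a, b}. M (Eq x a))" by simp
    also have "\<dots> \<le> (\<Sum>a \<in> vals F. M (Eq x a))"
      using fin dom(2)[OF that(1)] dom(2)[OF that(2)] by (intro sum_mono2) auto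
    finally show False using that sum1[OF dom(1)[OF that(1)]] by simp
  qed
  define ev where "ev x = (if \<exists>a. M (Eq x a) > 0 then Some (SOME a. M (Eq x a) > 0) else None)" for x
  have ev: "ev x = Some a \<longleftrightarrow> M (Eq x a) > 0" for x a
    unfolding ev_def using uniq someI_ex[of "\<lambda>a. M (Eq x a) > 0"] by auto
  have Eq: "M (Eq x a) = of_bool (ev x = Some a)" for x a
    using ev[of x a] le1[of x a] by (cases "M (Eq x a) > 0") auto
  have v: "valuation ev"
    unfolding valuation_def
  proof (intro conjI ballI allI impI)
    show "dom ev \<subseteq> vars" using ev dom(1) by blast
    show "ran ev \<subseteq> vals F" using ev dom(2) by (auto simp: ran_def)
    show "a \<in> NEW F" if "r \<in> RESTR F" "ev r = Some a" for r a using ev dom(3) that by blast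
    show "inj_on ev (dom ev \<inter> RESTR F)"
    proof (rule inj_onI, rule ccontr)
      fix r r' assume r: "r \<in> dom ev \<inter> RESTR F" "r' \<in> dom ev \<inter> RESTR F" "ev r = ev r'" "r \<noteq> r'"
      then obtain n where n: "ev r = Some n" by blast
      then have nN: "n \<in> NEW F" using ev dom(3) r(1) by blast
      have "M (Eq r n) + M (Eq r' n) = (\<Sum>r \<in> {r, r'}. M (Eq r n))" using r(4) by simp
      also have "\<dots> \<le> (\<Sum>r \<in> RESTR F. M (Eq r n))"
        using finite_vars r(1,2) by (intro sum_mono2) auto
      finally show False using star[OF nN] Eq n r(3) by simp
    qed
  qed
  have "M p = val_marking ev p" for p
  proof (cases p)
    case (Eq x a)
    then show ?thesis using \<open>\<And>x a. M (Eq x a) = of_bool (ev x = Some a)\<close> by simp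
  next
    case (Neq x n)
    show ?thesis
    proof (cases "x \<in> INP F \<union> FRM F \<and> n \<in> NEW F")
      case True
      then have "M (Eq x n) + M (Neq x n) = 1" using neq by blast
      then show ?thesis using Neq True Eq[of x n] by auto
    next
      case False
      then have "p \<notin> subst_places F" using Neq by (auto simp: subst_places_def)
      then show ?thesis using out Neq False by auto
    qed
  next
    case (NeqStar n)
    show ?thesis
    proof (cases "n \<in> NEW F")
      case True
      define s where "s = (\<Sum>r \<in> RESTR F. M (Eq r n))"
      have "s = 0 \<longleftrightarrow> (\<forall>r \<in> RESTR F. M (Eq r n) = 0)"
        unfolding s_def using finite_vars(3) by (rule sum_eq_0_iff)
      then have "s = 0 \<longleftrightarrow> (\<forall>r \<in> RESTR F. ev r \<noteq> Some n)" using Eq by simp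
      moreover have "M (NeqStar n) + s = 1" using star[OF True] by (simp add: s_def)
      ultimately have "M (NeqStar n) = of_bool (\<forall>r \<in> RESTR F. ev r \<noteq> Some n)"
        by (cases "s = 0") auto
      then show ?thesis using NeqStar True by simp
    next
      case False
      then have "p \<notin> subst_places F" using NeqStar by (auto simp: subst_places_def)
      then show ?thesis using out NeqStar False by simp
    qed
  next
    case (Ctrl i q)
    then have "p \<notin> subst_places F" by (auto simp: subst_places_def)
    then show ?thesis using out Ctrl by simp
  qed
  with v that show thesis by blast
qed

lemma val_marking_places:
  assumes "valuation ev" "val_marking ev p > 0"
  shows "p \<in> subst_places F"
proof (cases p)
  case (Eq x a)
  then have e: "ev x = Some a" using assms(2) by (simp split: if_splits)
  have "x \<in> vars" "a \<in> vals F" "x \<in> RESTR F \<Longrightarrow> a \<in> NEW F"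
    using valuationD(1,2)[OF assms(1) e] valuationD(3)[OF assms(1) _ e] by blast+
  then show ?thesis using Eq by (auto simp: subst_places_def)
qed (use assms in \<open>auto simp: subst_places_def split: if_splits\<close>)

lemma subst_marking_val:
  assumes v: "valuation ev"
  shows "subst_marking F (val_marking ev)"
  unfolding subst_marking_def
proof (intro conjI allI ballI impI)
  show "val_marking ev p = 0" if "p \<notin> subst_places F" for p
    using val_marking_places[OF v] that by blast
next
  fix n assume n: "n \<in> NEW F"
  show "val_marking ev (NeqStar n) + (\<Sum>r \<in> RESTR F. val_marking ev (Eq r n)) = 1"
  proof (cases "\<exists>r \<in> RESTR F. ev r = Some n")
    case True
    then obtain r where r: "r \<in> RESTR F" "ev r = Some n" by blast
    have "ev r' = Some n \<longleftrightarrow> r' = r" if "r' \<in> RESTR F" for r'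
      using valuationD(4)[OF v] r that by blast
    then have "(\<Sum>r' \<in> RESTR F. val_marking ev (Eq r' n)) = (\<Sum>r' \<in> RESTR F. if r' = r then 1 else 0)"
      by (intro sum.cong) auto
    also have "\<dots> = 1" using r(1) finite_vars by simp
    finally show ?thesis using r by auto
  next
    case False
    then show ?thesis using n by auto
  qed
next
  fix x assume "x \<in> vars"
  have fin: "finite (vals F)" using finite_PUB finite_NEW by blast
  have "(\<Sum>a \<in> vals F. val_marking ev (Eq x a)) = card {a \<in> vals F. ev x = Some a}"
    using fin by (simp add: of_bool_def sum.If_cases Int_def)
  also have "\<dots> \<le> card {the (ev x)}" by (intro card_mono) auto
  finally show "(\<Sum>a \<in> vals F. val_marking ev (Eq x a)) \<le> 1" by simp
next
  fix x n assume "x \<in> INP F \<union> FRM F" "n \<in> NEW F"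
  then show "val_marking ev (Eq x n) + val_marking ev (Neq x n) = 1" by auto
qed

text \<open>\<open>corresponds\<close> compares only pairs of names with restricted values. The
  other pairs follow since public entries coincide in both maps, and mixed pairs are unequal in
  both: \<open>rs\<close> and \<open>NEW F\<close> are each disjoint from
  \<open>PUB F\<close>.\<close>

lemma corresponds_agree:
  assumes c: "corresponds F rs \<sigma> (val_marking ev)" and v: "valuation ev"
  shows "agree rs \<sigma> ev"
proof -
  have disj: "rs \<inter> PUB F = {}" and none: "\<And>x. x \<notin> dom \<sigma> \<Longrightarrow> ev x = None"
    and pub: "\<And>x a. \<sigma> x = Some a \<Longrightarrow> a \<in> PUB F \<Longrightarrow> ev x = Some a"
    and new: "\<And>x a. \<sigma> x = Some a \<Longrightarrow> a \<in> rs \<Longrightarrow> \<exists>n \<in> NEW F. ev x = Some n"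
    and same: "\<And>x y a b. \<sigma> x = Some a \<Longrightarrow> \<sigma> y = Some b \<Longrightarrow> a \<in> rs \<Longrightarrow> b \<in> rs \<Longrightarrow>
       a = b \<longleftrightarrow> (\<forall>n \<in> NEW F. ev x = Some n \<longleftrightarrow> ev y = Some n)"
    and dom: "dom \<sigma> \<subseteq> vars"
    and r1: "\<forall>x \<in> dom \<sigma> \<inter> (INP F \<union> FRM F). the (\<sigma> x) \<in> PUB F \<union> rs"
    and r2: "\<forall>x \<in> dom \<sigma> \<inter> RESTR F. the (\<sigma> x) \<in> rs"
    using c unfolding corresponds_def val_marking.simps
    by (auto simp: of_bool_def split: if_splits)
  have ran: "a \<in> PUB F \<union> rs" if "\<sigma> x = Some a" for x a
  proof -
    have "x \<in> dom \<sigma>" using that by blast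
    then have "x \<in> dom \<sigma> \<inter> (INP F \<union> FRM F) \<or> x \<in> dom \<sigma> \<inter> RESTR F" using dom by blast
    then have "the (\<sigma> x) \<in> PUB F \<union> rs" using r1 r2 by blast
    then show ?thesis using that by simp
  qed
  have 1: "dom \<sigma> = dom ev"
  proof
    show "dom ev \<subseteq> dom \<sigma>" using none by force
    show "dom \<sigma> \<subseteq> dom ev"
    proof
      fix x assume "x \<in> dom \<sigma>"
      then obtain a where "\<sigma> x = Some a" by blast
      then show "x \<in> dom ev" using ran pub new by blast
    qed
  qed
  have 2: "a \<in> PUB F \<and> b = a \<or> a \<in> rs \<and> b \<in> NEW F" if "\<sigma> x = Some a" "ev x = Some b" for x a b
    using ran[OF that(1)] pub[OF that(1)] new[OF that(1)] that(2) by auto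
  have 3: "\<sigma> x = \<sigma> y \<longleftrightarrow> ev x = ev y" if xy: "x \<in> dom \<sigma>" "y \<in> dom \<sigma>" for x y
  proof -
    obtain a b where ab: "\<sigma> x = Some a" "\<sigma> y = Some b" using xy by blast
    obtain m n where mn: "ev x = Some m" "ev y = Some n" using xy 1 by blast
    show ?thesis
      using 2[OF ab(1) mn(1)] 2[OF ab(2) mn(2)]
    proof (elim disjE conjE)
      assume "a \<in> rs" "m \<in> NEW F" "b \<in> rs" "n \<in> NEW F"
      then show ?thesis using same[OF ab] ab mn by auto
    qed (use ab mn NEW_PUB disj in auto)
  qed
  show ?thesis unfolding agree_def using 1 2 3 by blast
qed

lemma agree_corresponds:
  assumes ag: "agree rs \<sigma> ev" and v: "valuation ev" and disj: "rs \<inter> PUB F = {}"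
  shows "corresponds F rs \<sigma> (val_marking ev)"
proof -
  have dom: "dom \<sigma> = dom ev" using agreeD(1)[OF ag] .
  have ex: "\<exists>b. ev x = Some b \<and> (a \<in> PUB F \<and> b = a \<or> a \<in> rs \<and> b \<in> NEW F)" if "\<sigma> x = Some a" for x a
    using agreeD(2)[OF ag that] dom that by (metis domD domI)
  have restr: "a \<in> rs" if "x \<in> RESTR F" "\<sigma> x = Some a" for x a
    using ex[OF that(2)] valuationD(3)[OF v that(1)] NEW_PUB by blast
  have inj: "inj_on \<sigma> (dom \<sigma> \<inter> RESTR F)"
  proof (rule inj_onI)
    fix x y assume xy: "x \<in> dom \<sigma> \<inter> RESTR F" "y \<in> dom \<sigma> \<inter> RESTR F" "\<sigma> x = \<sigma> y"
    then have "ev x = ev y" using agreeD(3)[OF ag] by blast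
    then show "x = y" using valuationD(4)[OF v, of x y] xy dom by auto
  qed
  have same: "(a = b) = (\<forall>n \<in> NEW F. val_marking ev (Eq x n) = val_marking ev (Eq y n))"
    if ab: "\<sigma> x = Some a" "\<sigma> y = Some b" "a \<in> rs" "b \<in> rs" for x y a b
  proof -
    obtain m where m: "ev x = Some m" "m \<in> NEW F" using ex[OF ab(1)] disj ab(3) by blast
    obtain n where n: "ev y = Some n" "n \<in> NEW F" using ex[OF ab(2)] disj ab(4) by blast
    have "a = b \<longleftrightarrow> m = n" using agreeD(3)[OF ag, of x y] ab m n by auto
    then show ?thesis using m n by auto
  qed
  have "dom \<sigma> \<subseteq> vars" using dom v by (simp add: valuation_def)
  moreover have "\<forall>x \<in> dom \<sigma> \<inter> (INP F \<union> FRM F). the (\<sigma> x) \<in> PUB F \<union> rs"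
  proof
    fix x assume "x \<in> dom \<sigma> \<inter> (INP F \<union> FRM F)"
    then obtain a where "\<sigma> x = Some a" by blast
    with agree_ran[OF ag this] show "the (\<sigma> x) \<in> PUB F \<union> rs" by auto
  qed
  moreover have "\<forall>x \<in> dom \<sigma> \<inter> RESTR F. the (\<sigma> x) \<in> rs"
  proof
    fix x assume x: "x \<in> dom \<sigma> \<inter> RESTR F"
    then obtain a where "\<sigma> x = Some a" by blast
    with restr[OF _ this] x show "the (\<sigma> x) \<in> rs" by simp
  qed
  moreover have "\<forall>x a. x \<notin> dom \<sigma> \<longrightarrow> val_marking ev (Eq x a) = 0" using dom by auto
  moreover have "\<forall>x a. \<sigma> x = Some a \<and> a \<in> PUB F \<longrightarrow> val_marking ev (Eq x a) = 1"
  proof (intro allI impI)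
    fix x a assume "\<sigma> x = Some a \<and> a \<in> PUB F"
    then have "ev x = Some a" using ex[of x a] disj by blast
    then show "val_marking ev (Eq x a) = 1" by simp
  qed
  moreover have "\<forall>x a. \<sigma> x = Some a \<and> a \<in> rs \<longrightarrow> (\<exists>n \<in> NEW F. val_marking ev (Eq x n) = 1)"
  proof (intro allI impI)
    fix x a assume "\<sigma> x = Some a \<and> a \<in> rs"
    then obtain n where "ev x = Some n" "n \<in> NEW F" using ex[of x a] disj by blast
    then show "\<exists>n \<in> NEW F. val_marking ev (Eq x n) = 1" by auto
  qed
  ultimately show ?thesis
    unfolding corresponds_def using subst_marking_val[OF v] disj inj same by (intro conjI) simp_all
qed

section \<open>Firing rules\<close>

lemma enabled_net:
  "enabled (net F Ms) M t \<longleftrightarrow> t \<in> net_trans F \<and> (\<forall>p \<in> preset F t. M p > 0)"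
  by (auto simp: enabled_def net_def)

lemma fire_net: "t \<in> net_trans F \<Longrightarrow>
    fire (net F Ms) M t p = M p - of_bool (p \<in> preset F t) + of_bool (p \<in> postset F t)"
  by (simp add: fire_def net_def)

definition fires_to :: "('k, 'n) marking \<Rightarrow> ('k, 'n) ntrans \<Rightarrow> (nat \<Rightarrow> ('k, 'n) aug) \<Rightarrow> ('n \<rightharpoonup> 'n) \<Rightarrow>
    (nat \<Rightarrow> ('k, 'n) aug) \<Rightarrow> ('n \<rightharpoonup> 'n) \<Rightarrow> bool" where
  "fires_to Ms t c ev c' ev' \<longleftrightarrow> enabled (net F Ms) (state_marking c ev) t \<and>
     fire (net F Ms) (state_marking c ev) t = state_marking c' ev'"

lemma preset_cmds: "preset F t = ctrl_pre t \<union> cmds_pre (commands t)"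
  by (simp add: preset_def cmds_pre_def)

lemma postset_cmds: "postset F t = ctrl_post t \<union> cmds_post (commands t)"
  by (simp add: postset_def cmds_post_def)

lemma cmds_pre_not_ctrl: "p \<in> cmds_pre C \<Longrightarrow> \<not> is_ctrl p"
  unfolding cmds_pre_def using cmd_pre_not_ctrl by blast

lemma cmds_post_not_ctrl: "p \<in> cmds_post C \<Longrightarrow> \<not> is_ctrl p"
  unfolding cmds_post_def using cmd_post_not_ctrl by blast

lemma ctrl_pre_ctrl: "p \<in> ctrl_pre t \<Longrightarrow> is_ctrl p" "p \<in> ctrl_post t \<Longrightarrow> is_ctrl p"
  by (cases t; auto)+

text \<open>Control places and substitution places are disjoint, so the effect of firing may be
  computed separately on each of them.\<close>

lemma fires_toI:
  assumes v: "valuation ev" and pl: "\<And>i. i < nthreads F \<Longrightarrow> c i \<in> cf_places F i"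
    and t: "t \<in> composed_trans F" and pre: "\<And>p. p \<in> ctrl_pre t \<Longrightarrow> state_marking c ev p > 0"
    and eff: "cmd_effect (commands t) ev ev'"
    and ctrl: "\<And>i q. state_marking c' ev' (Ctrl i q) = state_marking c ev (Ctrl i q)
        - of_bool (Ctrl i q \<in> ctrl_pre t) + of_bool (Ctrl i q \<in> ctrl_post t)"
  shows "fires_to Ms t c ev c' ev'"
proof -
  have marked: "state_marking c ev p > 0" if "p \<in> preset F t" for p
  proof (cases "p \<in> ctrl_pre t")
    case False
    then have "p \<in> cmds_pre (commands t)" using that by (simp add: preset_cmds)
    then show ?thesis
      using eff cmds_pre_not_ctrl unfolding cmd_effect_def by (simp add: state_marking_val)
  qed (rule pre)
  \<comment> \<open>Marked places exist in the net, so a transition whose preset is marked is not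
    among those left out of \<open>net_trans\<close>.\<close>
  have "p \<in> net_places F" if "state_marking c ev p > 0" for p
  proof (cases "is_ctrl p")
    case True
    then obtain i q where "p = Ctrl i q" by (cases p) auto
    then have "i < nthreads F" "c i = q" "p = Ctrl i (c i)" using that by (auto split: if_splits)
    then show ?thesis using pl[of i] unfolding net_places_def by blast
  next
    case False
    then show ?thesis using that val_marking_places[OF v, of p]
      by (simp add: state_marking_val net_places_def)
  qed
  then have t: "t \<in> net_trans F" using marked t unfolding net_trans_def by blast
  have "fire (net F Ms) (state_marking c ev) t p = state_marking c' ev' p" for p
  proof (cases "is_ctrl p")
    case True
    then obtain i q where p: "p = Ctrl i q" by (cases p) auto
    have "p \<in> preset F t \<longleftrightarrow> p \<in> ctrl_pre t" "p \<in> postset F t \<longleftrightarrow> p \<in> ctrl_post t"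
      using True cmds_pre_not_ctrl cmds_post_not_ctrl by (auto simp: preset_cmds postset_cmds)
    then show ?thesis unfolding fire_net[OF t] using ctrl[of i q] p by simp
  next
    case False
    then have "p \<in> preset F t \<longleftrightarrow> p \<in> cmds_pre (commands t)"
      "p \<in> postset F t \<longleftrightarrow> p \<in> cmds_post (commands t)"
      using ctrl_pre_ctrl by (auto simp: preset_cmds postset_cmds)
    then show ?thesis unfolding fire_net[OF t]
      using eff False unfolding cmd_effect_def by (simp add: state_marking_val)
  qed
  then show ?thesis unfolding fires_to_def enabled_net using t marked by blast
qed

lemma fires_to_Single:
  assumes v: "valuation ev" and pl: "\<And>i. i < nthreads F \<Longrightarrow> c i \<in> cf_places F i"
    and i: "i < nthreads F" and u: "u \<in> cf_trans F" "lab u = LTau" "src u = c i"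
    and eff: "cmd_effect (cmds u) ev ev'"
  shows "fires_to Ms (Single i u) c ev (c(i := tgt u)) ev'"
proof (rule fires_toI[OF v pl])
  show "Single i u \<in> composed_trans F"
    using i u pl[OF i] by (auto simp: composed_trans_def cf_net_trans_def)
qed (use i u eff in auto)

lemma fires_to_Sync:
  assumes v: "valuation ev" and pl: "\<And>i. i < nthreads F \<Longrightarrow> c i \<in> cf_places F i"
    and ij: "i < nthreads F" "j < nthreads F" "i \<noteq> j"
    and t: "t \<in> cf_trans F" "lab t = LSend a b" "src t = c i"
    and u: "u \<in> cf_trans F" "lab u = LRec a b" "src u = c j"
    and eff: "cmd_effect (cmds t \<union> cmds u) ev ev'"
  shows "fires_to Ms (Sync i t j u) c ev (c(i := tgt t, j := tgt u)) ev'"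
proof (rule fires_toI[OF v pl])
  show "Sync i t j u \<in> composed_trans F"
    using ij t u pl[OF ij(1)] pl[OF ij(2)] by (auto simp: composed_trans_def cf_net_trans_def)
qed (use ij t u eff in auto)

text \<open>The domain is exactly the union of the live names: a name about to be tested has a value
  because it is live, and a name about to be bound has none because it is not yet live.\<close>

definition state_inv ::
  "'n list \<Rightarrow> ('n \<rightharpoonup> 'n) \<Rightarrow> (nat \<Rightarrow> ('k, 'n) aug) \<Rightarrow> ('n \<rightharpoonup> 'n) \<Rightarrow> bool" where
  "state_inv rs \<sigma> c ev \<longleftrightarrow> distinct rs \<and> set rs \<inter> PUB F = {} \<and>
     (\<forall>i < nthreads F. place_ok i (c i)) \<and> (\<forall>i < nthreads F. c i \<in> cf_places F i) \<and>
     valuation ev \<and> agree (set rs) \<sigma> ev \<and> dom \<sigma> = (\<Union>i < nthreads F. live (c i))"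

lemma state_invD:
  assumes "state_inv rs \<sigma> c ev"
  shows "distinct rs" "set rs \<inter> PUB F = {}" "i < nthreads F \<Longrightarrow> place_ok i (c i)"
    "i < nthreads F \<Longrightarrow> c i \<in> cf_places F i" "valuation ev" "agree (set rs) \<sigma> ev"
    "dom \<sigma> = (\<Union>i < nthreads F. live (c i))" "dom \<sigma> = dom ev"
proof -
  show ag: "agree (set rs) \<sigma> ev" using assms unfolding state_inv_def by simp
  show "dom \<sigma> = dom ev" by (rule agreeD(1)[OF ag])
qed (use assms in \<open>simp_all add: state_inv_def\<close>)

section \<open>The process of a state and local changes to it\<close>

definition threads :: "('n \<rightharpoonup> 'n) \<Rightarrow> (nat \<Rightarrow> ('k, 'n) aug) \<Rightarrow> ('k, 'n) proc list" where
  "threads \<sigma> c = map (\<lambda>i. msubst \<sigma> (residual (fst (c i)))) [0..<nthreads F]"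

definition state_proc :: "'n list \<Rightarrow> ('n \<rightharpoonup> 'n) \<Rightarrow> (nat \<Rightarrow> ('k, 'n) aug) \<Rightarrow> ('k, 'n) proc" where
  "state_proc rs \<sigma> c = res_list rs (par_list (threads \<sigma> c))"

lemma length_threads [simp]: "length (threads \<sigma> c) = nthreads F"
  by (simp add: threads_def)

lemma nth_threads: "i < nthreads F \<Longrightarrow> threads \<sigma> c ! i = msubst \<sigma> (residual (fst (c i)))"
  by (simp add: threads_def)

lemma live_disjoint:
  assumes "state_inv rs \<sigma> c ev" "i < nthreads F" "j < nthreads F" "i \<noteq> j"
  shows "live (c i) \<inter> live (c j) = {}"
  using live_thread_vars[OF assms(2) state_invD(3)[OF assms(1,2)]]
    live_thread_vars[OF assms(3) state_invD(3)[OF assms(1,3)]] thread_vars_disjoint[OF assms(2-4)]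
  by blast

lemma live_dom: "state_inv rs \<sigma> c ev \<Longrightarrow> i < nthreads F \<Longrightarrow> live (c i) \<subseteq> dom \<sigma>"
  using state_invD(7) by blast

text \<open>A name belonging to thread \<open>i\<close> cannot be live in any other thread, so it
  suffices to look at the place of thread \<open>i\<close>.\<close>

lemma unmapped:
  assumes inv: "state_inv rs \<sigma> c ev" and i: "i < nthreads F" and x: "x \<in> thread_vars i" "x \<notin> live (c i)"
  shows "\<sigma> x = None" "ev x = None"
proof -
  have "x \<notin> live (c j)" if j: "j < nthreads F" for j
  proof (cases "j = i")
    case False
    then show ?thesis
      using live_thread_vars[OF j state_invD(3)[OF inv j]] thread_vars_disjoint[OF j i] x(1) by blast
  qed (use x in simp)
  then have "x \<notin> dom \<sigma>" unfolding state_invD(7)[OF inv] by blast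
  then show "\<sigma> x = None" "ev x = None" using state_invD(8)[OF inv] by blast+
qed

lemma mapped:
  assumes inv: "state_inv rs \<sigma> c ev" and i: "i < nthreads F" and x: "x \<in> live (c i)"
  obtains a b where "\<sigma> x = Some a" "ev x = Some b"
proof -
  have "x \<in> dom \<sigma>" "x \<in> dom ev" using live_dom[OF inv i] x state_invD(8)[OF inv] by blast+
  then show thesis using that by blast
qed

lemma state_inv_upd:
  assumes inv: "state_inv rs \<sigma> c ev" and i: "i < nthreads F"
    and q: "place_ok i q" "q \<in> cf_places F i"
    and rs: "distinct rs'" "set rs' \<inter> PUB F = {}"
    and v: "valuation ev'" and ag: "agree (set rs') \<sigma>' ev'" and dom: "dom \<sigma>' = (dom \<sigma> - live (c i)) \<union> live q"
  shows "state_inv rs' \<sigma>' (c(i := q)) ev'"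
proof -
  \<comment> \<open>Live names of different threads are disjoint, so removing those of thread
    \<open>i\<close> leaves exactly those of the others.\<close>
  have "dom \<sigma> - live (c i) = (\<Union>j \<in> {..<nthreads F} - {i}. live (c j))"
    unfolding state_invD(7)[OF inv] using live_disjoint[OF inv i] by blast
  then have "dom \<sigma>' = (\<Union>j < nthreads F. live ((c(i := q)) j))"
    unfolding dom using i by (auto split: if_splits)
  moreover have "\<forall>j < nthreads F. place_ok j ((c(i := q)) j)" using state_invD(3)[OF inv] q by simp
  moreover have "\<forall>j < nthreads F. (c(i := q)) j \<in> cf_places F j" using state_invD(4)[OF inv] q by simp
  ultimately show ?thesis unfolding state_inv_def using rs v ag by (intro conjI)
qed

lemma fn_residual_live: "fn (residual (fst q)) \<subseteq> live q"
  by (cases q) auto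

lemma threads_upd:
  assumes i: "i < nthreads F" and eq: "\<And>j x. j < nthreads F \<Longrightarrow> j \<noteq> i \<Longrightarrow> x \<in> live (c j) \<Longrightarrow> \<sigma>' x = \<sigma> x"
  shows "threads \<sigma>' (c(i := q)) = (threads \<sigma> c)[i := msubst \<sigma>' (residual (fst q))]"
proof (rule nth_equalityI)
  fix j assume "j < length (threads \<sigma>' (c(i := q)))"
  then have j: "j < nthreads F" by simp
  have "msubst \<sigma>' (residual (fst (c j))) = msubst \<sigma> (residual (fst (c j)))" if "j \<noteq> i"
  proof (rule subst_cong)
    fix x assume "x \<in> fn (residual (fst (c j)))"
    then have "x \<in> live (c j)" using fn_residual_live by blast
    then show "app_map \<sigma>' x = app_map \<sigma> x" using eq[OF j that] by (simp add: app_map_def)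
  qed
  then show "threads \<sigma>' (c(i := q)) ! j = (threads \<sigma> c)[i := msubst \<sigma>' (residual (fst q))] ! j"
    using j i by (cases "j = i") (simp_all add: nth_threads)
qed simp

lemma cf_places_step:
  assumes "u \<in> cf_trans F" "src u \<in> cf_places F i"
  shows "tgt u \<in> cf_places F i"
proof -
  have "(src u, tgt u) \<in> cf_step F" using assms(1) by (auto simp: cf_step_def)
  then show ?thesis using assms(2) unfolding cf_places_def by auto
qed

lemma fn_thread:
  assumes inv: "state_inv rs \<sigma> c ev" and i: "i < nthreads F" and X: "X \<subseteq> live (c i)"
  shows "app_map \<sigma> ` X \<subseteq> set rs \<union> PUB F"
proof
  fix y assume "y \<in> app_map \<sigma> ` X"
  then obtain x where x: "x \<in> X" "y = app_map \<sigma> x" by blast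
  obtain a b where "\<sigma> x = Some a" "ev x = Some b" using mapped[OF inv i] x X by blast
  then show "y \<in> set rs \<union> PUB F"
    using agree_ran[OF state_invD(6)[OF inv]] x by (simp add: app_map_def)
qed

section \<open>Effect of each kind of transition on a state\<close>

lemma app_map_upd: "app_map (\<sigma>(x \<mapsto> a)) = (app_map \<sigma>)(x := a)"
  by (auto simp: app_map_def)

text \<open>\<open>n\<close> is the net value and \<open>v\<close> the process name, each fresh on
  its own side. As \<open>v\<close> occurs in no other thread, the restriction made explicit by the
  transition can be extruded over them to the front.\<close>

lemma nu_rule:
  fixes u :: "('k, 'n) cftrans" and r n l and S :: "('k, 'n) proc"
  defines "u \<equiv> \<lparr>src = (Thr (Res r S), l), rl = RNu, lab = LTau, cmds = {Map r n}, tgt = (Thr S, l)\<rparr>"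
  assumes inv: "state_inv rs \<sigma> c ev" and i: "i < nthreads F" and ci: "c i = (Thr (Res r S), l)"
    and n: "n \<in> NEW F" "n \<notin> ran ev" and v: "v \<notin> set rs \<union> PUB F"
  shows "fires_to Ms (Single i u) c ev (c(i := (Thr S, l))) (ev(r \<mapsto> n))"
    and "state_inv (v # rs) (\<sigma>(r \<mapsto> v)) (c(i := (Thr S, l))) (ev(r \<mapsto> n))"
    and "scong (state_proc rs \<sigma> c) (state_proc (v # rs) (\<sigma>(r \<mapsto> v)) (c(i := (Thr S, l))))"
proof -
  have u: "u \<in> cf_trans F" unfolding u_def by (rule cf_nu[OF n(1)])
  have us: "src u = c i" "tgt u = (Thr S, l)" "lab u = LTau" "cmds u = {Map r n}"
    by (simp_all add: u_def ci)
  obtain K where K: "K \<in> thread_idents F i" "scoped K (Res r S) l"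
    using state_invD(3)[OF inv i] ci by auto
  have Kd: "K \<in> dom (eqs F)" using thread_idents_dom[OF i K(1)] .
  note sc = scoped_Res[OF K(2)]
  have rR: "r \<in> RESTR F" using res_binders_RESTR[OF Kd] sc(4) by blast
  have "r \<in> thread_vars i" using K(1) sc(4) by (auto simp: thread_vars_def eqn_binders_def)
  then have r: "\<sigma> r = None" "ev r = None"
    using unmapped[OF inv i] sc(3) ci by auto
  have ok: "place_ok i (tgt u)" by (rule place_ok_step[OF i u]) (use us state_invD(3)[OF inv i] in simp)
  have cp: "tgt u \<in> cf_places F i" by (rule cf_places_step[OF u]) (use us state_invD(4)[OF inv i] in simp)
  show "fires_to Ms (Single i u) c ev (c(i := (Thr S, l))) (ev(r \<mapsto> n))"
    using fires_to_Single[OF state_invD(5,4)[OF inv] i u us(3,1)] cmd_effect_new[of r n ev, OF rR n(1) r(2) n(2)] us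
    by metis
  have lv: "live (Thr S, l) = insert r (live (c i))" using ci sc(2) by auto
  show "state_inv (v # rs) (\<sigma>(r \<mapsto> v)) (c(i := (Thr S, l))) (ev(r \<mapsto> n))"
  proof (rule state_inv_upd[OF inv i])
    show "place_ok i (Thr S, l)" "(Thr S, l) \<in> cf_places F i" using ok cp us by simp_all
    show "distinct (v # rs)" "set (v # rs) \<inter> PUB F = {}" using state_invD(1,2)[OF inv] v by auto
    show "valuation (ev(r \<mapsto> n))" using valuation_new[OF state_invD(5)[OF inv] rR n] .
    show "agree (set (v # rs)) (\<sigma>(r \<mapsto> v)) (ev(r \<mapsto> n))"
      using agree_new[OF state_invD(6)[OF inv] v n r] by simp
    show "dom (\<sigma>(r \<mapsto> v)) = dom \<sigma> - live (c i) \<union> live (Thr S, l)"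
      using lv live_dom[OF inv i] by auto
  qed
  let ?As = "threads \<sigma> c" and ?X = "subst ((app_map \<sigma>)(r := v)) S"
  have th: "threads (\<sigma>(r \<mapsto> v)) (c(i := (Thr S, l))) = ?As[i := ?X]"
  proof -
    have "(\<sigma>(r \<mapsto> v)) x = \<sigma> x" if "j < nthreads F" "x \<in> live (c j)" for j x
      using live_dom[OF inv that(1)] that(2) r(1) by auto
    then show ?thesis using threads_upd[OF i, of c "\<sigma>(r \<mapsto> v)" \<sigma> "(Thr S, l)"] by (simp add: app_map_upd)
  qed
  have vfn: "v \<notin> fn (?As ! j)" if j: "j < nthreads F" for j
    using fn_thread[OF inv j fn_residual_live] v nth_threads[OF j] by (auto simp: fn_subst)
  have len: "i < length ?As" using i by simp
  have Asi: "scong (?As ! i) (Res v ?X)"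
  proof -
    have "app_map \<sigma> ` (fn S - {r}) \<subseteq> set rs \<union> PUB F"
      using ci by (intro fn_thread[OF inv i]) auto
    then have "v \<notin> app_map \<sigma> ` (fn S - {r})" using v by blast
    then show ?thesis unfolding nth_threads[OF i] ci fst_conv residual.simps by (rule scong_subst_Res)
  qed
  \<comment> \<open>The other threads: thread \<open>i\<close> is moved beside them so that its
    restriction can be extruded, and is then put back into position.\<close>
  define Bs where "Bs = take i ?As @ drop (Suc i) ?As"
  have m1: "mset ?As = mset (?As ! i # Bs)"
    using id_take_nth_drop[OF len] by (simp add: Bs_def) (metis mset.simps(2) mset_append union_mset_add_mset_right)
  have m2: "mset (?As[i := ?X]) = mset (?X # Bs)"
    using len by (simp add: Bs_def upd_conv_take_nth_drop)
  have vB: "v \<notin> fn (par_list Bs)"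
  proof -
    have "set Bs \<subseteq> set ?As" unfolding Bs_def using set_take_subset set_drop_subset by fastforce
    then show ?thesis unfolding fn_par_list using vfn by (force simp: in_set_conv_nth)
  qed
  have "scong (par_list ?As) (par_list (?As ! i # Bs))" by (rule scong_par_list_mset[OF m1])
  also have "scong \<dots> (Par (?As ! i) (par_list Bs))" by (rule scong_par_list_Cons)
  also have "scong \<dots> (Par (par_list Bs) (Res v ?X))"
    using sc_cong_par[OF Asi sc_refl] sc_par_comm by (rule sc_trans)
  also have "scong \<dots> (Res v (Par (par_list Bs) ?X))" using vB by (rule sc_sym[OF sc_scope])
  also have "scong \<dots> (Res v (par_list (?X # Bs)))"
    by (intro sc_cong_res sc_trans[OF sc_par_comm sc_sym[OF scong_par_list_Cons]])
  also have "scong \<dots> (Res v (par_list (?As[i := ?X])))"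
    by (intro sc_cong_res scong_par_list_mset m2[symmetric])
  finally have "scong (res_list rs (par_list ?As)) (res_list rs (Res v (par_list (?As[i := ?X]))))"
    by (rule scong_res_list_cong)
  also have "scong \<dots> (Res v (res_list rs (par_list (?As[i := ?X]))))"
    by (rule sc_sym[OF scong_Res_res_list])
  finally show "scong (state_proc rs \<sigma> c) (state_proc (v # rs) (\<sigma>(r \<mapsto> v)) (c(i := (Thr S, l))))"
    unfolding state_proc_def th by simp
qed

text \<open>A name that leaves the free names at a prefix is appended to the waiting list, so
  nothing ceases to be live and only the name bound by the prefix is added.\<close>

lemma live_branch:
  assumes i: "i < nthreads F" and ok: "place_ok i (Thr (Choice bs), l)" and mem: "(\<pi>, S) \<in> set bs"
  shows "live (Thr S, l @ dropped bs S) = live (Thr (Choice bs), l) \<union> set (prefix_binders \<pi>)"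
    and "set (prefix_binders \<pi>) \<inter> live (Thr (Choice bs), l) = {}"
    and "set (prefix_binders \<pi>) \<subseteq> INP F \<inter> thread_vars i"
proof -
  obtain K where K: "K \<in> thread_idents F i" "scoped K (Choice bs) l" using ok by auto
  note sc = scoped_Choice[OF K(2) mem]
  have "fn S \<subseteq> fn (Choice bs) \<union> set (prefix_binders \<pi>)"
    using fn_Choice_branch[OF mem] by (cases \<pi>) auto
  then show "live (Thr S, l @ dropped bs S) = live (Thr (Choice bs), l) \<union> set (prefix_binders \<pi>)"
    unfolding live.simps residual.simps set_append set_dropped(1) using sc(2) by blast
  show "set (prefix_binders \<pi>) \<inter> live (Thr (Choice bs), l) = {}" using sc(3) by simp
  show "set (prefix_binders \<pi>) \<subseteq> INP F \<inter> thread_vars i"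
    using sc(4) inp_binders_INP[OF thread_idents_dom[OF i K(1)]] K(1)
    by (auto simp: thread_vars_def eqn_binders_def)
qed

text \<open>Serves both \<tau>-branches and the sending half of a synchronisation, where neither map
  changes.\<close>

lemma branch_upd:
  assumes inv: "state_inv rs \<sigma> c ev" and i: "i < nthreads F" and ci: "c i = (Thr (Choice bs), l)"
    and mem: "(\<pi>, S) \<in> set bs" and np: "prefix_binders \<pi> = []"
    and u: "u \<in> cf_trans F" "src u = c i" "tgt u = (Thr S, l @ dropped bs S)"
  shows "state_inv rs \<sigma> (c(i := (Thr S, l @ dropped bs S))) ev"
    and "threads \<sigma> (c(i := (Thr S, l @ dropped bs S))) = (threads \<sigma> c)[i := msubst \<sigma> S]"
proof -
  have ok: "place_ok i (Thr (Choice bs), l)" using state_invD(3)[OF inv i] ci by simp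
  have "place_ok i (tgt u)" by (rule place_ok_step[OF i u(1)]) (use u state_invD(3)[OF inv i] in simp)
  moreover have "tgt u \<in> cf_places F i" by (rule cf_places_step[OF u(1)]) (use u state_invD(4)[OF inv i] in simp)
  moreover have "dom \<sigma> = dom \<sigma> - live (c i) \<union> live (Thr S, l @ dropped bs S)"
    unfolding live_branch(1)[OF i ok mem] ci[symmetric] np using live_dom[OF inv i] by auto
  ultimately show "state_inv rs \<sigma> (c(i := (Thr S, l @ dropped bs S))) ev"
    unfolding u(3) by (intro state_inv_upd[OF inv i] state_invD[OF inv])
  show "threads \<sigma> (c(i := (Thr S, l @ dropped bs S))) = (threads \<sigma> c)[i := msubst \<sigma> S]"
    using threads_upd[OF i, of c \<sigma> \<sigma> "(Thr S, l @ dropped bs S)"] by simp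
qed

lemma tau_rule:
  fixes u :: "('k, 'n) cftrans" and l bs and S :: "('k, 'n) proc"
  defines "u \<equiv> \<lparr>src = (Thr (Choice bs), l), rl = RTau, lab = LTau, cmds = {}, tgt = (Thr S, l @ dropped bs S)\<rparr>"
  assumes inv: "state_inv rs \<sigma> c ev" and i: "i < nthreads F" and ci: "c i = (Thr (Choice bs), l)"
    and mem: "(Tau, S) \<in> set bs"
  shows "fires_to Ms (Single i u) c ev (c(i := (Thr S, l @ dropped bs S))) ev"
    and "state_inv rs \<sigma> (c(i := (Thr S, l @ dropped bs S))) ev"
    and "threads \<sigma> (c(i := (Thr S, l @ dropped bs S))) = (threads \<sigma> c)[i := msubst \<sigma> S]"
proof -
  have u: "u \<in> cf_trans F" unfolding u_def by (rule cf_tau[OF mem])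
  have us: "src u = c i" "tgt u = (Thr S, l @ dropped bs S)" "lab u = LTau" "cmds u = {}"
    by (simp_all add: u_def ci)
  show "fires_to Ms (Single i u) c ev (c(i := (Thr S, l @ dropped bs S))) ev"
    using fires_to_Single[OF state_invD(5,4)[OF inv] i u us(3,1)] cmd_effect_none us by metis
qed (rule branch_upd[OF inv i ci mem _ cf_tau[OF mem]]; simp add: ci)+

lemma sync_rule:
  fixes t u :: "('k, 'n) cftrans" and c c' and l m bs cs x y x' y' a b i j and S S' :: "('k, 'n) proc"
  defines "t \<equiv> \<lparr>src = (Thr (Choice bs), l), rl = RSnd, lab = LSend a b, cmds = {Test x a, Test y b},
     tgt = (Thr S, l @ dropped bs S)\<rparr>"
    and "u \<equiv> \<lparr>src = (Thr (Choice cs), m), rl = RRec, lab = LRec a b, cmds = {Test x' a, Map y' b},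
     tgt = (Thr S', m @ dropped cs S')\<rparr>"
    and "c' \<equiv> c(i := (Thr S, l @ dropped bs S), j := (Thr S', m @ dropped cs S'))"
  assumes inv: "state_inv rs \<sigma> c ev" and ij: "i < nthreads F" "j < nthreads F" "i \<noteq> j"
    and ci: "c i = (Thr (Choice bs), l)" and cj: "c j = (Thr (Choice cs), m)"
    and mem: "(Out x y, S) \<in> set bs" "(Inp x' y', S') \<in> set cs"
    and ev: "ev x = Some a" "ev x' = Some a" "ev y = Some b" and z: "\<sigma> y = Some z"
  shows "fires_to Ms (Sync i t j u) c ev c' (ev(y' \<mapsto> b))"
    and "state_inv rs (\<sigma>(y' \<mapsto> z)) c' (ev(y' \<mapsto> b))"
    and "threads (\<sigma>(y' \<mapsto> z)) c' = (threads \<sigma> c)[i := msubst \<sigma> S, j := subst ((app_map \<sigma>)(y' := z)) S']"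
proof -
  note v = state_invD(5)[OF inv]
  have ab: "a \<in> vals F" "b \<in> vals F" using valuationD(2)[OF v] ev by blast+
  have t: "t \<in> cf_trans F" unfolding t_def by (rule cf_snd[OF mem(1) ab])
  have u: "u \<in> cf_trans F" unfolding u_def by (rule cf_rec[OF mem(2) ab])
  have okj: "place_ok j (Thr (Choice cs), m)" using state_invD(3)[OF inv ij(2)] cj by simp
  have y': "y' \<in> INP F" "y' \<in> thread_vars j" "y' \<notin> live (c j)"
    using live_branch(2,3)[OF ij(2) okj mem(2)] cj by auto
  have y'n: "\<sigma> y' = None" "ev y' = None" using unmapped[OF inv ij(2) y'(2,3)] .
  have C: "cmds t \<union> cmds u = insert (Map y' b) (case_prod Test ` {(x, a), (y, b), (x', a)})"
    by (auto simp: t_def u_def)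
  have eff: "cmd_effect (cmds t \<union> cmds u) ev (ev(y' \<mapsto> b))"
    by (rule cmd_effect_map[OF C]) (use y' ab y'n ev in auto)
  have ts: "lab t = LSend a b" "src t = c i" "tgt t = (Thr S, l @ dropped bs S)" by (simp_all add: t_def ci)
  have us: "lab u = LRec a b" "src u = c j" "tgt u = (Thr S', m @ dropped cs S')" by (simp_all add: u_def cj)
  show "fires_to Ms (Sync i t j u) c ev c' (ev(y' \<mapsto> b))"
    using fires_to_Sync[OF v state_invD(4)[OF inv] ij t ts(1,2) u us(1,2) eff]
    unfolding ts(3) us(3) c'_def by simp
  \<comment> \<open>The net fires both halves at once, but the invariant is updated in two stages,
    first for the sender with unchanged maps and then for the receiver.\<close>
  define c1 where "c1 = c(i := (Thr S, l @ dropped bs S))"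
  have inv1: "state_inv rs \<sigma> c1 ev" and th1: "threads \<sigma> c1 = (threads \<sigma> c)[i := msubst \<sigma> S]"
    unfolding c1_def using branch_upd[OF inv ij(1) ci mem(1) _ t ts(2,3)] by simp_all
  have c1j: "c1 j = c j" using ij(3) by (simp add: c1_def)
  have oku: "place_ok j (tgt u)" by (rule place_ok_step[OF ij(2) u]) (use us state_invD(3)[OF inv ij(2)] in simp)
  have cpu: "tgt u \<in> cf_places F j" by (rule cf_places_step[OF u]) (use us state_invD(4)[OF inv ij(2)] in simp)
  show "state_inv rs (\<sigma>(y' \<mapsto> z)) c' (ev(y' \<mapsto> b))"
    unfolding c'_def c1_def[symmetric]
  proof (rule state_inv_upd[OF inv1 ij(2)])
    show "place_ok j (Thr S', m @ dropped cs S')" "(Thr S', m @ dropped cs S') \<in> cf_places F j"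
      using oku cpu us by simp_all
    show "distinct rs" "set rs \<inter> PUB F = {}" using state_invD[OF inv] by simp_all
    show "valuation (ev(y' \<mapsto> b))" using y'(1) by (intro valuation_map v ab) simp
    show "agree (set rs) (\<sigma>(y' \<mapsto> z)) (ev(y' \<mapsto> b))"
      using agree_copy[OF state_invD(6)[OF inv] z ev(3) y'n] .
    show "dom (\<sigma>(y' \<mapsto> z)) = dom \<sigma> - live (c1 j) \<union> live (Thr S', m @ dropped cs S')"
      unfolding c1j live_branch(1)[OF ij(2) okj mem(2)] cj[symmetric] using live_dom[OF inv ij(2)] by auto
  qed
  have "(\<sigma>(y' \<mapsto> z)) w = \<sigma> w" if "k < nthreads F" "w \<in> live (c1 k)" for k w
    using live_dom[OF inv1 that(1)] that(2) y'n(1) by auto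
  then have "threads (\<sigma>(y' \<mapsto> z)) c' = (threads \<sigma> c1)[j := msubst (\<sigma>(y' \<mapsto> z)) S']"
    unfolding c'_def c1_def[symmetric]
    using threads_upd[OF ij(2), of c1 "\<sigma>(y' \<mapsto> z)" \<sigma> "(Thr S', m @ dropped cs S')"] by simp
  then show "threads (\<sigma>(y' \<mapsto> z)) c' = (threads \<sigma> c)[i := msubst \<sigma> S, j := subst ((app_map \<sigma>)(y' := z)) S']"
    by (simp add: th1 app_map_upd)
qed

text \<open>The last argument \<open>x\<close> gives way to the formal parameter \<open>f\<close>,
  which takes over its value, so the denoted threads are literally equal. That \<open>f\<close> has
  no value yet uses that no body calls its own identifier: \<open>f\<close> is bound by
  \<open>L\<close> and the names of the caller by \<open>K\<close>.\<close>

lemma call1_rule: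
  fixes u :: "('k, 'n) cftrans" and l cc L xs x a fs
  defines "l' \<equiv> if x \<in> set l then l else l @ [x]" and "f \<equiv> fs ! length xs"
  defines "u \<equiv> \<lparr>src = (cc, l), rl = RCall1, lab = LTau, cmds = {Test x a, Map f a}, tgt = (Pend L xs, l')\<rparr>"
  assumes inv: "state_inv rs \<sigma> c ev" and i: "i < nthreads F" and ci: "c i = (cc, l)"
    and cc: "cc = Thr (Call L (xs @ [x])) \<or> cc = Pend L (xs @ [x])" and fs: "fs = formals F L"
    and x: "ev x = Some a" "\<sigma> x = Some z"
  shows "u \<in> cf_trans F"
    and "fires_to Ms (Single i u) c ev (c(i := (Pend L xs, l'))) (ev(f \<mapsto> a))"
    and "state_inv rs (\<sigma>(f \<mapsto> z)) (c(i := (Pend L xs, l'))) (ev(f \<mapsto> a))"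
    and "threads (\<sigma>(f \<mapsto> z)) (c(i := (Pend L xs, l'))) = threads \<sigma> c"
proof -
  note v = state_invD(5)[OF inv]
  have a: "a \<in> vals F" using valuationD(2)[OF v x(1)] .
  have ok: "place_ok i (cc, l)" using state_invD(3)[OF inv i] ci by simp
  obtain K as where K: "K \<in> thread_idents F i" "(L, as) \<in> calls (body F K)"
    "length (xs @ [x]) \<le> length (formals F L)" "distinct l" "set (xs @ [x]) \<union> set l \<subseteq> binders K"
    "residual cc = Call L ((xs @ [x]) @ drop (length (xs @ [x])) (formals F L))"
    by (rule call_place[OF i ok cc])
  have Kd: "K \<in> dom (eqs F)" using thread_idents_dom[OF i K(1)] .
  have L: "L \<noteq> K" "L \<in> dom (eqs F)" using calls_body[OF Kd K(2)] by blast+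
  have Li: "L \<in> thread_idents F i" using thread_idents_call[OF i K(1,2)] .
  have lenxs: "length xs < length fs" using K(3) fs by simp
  have eqL: "eqs F L = Some (fs, body F L)" using eqs_Some[OF L(2)] fs by simp
  show u: "u \<in> cf_trans F" unfolding u_def f_def l'_def by (rule cf_call1[OF cc eqL lenxs a])
  have us: "src u = c i" "tgt u = (Pend L xs, l')" "lab u = LTau" "cmds u = {Test x a, Map f a}"
    by (simp_all add: u_def ci)
  have drop: "drop (length xs) fs = f # drop (Suc (length xs)) fs"
    unfolding f_def by (rule Cons_nth_drop_Suc[OF lenxs, symmetric])
  have ffs: "f \<in> set fs" unfolding f_def by (rule nth_mem[OF lenxs])
  have fL: "f \<in> binders L" using ffs fs by (simp add: eqn_binders_def)
  have fF: "f \<in> FRM F" using ffs formals_FRM[OF L(2)] fs by blast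
  have fK: "f \<notin> binders K" using binders_disjoint[OF L(2) Kd L(1)] fL by blast
  have "distinct fs" using distinct_eqn_binders[OF L(2)] fs by (simp add: eqn_binders_def)
  then have "distinct (drop (length xs) fs)" by simp
  then have fd: "f \<notin> set (drop (Suc (length xs)) fs)" unfolding drop by simp
  have lc: "live (c i) = set xs \<union> {x} \<union> set (drop (Suc (length xs)) fs) \<union> set l"
    using ci K(6) fs by auto
  have fl: "f \<notin> live (c i)" unfolding lc using fK K(5) fd by auto
  have fn: "\<sigma> f = None" "ev f = None"
    using unmapped[OF inv i _ fl] fL Li by (auto simp: thread_vars_def)
  have "live (Pend L xs, l') = set xs \<union> set (drop (length xs) fs) \<union> set l'" using fs by simp
  also have "\<dots> = insert f (live (c i))" unfolding lc drop l'_def by auto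
  finally have lv: "live (Pend L xs, l') = insert f (live (c i))" .
  have C: "cmds u = insert (Map f a) (case_prod Test ` {(x, a)})" using us(4) by auto
  have eff: "cmd_effect (cmds u) ev (ev(f \<mapsto> a))"
    by (rule cmd_effect_map[OF C]) (use fF a fn x in auto)
  show "fires_to Ms (Single i u) c ev (c(i := (Pend L xs, l'))) (ev(f \<mapsto> a))"
    using fires_to_Single[OF v state_invD(4)[OF inv] i u us(3,1) eff] unfolding us(2) .
  have oku: "place_ok i (tgt u)" by (rule place_ok_step[OF i u]) (use us state_invD(3)[OF inv i] in simp)
  have cpu: "tgt u \<in> cf_places F i" by (rule cf_places_step[OF u]) (use us state_invD(4)[OF inv i] in simp)
  show "state_inv rs (\<sigma>(f \<mapsto> z)) (c(i := (Pend L xs, l'))) (ev(f \<mapsto> a))"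
  proof (rule state_inv_upd[OF inv i])
    show "place_ok i (Pend L xs, l')" "(Pend L xs, l') \<in> cf_places F i" using oku cpu us by simp_all
    show "distinct rs" "set rs \<inter> PUB F = {}" using state_invD[OF inv] by simp_all
    show "valuation (ev(f \<mapsto> a))" using fF by (intro valuation_map v a) simp
    show "agree (set rs) (\<sigma>(f \<mapsto> z)) (ev(f \<mapsto> a))"
      using agree_copy[OF state_invD(6)[OF inv] x(2,1) fn] .
    show "dom (\<sigma>(f \<mapsto> z)) = dom \<sigma> - live (c i) \<union> live (Pend L xs, l')"
      unfolding lv using live_dom[OF inv i] by auto
  qed
  have same: "(\<sigma>(f \<mapsto> z)) w = \<sigma> w" if "k < nthreads F" "w \<in> live (c k)" for k w
    using live_dom[OF inv that(1)] that(2) fn(1) by auto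
  then have "threads (\<sigma>(f \<mapsto> z)) (c(i := (Pend L xs, l')))
      = (threads \<sigma> c)[i := msubst (\<sigma>(f \<mapsto> z)) (residual (Pend L xs))]"
    using threads_upd[OF i, of c "\<sigma>(f \<mapsto> z)" \<sigma> "(Pend L xs, l')"] by simp
  also have "msubst (\<sigma>(f \<mapsto> z)) (residual (Pend L xs)) = threads \<sigma> c ! i"
  proof -
    have "app_map (\<sigma>(f \<mapsto> z)) w = app_map \<sigma> w" if "w \<in> live (c i)" for w
      using same[OF i that] by (simp add: app_map_def)
    then have "map (app_map (\<sigma>(f \<mapsto> z))) xs = map (app_map \<sigma>) xs"
      "map (app_map (\<sigma>(f \<mapsto> z))) (drop (Suc (length xs)) fs) = map (app_map \<sigma>) (drop (Suc (length xs)) fs)"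
      unfolding lc by auto
    moreover have "app_map (\<sigma>(f \<mapsto> z)) f = app_map \<sigma> x" using x(2) by (simp add: app_map_def)
    ultimately show ?thesis
      unfolding nth_threads[OF i] ci fst_conv K(6) residual.simps fs[symmetric] drop by simp
  qed
  finally show "threads (\<sigma>(f \<mapsto> z)) (c(i := (Pend L xs, l'))) = threads \<sigma> c" by (simp only: list_update_id)
qed

text \<open>The unmapped name belongs to the caller, while the residual call mentions only formal
  parameters of the callee; hence the denoted thread does not notice.\<close>

lemma call2_rule:
  fixes u :: "('k, 'n) cftrans" and l cc L x a
  defines "u \<equiv> \<lparr>src = (cc, x # l), rl = RCall2, lab = LTau, cmds = {Unmap x a}, tgt = (Pend L [], l)\<rparr>"
  assumes inv: "state_inv rs \<sigma> c ev" and i: "i < nthreads F" and ci: "c i = (cc, x # l)"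
    and cc: "cc = Thr (Call L []) \<or> cc = Pend L []" and x: "ev x = Some a"
  shows "u \<in> cf_trans F"
    and "fires_to Ms (Single i u) c ev (c(i := (Pend L [], l))) (ev(x := None))"
    and "state_inv rs (\<sigma>(x := None)) (c(i := (Pend L [], l))) (ev(x := None))"
    and "threads (\<sigma>(x := None)) (c(i := (Pend L [], l))) = threads \<sigma> c"
proof -
  note v = state_invD(5)[OF inv]
  have a: "a \<in> vals F" using valuationD(2)[OF v x(1)] .
  have ok: "place_ok i (cc, x # l)" using state_invD(3)[OF inv i] ci by simp
  obtain K as where K: "K \<in> thread_idents F i" "(L, as) \<in> calls (body F K)"
    "distinct (x # l)" "set (x # l) \<subseteq> binders K" "residual cc = Call L (formals F L)"
    by (rule call_place[OF i ok cc]) (rule that; simp)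
  have Kd: "K \<in> dom (eqs F)" using thread_idents_dom[OF i K(1)] .
  have L: "L \<noteq> K" "L \<in> dom (eqs F)" using calls_body[OF Kd K(2)] by blast+
  show u: "u \<in> cf_trans F" unfolding u_def by (rule cf_call2[OF cc L(2) a])
  have us: "src u = c i" "tgt u = (Pend L [], l)" "lab u = LTau" "cmds u = {Unmap x a}"
    by (simp_all add: u_def ci)
  have "x \<in> binders K" using K(4) by simp
  moreover have "set (formals F L) \<subseteq> binders L" by (auto simp: eqn_binders_def)
  ultimately have xf: "x \<notin> set (formals F L)" using binders_disjoint[OF L(2) Kd L(1)] by blast
  have lc: "live (c i) = insert x (live (Pend L [], l))" "x \<notin> live (Pend L [], l)"
    using ci K(3,5) xf by auto
  have eff: "cmd_effect (cmds u) ev (ev(x := None))"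
    unfolding us(4) by (rule cmd_effect_unmap[OF v x])
  show "fires_to Ms (Single i u) c ev (c(i := (Pend L [], l))) (ev(x := None))"
    using fires_to_Single[OF v state_invD(4)[OF inv] i u us(3,1) eff] unfolding us(2) .
  have oku: "place_ok i (tgt u)" by (rule place_ok_step[OF i u]) (use us state_invD(3)[OF inv i] in simp)
  have cpu: "tgt u \<in> cf_places F i" by (rule cf_places_step[OF u]) (use us state_invD(4)[OF inv i] in simp)
  show "state_inv rs (\<sigma>(x := None)) (c(i := (Pend L [], l))) (ev(x := None))"
  proof (rule state_inv_upd[OF inv i])
    show "place_ok i (Pend L [], l)" "(Pend L [], l) \<in> cf_places F i" using oku cpu us by simp_all
    show "distinct rs" "set rs \<inter> PUB F = {}" using state_invD[OF inv] by simp_all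
    show "valuation (ev(x := None))" by (rule valuation_unmap[OF v])
    show "agree (set rs) (\<sigma>(x := None)) (ev(x := None))" by (rule agree_unmap[OF state_invD(6)[OF inv]])
    show "dom (\<sigma>(x := None)) = dom \<sigma> - live (c i) \<union> live (Pend L [], l)"
      using lc live_dom[OF inv i] by auto
  qed
  have same: "(\<sigma>(x := None)) w = \<sigma> w" if "w \<noteq> x" for w using that by simp
  have "x \<notin> live (c j)" if "j < nthreads F" "j \<noteq> i" for j
    using live_disjoint[OF inv i that(1)] that(2) lc(1) by blast
  then have "threads (\<sigma>(x := None)) (c(i := (Pend L [], l)))
      = (threads \<sigma> c)[i := msubst (\<sigma>(x := None)) (residual (Pend L []))]"
    using threads_upd[OF i, of c "\<sigma>(x := None)" \<sigma> "(Pend L [], l)"] same by fastforce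
  also have "msubst (\<sigma>(x := None)) (residual (Pend L [])) = threads \<sigma> c ! i"
    unfolding nth_threads[OF i] ci fst_conv K(5) residual.simps using xf by (auto simp: app_map_def)
  finally show "threads (\<sigma>(x := None)) (c(i := (Pend L [], l))) = threads \<sigma> c" by (simp only: list_update_id)
qed

text \<open>Once the waiting list is empty, exactly the formal parameters of \<open>L\<close> are
  live, and these are the free names of its body. Both maps can therefore stay as they are.\<close>

lemma call3_rule:
  fixes u :: "('k, 'n) cftrans" and cc L
  defines "u \<equiv> \<lparr>src = (cc, []), rl = RCall3, lab = LTau, cmds = {}, tgt = (Thr (body F L), [])\<rparr>"
  assumes inv: "state_inv rs \<sigma> c ev" and i: "i < nthreads F" and ci: "c i = (cc, [])"
    and cc: "cc = Thr (Call L []) \<or> cc = Pend L []"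
  shows "L \<in> dom (eqs F)"
    and "fires_to Ms (Single i u) c ev (c(i := (Thr (body F L), []))) ev"
    and "state_inv rs \<sigma> (c(i := (Thr (body F L), []))) ev"
    and "threads \<sigma> (c(i := (Thr (body F L), []))) = (threads \<sigma> c)[i := msubst \<sigma> (body F L)]"
    and "threads \<sigma> c ! i = Call L (map (app_map \<sigma>) (formals F L))"
proof -
  note v = state_invD(5)[OF inv]
  have ok: "place_ok i (cc, [])" using state_invD(3)[OF inv i] ci by simp
  obtain K as where K: "K \<in> thread_idents F i" "(L, as) \<in> calls (body F K)"
    "residual cc = Call L (formals F L)"
    by (rule call_place[OF i ok cc]) (rule that; simp)
  show L: "L \<in> dom (eqs F)" using calls_body(2)[OF thread_idents_dom[OF i K(1)] K(2)] .
  have u: "u \<in> cf_trans F" unfolding u_def by (rule cf_call3[OF cc eqs_Some[OF L]])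
  have us: "src u = c i" "tgt u = (Thr (body F L), [])" "lab u = LTau" "cmds u = {}"
    by (simp_all add: u_def ci)
  have lc: "live (c i) = live (Thr (body F L), [])" using ci K(3) fn_body[OF L] by simp
  show "fires_to Ms (Single i u) c ev (c(i := (Thr (body F L), []))) ev"
    using fires_to_Single[OF v state_invD(4)[OF inv] i u us(3,1)] cmd_effect_none us by metis
  have oku: "place_ok i (tgt u)" by (rule place_ok_step[OF i u]) (use us state_invD(3)[OF inv i] in simp)
  have cpu: "tgt u \<in> cf_places F i" by (rule cf_places_step[OF u]) (use us state_invD(4)[OF inv i] in simp)
  show "state_inv rs \<sigma> (c(i := (Thr (body F L), []))) ev"
    by (rule state_inv_upd[OF inv i])
       (use oku cpu us state_invD[OF inv] lc live_dom[OF inv i] in auto)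
  show "threads \<sigma> (c(i := (Thr (body F L), []))) = (threads \<sigma> c)[i := msubst \<sigma> (body F L)]"
    using threads_upd[OF i, of c \<sigma> \<sigma> "(Thr (body F L), [])"] by simp
  show "threads \<sigma> c ! i = Call L (map (app_map \<sigma>) (formals F L))"
    unfolding nth_threads[OF i] ci fst_conv K(3) by simp
qed

end

section \<open>Soundness of net steps\<close>

lemma fires_append: "fires N M ts M' \<Longrightarrow> fires N M' ts' M'' \<Longrightarrow> fires N M (ts @ ts') M''"
  by (induction rule: fires.induct) (auto intro: fires.intros)

lemma subst_branch_inv:
  "subst_branch \<theta> b = (Tau, S') \<Longrightarrow> \<exists>S. b = (Tau, S) \<and> S' = subst \<theta> S"
  "subst_branch \<theta> b = (Out x z, S') \<Longrightarrow> \<exists>x0 z0 S. b = (Out x0 z0, S) \<and> x = \<theta> x0 \<and> z = \<theta> z0 \<and> S' = subst \<theta> S"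
  "subst_branch \<theta> b = (Inp x y, S') \<Longrightarrow> \<exists>x0 y0 S. b = (Inp x0 y0, S) \<and> x = \<theta> x0 \<and>
     y = avoid y0 (\<theta> ` (fn S - {y0})) \<and> S' = subst (\<theta>(y0 := y)) S"
  by (cases b; cases "fst b"; auto)+

text \<open>A reaction instantiates the binder as renamed by the substitution, whereas the net
  extends the map at the original binder. The two continuations are congruent.\<close>

lemma scong_comm:
  assumes "j < length As" "y = avoid y0 (\<phi> ` (fn S - {y0}))"
  shows "scong (par_list (As[j := subst (id(y := z)) (subst (\<phi>(y0 := y)) S)]))
    (par_list (As[j := subst (\<phi>(y0 := z)) S]))"
proof -
  have "y \<notin> \<phi> ` (fn S - {y0})" unfolding assms(2) by (rule avoid_fresh) simp
  from scong_subst_upd_comp[OF this, of id z]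
  have "scong (subst (id(y := z)) (subst (\<phi>(y0 := y)) S)) (subst (\<phi>(y0 := z)) S)"
    by (simp only: id_o)
  then have "list_all2 scong (As[j := subst (id(y := z)) (subst (\<phi>(y0 := y)) S)]) (As[j := subst (\<phi>(y0 := z)) S])"
    by (intro list_all2_update_cong list.rel_refl sc_refl)
  then show ?thesis by (rule scong_par_list_cong)
qed

context fcp
begin

lemma react_tau:
  assumes "i < nthreads F" "fst (c i) = Thr (Choice bs)" "(Tau, S) \<in> set bs"
  shows "react (eqs F) (state_proc rs \<sigma> c) (res_list rs (par_list ((threads \<sigma> c)[i := msubst \<sigma> S])))"
proof -
  have "(Tau, msubst \<sigma> S) \<in> set (map (subst_branch (app_map \<sigma>)) bs)" using assms(3) by force
  then have "redex_at (eqs F) (threads \<sigma> c) ((threads \<sigma> c)[i := msubst \<sigma> S])"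
    using assms(1,2) by (intro at_tau) (auto simp: nth_threads)
  then show ?thesis unfolding state_proc_def by (rule redex_imp_react[OF redex_at_imp_redex])
qed

lemma react_sync:
  assumes ij: "i < nthreads F" "j < nthreads F" "i \<noteq> j"
    and c: "fst (c i) = Thr (Choice bs)" "fst (c j) = Thr (Choice cs)"
    and mem: "(Out x y, S) \<in> set bs" "(Inp x' y', S') \<in> set cs"
    and eq: "app_map \<sigma> x = app_map \<sigma> x'" "app_map \<sigma> y = z"
  shows "react (eqs F) (state_proc rs \<sigma> c)
    (res_list rs (par_list ((threads \<sigma> c)[i := msubst \<sigma> S, j := subst ((app_map \<sigma>)(y' := z)) S'])))"
proof -
  let ?u = "avoid y' (app_map \<sigma> ` (fn S' - {y'}))"
  let ?As = "(threads \<sigma> c)[i := msubst \<sigma> S]"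
  have 1: "(Out (app_map \<sigma> x') z, msubst \<sigma> S) \<in> set (map (subst_branch (app_map \<sigma>)) bs)"
    using mem(1) eq by force
  have 2: "(Inp (app_map \<sigma> x') ?u, subst ((app_map \<sigma>)(y' := ?u)) S') \<in> set (map (subst_branch (app_map \<sigma>)) cs)"
    using mem(2) by force
  have "redex_at (eqs F) (threads \<sigma> c) (?As[j := subst (id(?u := z)) (subst ((app_map \<sigma>)(y' := ?u)) S')])"
    using ij c by (intro at_comm[OF _ _ ij(3) _ _ 1 2]) (auto simp: nth_threads)
  from redex_imp_react[OF redex_at_imp_redex[OF this], of rs]
  have "react (eqs F) (state_proc rs \<sigma> c)
    (res_list rs (par_list (?As[j := subst (id(?u := z)) (subst ((app_map \<sigma>)(y' := ?u)) S')])))"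
    unfolding state_proc_def .
  moreover have "scong (par_list (?As[j := subst (id(?u := z)) (subst ((app_map \<sigma>)(y' := ?u)) S')]))
     (par_list (?As[j := subst ((app_map \<sigma>)(y' := z)) S']))"
    using ij(2) by (intro scong_comm) simp_all
  ultimately show ?thesis using re_struct[OF sc_refl] scong_res_list_cong by blast
qed

lemma react_call:
  assumes i: "i < nthreads F" and L: "L \<in> dom (eqs F)"
    and th: "threads \<sigma> c ! i = Call L (map (app_map \<sigma>) (formals F L))"
  shows "msubst (map_of (zip (formals F L) (map (app_map \<sigma>) (formals F L)))) (body F L) = msubst \<sigma> (body F L)"
    and "react (eqs F) (state_proc rs \<sigma> c) (res_list rs (par_list ((threads \<sigma> c)[i := msubst \<sigma> (body F L)])))"
proof -
  show *: "msubst (map_of (zip (formals F L) (map (app_map \<sigma>) (formals F L)))) (body F L) = msubst \<sigma> (body F L)"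
  proof (rule subst_cong)
    fix x assume "x \<in> fn (body F L)"
    then have "x \<in> set (formals F L)" using fn_body[OF L] by simp
    then show "app_map (map_of (zip (formals F L) (map (app_map \<sigma>) (formals F L)))) x = app_map \<sigma> x"
      by (simp add: app_map_def map_of_zip_map)
  qed
  have "redex_at (eqs F) (threads \<sigma> c) ((threads \<sigma> c)[i := msubst \<sigma> (body F L)])"
    using at_call[where D = "eqs F", OF _ th eqs_Some[OF L]] i * by simp
  then show "react (eqs F) (state_proc rs \<sigma> c) (res_list rs (par_list ((threads \<sigma> c)[i := msubst \<sigma> (body F L)])))"
    unfolding state_proc_def by (rule redex_imp_react[OF redex_at_imp_redex])
qed

lemma Single_sound:
  assumes inv: "state_inv rs \<sigma> c ev" and i: "i < nthreads F" and u: "u \<in> cf_trans F" "lab u = LTau"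
    and ci: "c i = src u" and pre: "\<And>p. p \<in> cmds_pre (cmds u) \<Longrightarrow> val_marking ev p > 0"
  shows "\<exists>rs' \<sigma>' c' ev'. fires_to Ms (Single i u) c ev c' ev' \<and> state_inv rs' \<sigma>' c' ev' \<and>
     (if main_trans (Single i u) then react (eqs F) (state_proc rs \<sigma> c) (state_proc rs' \<sigma>' c')
      else scong (state_proc rs \<sigma> c) (state_proc rs' \<sigma>' c'))"
  using u(1)
proof cases
  case (cf_nu n r S l)
  have c: "c i = (Thr (Res r S), l)" using ci cf_nu(1) by simp
  obtain K where K: "K \<in> thread_idents F i" "scoped K (Res r S) l"
    using state_invD(3)[OF inv i] c by auto
  have rR: "r \<in> RESTR F" using res_binders_RESTR[OF thread_idents_dom[OF i K(1)]] scoped_Res(4)[OF K(2)] by blast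
  have nP: "n \<notin> PUB F" using NEW_PUB[OF cf_nu(2)] .
  have star: "val_marking ev (NeqStar n) > 0"
    by (rule pre) (use cf_nu(1) nP rR in \<open>simp add: cmds_pre_def\<close>)
  have neq: "val_marking ev (Neq y n) > 0" if "y \<in> INP F \<union> FRM F" for y
    by (rule pre) (use cf_nu(1) nP rR that in \<open>simp add: cmds_pre_def\<close>)
  \<comment> \<open>The marked place \<open>NeqStar n\<close> excludes restricted names with value
    \<open>n\<close>, and the tests of \<open>Neq y n\<close> exclude inputs and formal parameters.
    Without these tests a value still held by a receiver could be handed out again.\<close>
  have "ev x \<noteq> Some n" for x
  proof
    assume x: "ev x = Some n"
    then have "x \<in> vars" by (rule valuationD(1)[OF state_invD(5)[OF inv]])
    then consider "x \<in> RESTR F" | "x \<in> INP F \<union> FRM F" by blast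
    then show False
    proof cases
      case 1
      then show False using star x by (auto split: if_splits)
    next
      case 2
      then show False using neq[OF 2] x by simp
    qed
  qed
  then have n: "n \<notin> ran ev" by (auto simp: ran_def)
  obtain v where v: "v \<notin> set rs \<union> PUB F" using arb_element[of "set rs \<union> PUB F"] finite_PUB by auto
  have "\<not> main_trans (Single i u)" using cf_nu(1) by simp
  then show ?thesis using nu_rule[OF inv i c cf_nu(2) n v] cf_nu(1) by metis
next
  case (cf_tau S bs l)
  have c: "c i = (Thr (Choice bs), l)" using ci cf_tau(1) by simp
  note rule = tau_rule[OF inv i c cf_tau(2)]
  have "react (eqs F) (state_proc rs \<sigma> c) (state_proc rs \<sigma> (c(i := (Thr S, l @ dropped bs S))))"
    using react_tau[OF i _ cf_tau(2), of c rs \<sigma>] c rule(3) unfolding state_proc_def by simp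
  moreover have "main_trans (Single i u)" using cf_tau(1) by simp
  ultimately show ?thesis using rule(1,2) cf_tau(1) by metis
next
  case (cf_call1 cc L xs x fs S a l)
  have c: "c i = (cc, l)" using ci cf_call1(1) by simp
  have x: "ev x = Some a"
    using pre[of "Eq x a"] cf_call1(1) by (simp add: cmds_pre_def split: if_splits)
  obtain z where z: "\<sigma> x = Some z" using state_invD(8)[OF inv] x by blast
  have fs: "fs = formals F L" using eqs_SomeD(2)[OF cf_call1(3)] by simp
  note rule = call1_rule[OF inv i c cf_call1(2) fs x z]
  have "\<not> main_trans (Single i u)" using cf_call1(1) by simp
  moreover have "scong (state_proc rs \<sigma> c) (state_proc rs (\<sigma>(fs ! length xs \<mapsto> z))
      (c(i := (Pend L xs, if x \<in> set l then l else l @ [x]))))"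
    unfolding state_proc_def rule(4) by (rule sc_refl)
  ultimately show ?thesis using rule(2,3) cf_call1(1) by metis
next
  case (cf_call2 cc L a x l)
  have c: "c i = (cc, x # l)" using ci cf_call2(1) by simp
  have x: "ev x = Some a"
    using pre[of "Eq x a"] cf_call2(1) by (simp add: cmds_pre_def split: if_splits)
  note rule = call2_rule[OF inv i c cf_call2(2) x]
  have "\<not> main_trans (Single i u)" using cf_call2(1) by simp
  moreover have "scong (state_proc rs \<sigma> c) (state_proc rs (\<sigma>(x := None)) (c(i := (Pend L [], l))))"
    unfolding state_proc_def rule(4) by (rule sc_refl)
  ultimately show ?thesis using rule(2,3) cf_call2(1) by metis
next
  case (cf_call3 cc L fs S)
  have c: "c i = (cc, [])" using ci cf_call3(1) by simp
  have S: "S = body F L" using eqs_SomeD(3)[OF cf_call3(3)] by simp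
  note rule = call3_rule[OF inv i c cf_call3(2)]
  have "react (eqs F) (state_proc rs \<sigma> c) (state_proc rs \<sigma> (c(i := (Thr (body F L), []))))"
    using react_call(2)[OF i rule(1,5), of rs] rule(4) unfolding state_proc_def by simp
  moreover have "main_trans (Single i u)" using cf_call3(1) by simp
  ultimately show ?thesis using rule(2,3) cf_call3(1) S by metis
qed (use u(2) in auto)

lemma Sync_sound:
  assumes inv: "state_inv rs \<sigma> c ev" and ij: "i < nthreads F" "j < nthreads F" "i \<noteq> j"
    and t: "t \<in> cf_trans F" "lab t = LSend a b" and u: "u \<in> cf_trans F" "lab u = LRec a b"
    and c: "c i = src t" "c j = src u"
    and pre: "\<And>p. p \<in> cmds_pre (cmds t \<union> cmds u) \<Longrightarrow> val_marking ev p > 0"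
  shows "\<exists>rs' \<sigma>' c' ev'. fires_to Ms (Sync i t j u) c ev c' ev' \<and> state_inv rs' \<sigma>' c' ev' \<and>
     react (eqs F) (state_proc rs \<sigma> c) (state_proc rs' \<sigma>' c')"
proof -
  obtain x y S bs l where T: "(Out x y, S) \<in> set bs"
    "t = \<lparr>src = (Thr (Choice bs), l), rl = RSnd, lab = LSend a b, cmds = {Test x a, Test y b},
     tgt = (Thr S, l @ dropped bs S)\<rparr>"
    using t by cases auto
  obtain x' y' S' cs m where U: "(Inp x' y', S') \<in> set cs"
    "u = \<lparr>src = (Thr (Choice cs), m), rl = RRec, lab = LRec a b, cmds = {Test x' a, Map y' b},
     tgt = (Thr S', m @ dropped cs S')\<rparr>"
    using u by cases auto
  have ci: "c i = (Thr (Choice bs), l)" and cj: "c j = (Thr (Choice cs), m)" using c T U by simp_all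
  have ev: "ev x = Some a" "ev x' = Some a" "ev y = Some b"
    using pre[of "Eq x a"] pre[of "Eq x' a"] pre[of "Eq y b"] T(2) U(2)
    by (simp_all add: cmds_pre_def split: if_splits)
  have dom: "x \<in> dom \<sigma>" "x' \<in> dom \<sigma>" using state_invD(8)[OF inv] ev by blast+
  obtain z where z: "\<sigma> y = Some z" using state_invD(8)[OF inv] ev by blast
  have "\<sigma> x = \<sigma> x'" using agreeD(3)[OF state_invD(6)[OF inv] dom] ev by simp
  then have eq: "app_map \<sigma> x = app_map \<sigma> x'" "app_map \<sigma> y = z" using z dom by (auto simp: app_map_def)
  note rule = sync_rule[OF inv ij ci cj T(1) U(1) ev z]
  have "react (eqs F) (state_proc rs \<sigma> c) (state_proc rs (\<sigma>(y' \<mapsto> z))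
      (c(i := (Thr S, l @ dropped bs S), j := (Thr S', m @ dropped cs S'))))"
    using react_sync[OF ij _ _ T(1) U(1) eq, of c rs] ci cj rule(3) unfolding state_proc_def by simp
  then show ?thesis using rule(1,2) T(2) U(2) by metis
qed

lemma step_sound:
  assumes inv: "state_inv rs \<sigma> c ev" and en: "enabled (net F Ms) (state_marking c ev) t"
  shows "\<exists>rs' \<sigma>' c' ev'. fire (net F Ms) (state_marking c ev) t = state_marking c' ev' \<and>
     state_inv rs' \<sigma>' c' ev' \<and>
     (if main_trans t then react (eqs F) (state_proc rs \<sigma> c) (state_proc rs' \<sigma>' c')
      else scong (state_proc rs \<sigma> c) (state_proc rs' \<sigma>' c'))"
proof -
  have t: "t \<in> composed_trans F" and marked: "\<And>p. p \<in> preset F t \<Longrightarrow> state_marking c ev p > 0"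
    using en unfolding enabled_net net_trans_def by blast+
  have pre: "val_marking ev p > 0" if "p \<in> cmds_pre (commands t)" for p
    using marked[of p] that cmds_pre_not_ctrl[OF that] by (simp add: preset_cmds state_marking_val)
  have ctrl: "c i = q" if "Ctrl i q \<in> ctrl_pre t" for i q
    using marked[of "Ctrl i q"] that by (simp add: preset_cmds split: if_splits)
  show ?thesis
  proof (cases t)
    case (Single i u)
    then have "i < nthreads F" "u \<in> cf_trans F" "lab u = LTau" "c i = src u"
      using t ctrl by (auto simp: composed_trans_def cf_net_trans_def)
    from Single_sound[OF inv this] pre Single show ?thesis
      unfolding fires_to_def by (metis commands.simps(1))
  next
    case (Sync i u j w)
    then obtain a b where "i < nthreads F" "j < nthreads F" "i \<noteq> j" "u \<in> cf_trans F" "lab u = LSend a b"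
      "w \<in> cf_trans F" "lab w = LRec a b"
      using t by (auto simp: composed_trans_def cf_net_trans_def)
    moreover have "c i = src u" "c j = src w" using Sync ctrl by simp_all
    ultimately obtain rs' \<sigma>' c' ev' where "fires_to Ms (Sync i u j w) c ev c' ev'" "state_inv rs' \<sigma>' c' ev'"
      "react (eqs F) (state_proc rs \<sigma> c) (state_proc rs' \<sigma>' c')"
      using Sync_sound[OF inv, of i j u a b w Ms] pre Sync by (metis commands.simps(2))
    then show ?thesis using Sync unfolding fires_to_def by (metis main_trans.simps(2))
  qed
qed

text \<open>Race freedom asks for one counted transition; the case of none is carried along because
  it describes the rest of the sequence once that transition has fired.\<close>

lemma fires_sound:
  assumes "fires (net F Ms) M ts M'" "M = state_marking c ev" "state_inv rs \<sigma> c ev"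
  shows "\<exists>rs' \<sigma>' c' ev'. M' = state_marking c' ev' \<and> state_inv rs' \<sigma>' c' ev' \<and>
     (filter main_trans ts = [] \<longrightarrow> scong (state_proc rs \<sigma> c) (state_proc rs' \<sigma>' c')) \<and>
     (length (filter main_trans ts) = 1 \<longrightarrow> react (eqs F) (state_proc rs \<sigma> c) (state_proc rs' \<sigma>' c'))"
  using assms
proof (induction arbitrary: c ev rs \<sigma> rule: fires.induct)
  case (fires_Nil M)
  then show ?case
    by (intro exI[of _ rs] exI[of _ \<sigma>] exI[of _ c] exI[of _ ev]) (simp add: sc_refl)
next
  case (fires_Cons M t ts M')
  have en: "enabled (net F Ms) (state_marking c ev) t" using fires_Cons by simp
  obtain rs1 \<sigma>1 c1 ev1 where 1: "fire (net F Ms) M t = state_marking c1 ev1" "state_inv rs1 \<sigma>1 c1 ev1"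
    "if main_trans t then react (eqs F) (state_proc rs \<sigma> c) (state_proc rs1 \<sigma>1 c1)
      else scong (state_proc rs \<sigma> c) (state_proc rs1 \<sigma>1 c1)"
    using step_sound[OF fires_Cons.prems(2) en] unfolding fires_Cons.prems(1) by blast
  obtain rs' \<sigma>' c' ev' where 2: "M' = state_marking c' ev'" "state_inv rs' \<sigma>' c' ev'"
    "filter main_trans ts = [] \<longrightarrow> scong (state_proc rs1 \<sigma>1 c1) (state_proc rs' \<sigma>' c')"
    "length (filter main_trans ts) = 1 \<longrightarrow> react (eqs F) (state_proc rs1 \<sigma>1 c1) (state_proc rs' \<sigma>' c')"
    using fires_Cons.IH[OF 1(1,2)] by blast
  have "filter main_trans (t # ts) = [] \<longrightarrow> scong (state_proc rs \<sigma> c) (state_proc rs' \<sigma>' c')"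
    using 1(3) 2(3) by (auto intro: sc_trans)
  moreover have "react (eqs F) (state_proc rs \<sigma> c) (state_proc rs' \<sigma>' c')"
    if "length (filter main_trans (t # ts)) = 1"
  proof (cases "main_trans t")
    case True
    then have "filter main_trans ts = []" using that by simp
    then show ?thesis using True 1(3) 2(3) re_struct[OF sc_refl] by simp
  next
    case False
    then have "length (filter main_trans ts) = 1" using that by simp
    then show ?thesis using False 1(3) 2(4) re_struct[OF _ _ sc_refl] by simp
  qed
  ultimately show ?case using 2(1,2) by blast
qed

section \<open>Completeness of net steps\<close>

fun res_depth :: "('k, 'n) ctrl \<Rightarrow> nat" where
  "res_depth (Thr (Res r S)) = Suc (res_depth (Thr S))"
| "res_depth _ = 0"

lemma fires_to_Cons:
  "fires_to Ms t c ev c' ev' \<Longrightarrow> fires (net F Ms) (state_marking c' ev') ts M \<Longrightarrow>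
   fires (net F Ms) (state_marking c ev) (t # ts) M"
  unfolding fires_to_def by (metis fires_Cons)

text \<open>By the hypothesis on \<open>c\<close> no call is half processed, so only leading
  restrictions can keep a place from being stable. Their total number decreases with each resolved
  restriction.\<close>

lemma complete_nu:
  assumes "state_inv rs \<sigma> c ev" "\<And>i. i < nthreads F \<Longrightarrow> \<exists>S. fst (c i) = Thr S"
  shows "\<exists>ts rs' \<sigma>' c' ev'. fires (net F Ms) (state_marking c ev) ts (state_marking c' ev') \<and>
     filter main_trans ts = [] \<and> state_inv rs' \<sigma>' c' ev' \<and>
     scong (state_proc rs \<sigma> c) (state_proc rs' \<sigma>' c') \<and> (\<forall>i < nthreads F. stable_place F (c' i))"
  using assms
proof (induction "\<Sum>i < nthreads F. res_depth (fst (c i))" arbitrary: rs \<sigma> c ev rule: less_induct)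
  case less
  note inv = less.prems(1)
  show ?case
  proof (cases "\<exists>i < nthreads F. \<exists>r S l. c i = (Thr (Res r S), l)")
    case True
    then obtain i r S l where i: "i < nthreads F" and ci: "c i = (Thr (Res r S), l)" by blast
    obtain K where K: "K \<in> thread_idents F i" "scoped K (Res r S) l"
      using state_invD(3)[OF inv i] ci by auto
    have rR: "r \<in> RESTR F" using res_binders_RESTR[OF thread_idents_dom[OF i K(1)]] scoped_Res(4)[OF K(2)] by blast
    have "r \<in> thread_vars i" using K(1) scoped_Res(4)[OF K(2)] by (auto simp: thread_vars_def eqn_binders_def)
    then have "ev r = None" using unmapped(2)[OF inv i] scoped_Res(3)[OF K(2)] ci by auto
    then obtain n where n: "n \<in> NEW F" "n \<notin> ran ev" using fresh_value[OF state_invD(5)[OF inv] rR] by blast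
    obtain v where v: "v \<notin> set rs \<union> PUB F" using arb_element[of "set rs \<union> PUB F"] finite_PUB by auto
    let ?c = "c(i := (Thr S, l))"
    let ?u = "\<lparr>src = (Thr (Res r S), l), rl = RNu, lab = LTau, cmds = {Map r n}, tgt = (Thr S, l)\<rparr>"
    note rule = nu_rule[OF inv i ci n v]
    have "(\<Sum>j < nthreads F. res_depth (fst (?c j))) < (\<Sum>j < nthreads F. res_depth (fst (c j)))"
      by (rule sum_strict_mono_ex1) (use i ci in \<open>auto intro!: bexI[of _ i]\<close>)
    moreover have "\<exists>S. fst (?c j) = Thr S" if "j < nthreads F" for j using less.prems(2)[OF that] by simp
    ultimately obtain ts rs' \<sigma>' c' ev' where IH: "fires (net F Ms) (state_marking ?c (ev(r \<mapsto> n))) ts (state_marking c' ev')"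
      "filter main_trans ts = []" "state_inv rs' \<sigma>' c' ev'"
      "scong (state_proc (v # rs) (\<sigma>(r \<mapsto> v)) ?c) (state_proc rs' \<sigma>' c')" "\<forall>i < nthreads F. stable_place F (c' i)"
      using less.hyps[OF _ rule(2)] by blast
    show ?thesis
      using fires_to_Cons[OF rule(1) IH(1)] IH(2,3,5) sc_trans[OF rule(3) IH(4)]
      by (intro exI[of _ "Single i ?u # ts"] exI[of _ rs'] exI[of _ \<sigma>'] exI[of _ c'] exI[of _ ev']) simp
  next
    case False
    have "stable_place F (c i)" if i: "i < nthreads F" for i
    proof -
      obtain S l where ci: "c i = (Thr S, l)" using less.prems(2)[OF i] by (metis prod.collapse)
      then obtain K where K: "K \<in> thread_idents F i" "scoped K S l" using state_invD(3)[OF inv i] by auto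
      show ?thesis
      proof (cases S)
        case (Call L xs)
        then have "(L, xs) \<in> calls (body F K)" using scopedD(3)[OF K(2)] by simp
        then show ?thesis using calls_body(3)[OF thread_idents_dom[OF i K(1)]] ci Call by simp
      next
        case (Par P Q)
        then show ?thesis using scopedD(1)[OF K(2)] by simp
      qed (use ci False i in auto)
    qed
    then show ?thesis using inv sc_refl
      by (intro exI[of _ "[]"] exI[of _ rs] exI[of _ \<sigma>] exI[of _ c] exI[of _ ev]) (auto intro: fires_Nil)
  qed
qed

lemma complete_call:
  assumes "state_inv rs \<sigma> c ev" "i < nthreads F" "c i = (cc, l)"
    "cc = Thr (Call L xs) \<or> cc = Pend L xs"
  shows "\<exists>ts \<sigma>' c' ev' cc'. fires (net F Ms) (state_marking c ev) ts (state_marking c' ev') \<and>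
     filter main_trans ts = [] \<and> state_inv rs \<sigma>' c' ev' \<and> threads \<sigma>' c' = threads \<sigma> c \<and>
     c' i = (cc', []) \<and> (cc' = Thr (Call L []) \<or> cc' = Pend L []) \<and> (\<forall>j. j \<noteq> i \<longrightarrow> c' j = c j)"
  using assms
\<comment> \<open>Passing a parameter removes one argument but may lengthen the waiting list by one,
  hence the weight 2; unmapping shortens the waiting list.\<close>
proof (induction "2 * length xs + length l" arbitrary: \<sigma> c ev cc l xs rule: less_induct)
  case less
  note inv = less.prems(1) and i = less.prems(2) and ci = less.prems(3) and cc = less.prems(4)
  consider y ys where "xs = ys @ [y]" | y m where "xs = []" "l = y # m" | "xs = []" "l = []"
    by (metis list.exhaust rev_exhaust)
  then show ?case
  proof cases
    case (1 x ys)
    have cc': "cc = Thr (Call L (ys @ [x])) \<or> cc = Pend L (ys @ [x])" using cc 1 by simp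
    have "x \<in> live (c i)" using cc' ci by auto
    then obtain z a where z: "\<sigma> x = Some z" "ev x = Some a" using mapped[OF inv i] by blast
    let ?l = "if x \<in> set l then l else l @ [x]" and ?f = "formals F L ! length ys"
    let ?c = "c(i := (Pend L ys, ?l))"
    let ?u = "\<lparr>src = (cc, l), rl = RCall1, lab = LTau, cmds = {Test x a, Map ?f a}, tgt = (Pend L ys, ?l)\<rparr>"
    note rule = call1_rule[OF inv i ci cc' refl z(2,1)]
    have "2 * length ys + length ?l < 2 * length xs + length l" using 1 by simp
    from less.hyps[OF this rule(3) i]
    obtain ts \<sigma>' c' ev' cc' where IH: "fires (net F Ms) (state_marking ?c (ev(?f \<mapsto> a))) ts (state_marking c' ev')"
      "filter main_trans ts = []" "state_inv rs \<sigma>' c' ev'" "threads \<sigma>' c' = threads (\<sigma>(?f \<mapsto> z)) ?c"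
      "c' i = (cc', [])" "cc' = Thr (Call L []) \<or> cc' = Pend L []" "\<forall>j. j \<noteq> i \<longrightarrow> c' j = ?c j"
      by auto
    show ?thesis
      using fires_to_Cons[OF rule(2) IH(1)] IH(2-7) rule(4)
      by (intro exI[of _ "Single i ?u # ts"] exI[of _ \<sigma>'] exI[of _ c'] exI[of _ ev'] exI[of _ cc']) simp
  next
    case (2 x m)
    have cc': "cc = Thr (Call L []) \<or> cc = Pend L []" and ci': "c i = (cc, x # m)" using cc ci 2 by simp_all
    have "x \<in> live (c i)" using ci' by auto
    then obtain z a where z: "\<sigma> x = Some z" "ev x = Some a" using mapped[OF inv i] by blast
    let ?c = "c(i := (Pend L [], m))"
    let ?u = "\<lparr>src = (cc, x # m), rl = RCall2, lab = LTau, cmds = {Unmap x a}, tgt = (Pend L [], m)\<rparr>"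
    note rule = call2_rule[OF inv i ci' cc' z(2)]
    have "2 * length ([] :: 'n list) + length m < 2 * length xs + length l" using 2 by simp
    from less.hyps[OF this rule(3) i]
    obtain ts \<sigma>' c' ev' cc' where IH: "fires (net F Ms) (state_marking ?c (ev(x := None))) ts (state_marking c' ev')"
      "filter main_trans ts = []" "state_inv rs \<sigma>' c' ev'" "threads \<sigma>' c' = threads (\<sigma>(x := None)) ?c"
      "c' i = (cc', [])" "cc' = Thr (Call L []) \<or> cc' = Pend L []" "\<forall>j. j \<noteq> i \<longrightarrow> c' j = ?c j"
      by auto
    show ?thesis
      using fires_to_Cons[OF rule(2) IH(1)] IH(2-7) rule(4)
      by (intro exI[of _ "Single i ?u # ts"] exI[of _ \<sigma>'] exI[of _ c'] exI[of _ ev'] exI[of _ cc']) simp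
  next
    case 3
    then show ?thesis using inv ci cc
      by (intro exI[of _ "[]"] exI[of _ \<sigma>] exI[of _ c] exI[of _ ev] exI[of _ cc]) (auto intro: fires_Nil)
  qed
qed

text \<open>Only the threads of the redex leave their places, and they end in \<open>Thr\<close>
  states. Unresolved restrictions are then all that can separate the result from a stable
  one.\<close>

lemma complete_main:
  assumes inv: "state_inv rs \<sigma> c ev" and st: "\<And>i. i < nthreads F \<Longrightarrow> stable_place F (c i)"
    and G: "react (eqs F) G G'" "scong G (state_proc rs \<sigma> c)"
  shows "\<exists>ts rs' \<sigma>' c' ev'. fires (net F Ms) (state_marking c ev) ts (state_marking c' ev') \<and>
     length (filter main_trans ts) = 1 \<and> state_inv rs' \<sigma>' c' ev' \<and>
     scong G' (state_proc rs' \<sigma>' c') \<and> (\<forall>i < nthreads F. \<exists>S. fst (c' i) = Thr S)"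
proof -
  \<comment> \<open>\<open>binders_used\<close> rules out the empty choice, which would vanish from
    the prenex form.\<close>
  have thr: "(\<exists>bs l. c i = (Thr (Choice bs), l) \<and> bs \<noteq> []) \<or> (\<exists>L xs l. c i = (Thr (Call L xs), l))"
    if i: "i < nthreads F" for i
  proof -
    obtain cc l where ci: "c i = (cc, l)" by force
    then obtain S where cc: "cc = Thr S" "is_choice S \<or> is_call S" using st[OF i]
      by (cases "(F, c i)" rule: stable_place.cases) auto
    then obtain K where K: "scoped K S l" using state_invD(3)[OF inv i] ci by auto
    show ?thesis using cc ci scopedD(2)[OF K] by (cases S) auto
  qed
  have Thr: "\<exists>S. fst (c i) = Thr S" if "i < nthreads F" for i using thr[OF that] by auto
  let ?As = "threads \<sigma> c"
  have atoms: "is_call A \<or> is_choice A \<and> A \<noteq> Nil0" if "A \<in> set ?As" for A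
  proof -
    obtain i where i: "i < nthreads F" "A = ?As ! i" using \<open>A \<in> set ?As\<close> by (auto simp: in_set_conv_nth)
    show ?thesis using thr[OF i(1)] i by (auto simp: nth_threads)
  qed
  obtain Cs where Cs: "redex (eqs F) (mset ?As) (mset Cs)" "scong G' (res_list rs (par_list Cs))"
    using react_inversion[OF G(1) closed_eqs G(2)[unfolded state_proc_def] state_invD(1)[OF inv] atoms] by blast
  obtain Ds where Ds: "redex_at (eqs F) ?As Ds" "mset Cs = mset Ds" using redex_imp_redex_at[OF Cs(1)] .
  have G': "scong G' (res_list rs (par_list Ds))"
    using Cs(2) scong_res_list_cong[OF scong_par_list_mset[OF Ds(2)]] by (rule sc_trans)
  have split: "(\<exists>bs l. c i = (Thr (Choice bs), l) \<and> bs0 = map (subst_branch (app_map \<sigma>)) bs)"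
    if "i < nthreads F" "?As ! i = Choice bs0" for i bs0
    using thr[OF that(1)] that by (auto simp: nth_threads)
  show ?thesis using Ds(1)
  proof cases
    case (at_tau i bs0 S0)
    then have i: "i < nthreads F" by simp
    obtain bs l where bs: "c i = (Thr (Choice bs), l)" "bs0 = map (subst_branch (app_map \<sigma>)) bs"
      using split[OF i at_tau(3)] by blast
    \<comment> \<open>The redex is found in the substituted thread; undoing
      \<open>subst_branch\<close> recovers the branch of the unsubstituted one, from which the net
      transition is built.\<close>
    obtain b where "b \<in> set bs" "subst_branch (app_map \<sigma>) b = (Tau, S0)" using at_tau(4) bs(2) by auto
    then obtain S where S: "(Tau, S) \<in> set bs" "S0 = msubst \<sigma> S" using subst_branch_inv(1) by blast
    note rule = tau_rule[OF inv i bs(1) S(1)]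
    show ?thesis
      using fires_to_Cons[OF rule(1) fires_Nil] rule(2,3) G' at_tau(1) S(2) Thr
      unfolding state_proc_def
      by (intro exI[of _ "[Single i \<lparr>src = (Thr (Choice bs), l), rl = RTau, lab = LTau, cmds = {}, tgt = (Thr S, l @ dropped bs S)\<rparr>]"]
          exI[of _ rs] exI[of _ \<sigma>] exI[of _ "c(i := (Thr S, l @ dropped bs S))"] exI[of _ ev]) auto
  next
    case (at_call i L as fs S)
    then have i: "i < nthreads F" by simp
    have "\<exists>xs l. c i = (Thr (Call L xs), l)"
      using thr[OF i] at_call(3) i by (auto simp: nth_threads)
    then obtain xs l where ci: "c i = (Thr (Call L xs), l)" by blast
    \<comment> \<open>Parameter passing and unmapping come first. They leave the list of threads
      literally unchanged, so the redex is still in place when the call is unfolded.\<close>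
    obtain ts \<sigma>' c1 ev' cc' where C: "fires (net F Ms) (state_marking c ev) ts (state_marking c1 ev')"
     "filter main_trans ts = []" "state_inv rs \<sigma>' c1 ev'" "threads \<sigma>' c1 = threads \<sigma> c"
     "c1 i = (cc', [])" "cc' = Thr (Call L []) \<or> cc' = Pend L []" "\<forall>j. j \<noteq> i \<longrightarrow> c1 j = c j"
      using complete_call[OF inv i ci, of L xs Ms] by blast
    note rule = call3_rule[OF C(3) i C(5,6)]
    have as: "as = map (app_map \<sigma>') (formals F L)" using rule(5) C(4) at_call(3) by simp
    have fs: "fs = formals F L" "S = body F L" using eqs_SomeD[OF at_call(4)] by simp_all
    have "Ds = threads \<sigma>' (c1(i := (Thr (body F L), [])))"
      unfolding at_call(1) as fs react_call(1)[OF i rule(1,5)] rule(4) C(4) by simp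
    moreover have "fires (net F Ms) (state_marking c ev) (ts @ [Single i \<lparr>src = (cc', []), rl = RCall3, lab = LTau, cmds = {}, tgt = (Thr (body F L), [])\<rparr>])
       (state_marking (c1(i := (Thr (body F L), []))) ev')"
      by (rule fires_append[OF C(1) fires_to_Cons[OF rule(2) fires_Nil]])
    moreover have "\<exists>S. fst ((c1(i := (Thr (body F L), []))) j) = Thr S" if "j < nthreads F" for j
      using Thr[OF that] C(7) by auto
    ultimately show ?thesis using G' rule(3) C(2) unfolding state_proc_def
      by (intro exI[of _ "ts @ [Single i \<lparr>src = (cc', []), rl = RCall3, lab = LTau, cmds = {}, tgt = (Thr (body F L), [])\<rparr>]"]
          exI[of _ rs] exI[of _ \<sigma>'] exI[of _ "c1(i := (Thr (body F L), []))"] exI[of _ ev']) simp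
  next
    case (at_comm i j bs0 cs0 x0 z S0 y0 S0')
    then have ij: "i < nthreads F" "j < nthreads F" "i \<noteq> j" by simp_all
    obtain bs l where bs: "c i = (Thr (Choice bs), l)" "bs0 = map (subst_branch (app_map \<sigma>)) bs"
      using split[OF ij(1) at_comm(5)] by blast
    obtain cs m where cs: "c j = (Thr (Choice cs), m)" "cs0 = map (subst_branch (app_map \<sigma>)) cs"
      using split[OF ij(2) at_comm(6)] by blast
    obtain b where "b \<in> set bs" "subst_branch (app_map \<sigma>) b = (Out x0 z, S0)" using at_comm(7) bs(2) by auto
    then obtain x y S where S: "(Out x y, S) \<in> set bs" "x0 = app_map \<sigma> x" "z = app_map \<sigma> y" "S0 = msubst \<sigma> S"
      using subst_branch_inv(2) by blast
    obtain b' where "b' \<in> set cs" "subst_branch (app_map \<sigma>) b' = (Inp x0 y0, S0')" using at_comm(8) cs(2) by auto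
    then obtain x' y' S' where S': "(Inp x' y', S') \<in> set cs" "x0 = app_map \<sigma> x'"
      "y0 = avoid y' (app_map \<sigma> ` (fn S' - {y'}))" "S0' = subst ((app_map \<sigma>)(y' := y0)) S'"
      using subst_branch_inv(3) by blast
    have lv: "x \<in> live (c i)" "y \<in> live (c i)" "x' \<in> live (c j)"
      using bs(1) cs(1) fn_Choice_branch[OF S(1)] fn_Choice_branch[OF S'(1)] by auto
    obtain z1 a where x: "\<sigma> x = Some z1" "ev x = Some a" using mapped[OF inv ij(1) lv(1)] .
    obtain z2 b where y: "\<sigma> y = Some z2" "ev y = Some b" using mapped[OF inv ij(1) lv(2)] .
    obtain z3 a' where x': "\<sigma> x' = Some z3" "ev x' = Some a'" using mapped[OF inv ij(2) lv(3)] .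
    \<comment> \<open>The channels coincide as process names; \<open>agree\<close> carries this over
      to the net values, so the labels of the sending and the receiving transition match.\<close>
    have "\<sigma> x = \<sigma> x'" using S(2) S'(2) x x' by (simp add: app_map_def)
    then have "ev x = ev x'" using agreeD(3)[OF state_invD(6)[OF inv], of x x'] x x' by auto
    then have ex': "ev x' = Some a" using x by simp
    have z: "\<sigma> y = Some z" using y S(3) by (simp add: app_map_def)
    let ?c = "c(i := (Thr S, l @ dropped bs S), j := (Thr S', m @ dropped cs S'))"
    note rule = sync_rule[OF inv ij bs(1) cs(1) S(1) S'(1) x(2) ex' y(2) z]
    have "scong (par_list Ds) (par_list (threads (\<sigma>(y' \<mapsto> z)) ?c))"
      unfolding at_comm(1) rule(3) S(4) S'(4) using ij(2) by (intro scong_comm[OF _ S'(3)]) simp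
    then have "scong G' (state_proc rs (\<sigma>(y' \<mapsto> z)) ?c)"
      unfolding state_proc_def using G' scong_res_list_cong sc_trans by blast
    moreover have "\<exists>S. fst (?c k) = Thr S" if "k < nthreads F" for k using Thr[OF that] by auto
    ultimately show ?thesis using fires_to_Cons[OF rule(1) fires_Nil] rule(2)
      by (intro exI[of _ "[Sync i \<lparr>src = (Thr (Choice bs), l), rl = RSnd, lab = LSend a b, cmds = {Test x a, Test y b},
     tgt = (Thr S, l @ dropped bs S)\<rparr> j \<lparr>src = (Thr (Choice cs), m), rl = RRec, lab = LRec a b, cmds = {Test x' a, Map y' b},
     tgt = (Thr S', m @ dropped cs S')\<rparr>]"] exI[of _ rs] exI[of _ "\<sigma>(y' \<mapsto> z)"] exI[of _ ?c] exI[of _ "ev(y' \<mapsto> b)"]) simp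
  qed
qed

lemma complete_step:
  assumes inv: "state_inv rs \<sigma> c ev" and st: "\<And>i. i < nthreads F \<Longrightarrow> stable_place F (c i)"
    and G: "react (eqs F) G G'" "scong G (state_proc rs \<sigma> c)"
  obtains ts rs' \<sigma>' c' ev' where "fires (net F Ms) (state_marking c ev) ts (state_marking c' ev')"
    "length (filter main_trans ts) = 1" "state_inv rs' \<sigma>' c' ev'"
    "scong G' (state_proc rs' \<sigma>' c')" "\<And>i. i < nthreads F \<Longrightarrow> stable_place F (c' i)"
proof -
  obtain ts1 rs1 \<sigma>1 c1 ev1 where 1: "fires (net F Ms) (state_marking c ev) ts1 (state_marking c1 ev1)"
    "length (filter main_trans ts1) = 1" "state_inv rs1 \<sigma>1 c1 ev1" "scong G' (state_proc rs1 \<sigma>1 c1)"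
    "\<forall>i < nthreads F. \<exists>S. fst (c1 i) = Thr S"
    using complete_main[OF inv st G, of Ms] by blast
  obtain ts2 rs2 \<sigma>2 c2 ev2 where 2: "fires (net F Ms) (state_marking c1 ev1) ts2 (state_marking c2 ev2)"
    "filter main_trans ts2 = []" "state_inv rs2 \<sigma>2 c2 ev2" "scong (state_proc rs1 \<sigma>1 c1) (state_proc rs2 \<sigma>2 c2)"
    "\<forall>i < nthreads F. stable_place F (c2 i)"
    using complete_nu[OF 1(3), of Ms] 1(5) by blast
  show thesis
    using that[OF fires_append[OF 1(1) 2(1)] _ 2(3) sc_trans[OF 1(4) 2(4)]] 1(2) 2(2,5) by simp
qed

end

section \<open>The bisimulation\<close>

lemma map_union_Cons: "map_union (\<tau> # \<tau>s) = \<tau> ++ map_union \<tau>s"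
  by (simp add: map_union_def)

lemma dom_map_union: "dom (map_union \<tau>s) = (\<Union>\<tau> \<in> set \<tau>s. dom \<tau>)"
  by (induction \<tau>s) (auto simp: map_union_Cons, simp_all add: map_union_def)

lemma map_union_nth:
  assumes "\<And>i j. i < length \<tau>s \<Longrightarrow> j < length \<tau>s \<Longrightarrow> i \<noteq> j \<Longrightarrow> dom (\<tau>s ! i) \<inter> dom (\<tau>s ! j) = {}"
    and "i < length \<tau>s" "x \<in> dom (\<tau>s ! i)"
  shows "map_union \<tau>s x = (\<tau>s ! i) x"
  using assms
proof (induction \<tau>s arbitrary: i)
  case (Cons \<tau> \<tau>s)
  have disj: "dom (\<tau>s ! j) \<inter> dom (\<tau>s ! k) = {}" if "j < length \<tau>s" "k < length \<tau>s" "j \<noteq> k" for j k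
    using Cons.prems(1)[of "Suc j" "Suc k"] that by simp
  show ?case
  proof (cases i)
    case 0
    have "x \<notin> dom (map_union \<tau>s)"
    proof
      assume "x \<in> dom (map_union \<tau>s)"
      then obtain j where j: "j < length \<tau>s" "x \<in> dom (\<tau>s ! j)"
        unfolding dom_map_union by (metis UN_E in_set_conv_nth)
      then show False using Cons.prems(1)[of 0 "Suc j"] Cons.prems(3) 0 by auto
    qed
    then show ?thesis using 0 by (simp add: map_union_Cons map_add_def domIff)
  next
    case (Suc j)
    then have "map_union \<tau>s x = (\<tau>s ! j) x" using Cons.IH[OF disj, of j] Cons.prems(2,3) by simp
    moreover have "x \<in> dom (map_union \<tau>s)" unfolding dom_map_union using Cons.prems(2,3) Suc by auto
    ultimately show ?thesis using Suc by (simp add: map_union_Cons map_add_dom_app_simps)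
  qed
qed simp

context fcp
begin

lemma subst_part_state: "valuation ev \<Longrightarrow> subst_part F (state_marking c ev) = val_marking ev"
proof
  fix p assume v: "valuation ev"
  show "subst_part F (state_marking c ev) p = val_marking ev p"
  proof (cases "p \<in> subst_places F")
    case True
    then have "\<not> is_ctrl p" by (auto simp: subst_places_def)
    then show ?thesis using True by (simp add: subst_part_def state_marking_val)
  next
    case False
    then have "val_marking ev p = 0" using val_marking_places[OF v, of p] by blast
    then show ?thesis using False by (simp add: subst_part_def)
  qed
qed

lemma stable_state:
  assumes "state_inv rs \<sigma> c ev"
  shows "stable F (state_marking c ev) \<longleftrightarrow> (\<forall>i < nthreads F. stable_place F (c i))"
  unfolding stable_def using state_invD(4)[OF assms] by (auto split: if_splits)

lemma represents_state:
  assumes inv: "state_inv rs \<sigma> c ev" and st: "\<And>i. i < nthreads F \<Longrightarrow> stable_place F (c i)"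
    and G: "scong G (state_proc rs \<sigma> c)"
  shows "represents F G (state_marking c ev)"
proof -
  let ?n = "nthreads F"
  \<comment> \<open>The maps of the individual threads are the global map cut down to the live names
    of each thread.\<close>
  let ?Ss = "map (\<lambda>i. residual (fst (c i))) [0..<?n]" and ?ls = "map (\<lambda>i. snd (c i)) [0..<?n]"
    and ?\<sigma>s = "map (\<lambda>i. \<sigma> |` live (c i)) [0..<?n]"
  have dom: "dom (\<sigma> |` live (c i)) = live (c i)" if "i < ?n" for i
    using live_dom[OF inv that] by auto
  have "map2 msubst ?\<sigma>s ?Ss = threads \<sigma> c"
  proof (rule nth_equalityI)
    fix i assume "i < length (map2 msubst ?\<sigma>s ?Ss)"
    then have i: "i < ?n" by simp
    have "msubst (\<sigma> |` live (c i)) (residual (fst (c i))) = msubst \<sigma> (residual (fst (c i)))"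
    proof (rule subst_cong)
      fix x assume "x \<in> fn (residual (fst (c i)))"
      then have "x \<in> live (c i)" using fn_residual_live by blast
      then show "app_map (\<sigma> |` live (c i)) x = app_map \<sigma> x" by (simp add: app_map_def)
    qed
    then show "map2 msubst ?\<sigma>s ?Ss ! i = threads \<sigma> c ! i" using i by (simp add: nth_threads)
  qed simp
  then have "scong G (res_list rs (par_list (map2 msubst ?\<sigma>s ?Ss)))" using G by (simp add: state_proc_def)
  moreover have "map_union ?\<sigma>s = \<sigma>"
  proof
    fix x
    have d: "dom (map_union ?\<sigma>s) = dom \<sigma>"
      unfolding dom_map_union state_invD(7)[OF inv] using dom by auto
    show "map_union ?\<sigma>s x = \<sigma> x"
    proof (cases "x \<in> dom \<sigma>")
      case True
      then obtain i where i: "i < ?n" "x \<in> live (c i)" using state_invD(7)[OF inv] by auto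
      have "map_union ?\<sigma>s x = (?\<sigma>s ! i) x"
        by (rule map_union_nth) (use i dom live_disjoint[OF inv] in simp_all)
      then show ?thesis using i by simp
    next
      case False
      then show ?thesis using d by (metis domIff)
    qed
  qed
  then have "corresponds F (set rs) (map_union ?\<sigma>s) (subst_part F (state_marking c ev))"
    unfolding subst_part_state[OF state_invD(5)[OF inv]]
    using agree_corresponds[OF state_invD(6,5,2)[OF inv]] by simp
  moreover have "derived F (?Ss ! i) (?ls ! i) \<and> dom (?\<sigma>s ! i) = fn (?Ss ! i) \<union> set (?ls ! i) \<and>
      ran (?\<sigma>s ! i) \<subseteq> set rs \<union> PUB F \<and> state_marking c ev (Ctrl i (Thr (?Ss ! i), ?ls ! i)) = 1"
    if i: "i < ?n" for i
  proof -
    obtain S l where ci: "c i = (Thr S, l)" "is_choice S \<or> is_call S"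
      using st[OF i] by (cases "(F, c i)" rule: stable_place.cases) auto
    obtain K where "K \<in> thread_idents F i" "((Thr (body F K), []), (Thr S, l)) \<in> (call_free_step F)\<^sup>*"
      using state_invD(3)[OF inv i] ci by auto
    then have "derived F S l" unfolding derived_def using ci(2) thread_idents_dom[OF i] by blast
    moreover have "ran (\<sigma> |` live (c i)) \<subseteq> set rs \<union> PUB F"
      using agree_ran[OF state_invD(6)[OF inv]] by (auto simp: ran_def restrict_map_def split: if_splits)
    ultimately show ?thesis using i ci dom[OF i] by simp
  qed
  ultimately show ?thesis unfolding represents_def
    using state_invD(1)[OF inv]
    by (intro exI[of _ rs] exI[of _ ?Ss] exI[of _ ?ls] exI[of _ ?\<sigma>s]) simp
qed

text \<open>The relation may hold by restricted names and maps other than those found along the run.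
  The control places and the net values are fixed by the marking, so the invariant can be rebuilt
  with the maps supplied by \<open>represents\<close>.\<close>

lemma represents_stateE:
  assumes inv: "state_inv rs0 \<sigma>0 c ev" and rep: "represents F G (state_marking c ev)"
  obtains rs \<sigma> where "state_inv rs \<sigma> c ev" "scong G (state_proc rs \<sigma> c)"
proof -
  let ?n = "nthreads F"
  obtain rs Ss ls \<sigma>s where len: "length Ss = ?n" "length ls = ?n" "length \<sigma>s = ?n" and rs: "distinct rs"
    and G: "scong G (res_list rs (par_list (map2 msubst \<sigma>s Ss)))"
    and th: "\<forall>i < ?n. derived F (Ss ! i) (ls ! i) \<and> dom (\<sigma>s ! i) = fn (Ss ! i) \<union> set (ls ! i) \<and>
       ran (\<sigma>s ! i) \<subseteq> set rs \<union> PUB F \<and> state_marking c ev (Ctrl i (Thr (Ss ! i), ls ! i)) = 1"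
    and cor: "corresponds F (set rs) (map_union \<sigma>s) (subst_part F (state_marking c ev))"
    using rep unfolding represents_def by blast
  define \<sigma> where "\<sigma> = map_union \<sigma>s"
  have ci: "c i = (Thr (Ss ! i), ls ! i)" if "i < ?n" for i
  proof -
    have "state_marking c ev (Ctrl i (Thr (Ss ! i), ls ! i)) = 1" using th that by blast
    then show ?thesis by (simp add: of_bool_def split: if_splits)
  qed
  have dom: "dom (\<sigma>s ! i) = live (c i)" if "i < ?n" for i
    using th[rule_format, OF that] ci[OF that] by simp
  have \<sigma>i: "\<sigma> x = (\<sigma>s ! i) x" if "i < ?n" "x \<in> live (c i)" for i x
    unfolding \<sigma>_def by (rule map_union_nth) (use len that dom live_disjoint[OF inv] in simp_all)
  have cor': "corresponds F (set rs) \<sigma> (val_marking ev)"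
    using cor unfolding \<sigma>_def subst_part_state[OF state_invD(5)[OF inv]] .
  have "agree (set rs) \<sigma> ev" by (rule corresponds_agree[OF cor' state_invD(5)[OF inv]])
  moreover have "set rs \<inter> PUB F = {}" using cor' by (simp add: corresponds_def)
  moreover have "dom \<sigma> = (\<Union>i < ?n. live (c i))"
  proof -
    have "set \<sigma>s = (\<lambda>i. \<sigma>s ! i) ` {..<?n}" using len(3) by (auto simp: set_conv_nth)
    then show ?thesis unfolding \<sigma>_def dom_map_union using dom by simp
  qed
  ultimately have "state_inv rs \<sigma> c ev"
    unfolding state_inv_def using rs state_invD(3-5)[OF inv] by simp
  moreover have "map2 msubst \<sigma>s Ss = threads \<sigma> c"
  proof (rule nth_equalityI)
    show "length (map2 msubst \<sigma>s Ss) = length (threads \<sigma> c)" using len by simp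
    fix i assume "i < length (map2 msubst \<sigma>s Ss)"
    then have i: "i < ?n" using len by simp
    have "msubst (\<sigma>s ! i) (Ss ! i) = msubst \<sigma> (Ss ! i)"
    proof (rule subst_cong)
      fix x assume "x \<in> fn (Ss ! i)"
      then have "x \<in> live (c i)" using ci[OF i] by simp
      then show "app_map (\<sigma>s ! i) x = app_map \<sigma> x" using \<sigma>i[OF i] by (simp add: app_map_def)
    qed
    then show "map2 msubst \<sigma>s Ss ! i = threads \<sigma> c ! i" using i len ci[OF i] by (simp add: nth_threads)
  qed
  ultimately show thesis using that G by (simp add: state_proc_def)
qed

lemma initial_state:
  assumes cor: "corresponds F (set (restricted F)) (map_union (map (init_map F) [0..<nthreads F])) Ms"
  obtains rs \<sigma> c ev where "state_inv rs \<sigma> c ev" "initial (net F Ms) = state_marking c ev"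
    "fcp_proc F = state_proc rs \<sigma> c" "\<And>i. i < nthreads F \<Longrightarrow> stable_place F (c i)"
proof -
  let ?n = "nthreads F" and ?\<sigma>s = "map (init_map F) [0..<nthreads F]"
  define \<sigma> where "\<sigma> = map_union ?\<sigma>s"
  define c where "c i = (Thr (init_thread F i), [] :: 'n list)" for i
  have "subst_marking F Ms" using cor by (simp add: corresponds_def)
  \<comment> \<open>The concrete net values of the initial marking are left open by
    \<open>corresponds\<close>, so they are read off from \<open>Ms\<close>.\<close>
  then obtain ev where v: "valuation ev" and Ms: "\<And>p. Ms p = val_marking ev p"
    using subst_marking_valuation by blast
  have Ms': "Ms = val_marking ev" using Ms by blast
  have K: "init_ident F i \<in> thread_idents F i" for i by (simp add: thread_idents_def)
  have ok: "place_ok i (c i)" if "i < ?n" for i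
    using K scoped_body[OF init_ident_dom[OF that]] by (auto simp: c_def init_thread_def)
  have lv: "live (c i) = set (formals F (init_ident F i))" if "i < ?n" for i
    using fn_body[OF init_ident_dom[OF that]] by (simp add: c_def init_thread_def)
  have dom: "dom (init_map F i) = live (c i)" if "i < ?n" for i
    using lv[OF that] dom_init_map[OF that] by simp
  have disj: "live (c i) \<inter> live (c j) = {}" if "i < ?n" "j < ?n" "i \<noteq> j" for i j
    using live_thread_vars[OF that(1) ok[OF that(1)]] live_thread_vars[OF that(2) ok[OF that(2)]]
      thread_vars_disjoint[OF that] by blast
  have \<sigma>i: "\<sigma> x = init_map F i x" if "i < ?n" "x \<in> live (c i)" for i x
  proof -
    have "map_union ?\<sigma>s x = (?\<sigma>s ! i) x"
      by (rule map_union_nth) (use that dom disj in simp_all)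
    then show ?thesis using that(1) by (simp add: \<sigma>_def)
  qed
  have cor': "corresponds F (set (restricted F)) \<sigma> (val_marking ev)" using cor unfolding \<sigma>_def Ms' .
  have "agree (set (restricted F)) \<sigma> ev" by (rule corresponds_agree[OF cor' v])
  moreover have "set (restricted F) \<inter> PUB F = {}" using cor' by (simp add: corresponds_def)
  moreover have "distinct (restricted F)" using bound_once by (simp add: bound_once_def)
  moreover have "dom \<sigma> = (\<Union>i < ?n. live (c i))"
    unfolding \<sigma>_def dom_map_union using dom by auto
  moreover have "c i \<in> cf_places F i" for i by (simp add: c_def cf_places_def)
  ultimately have inv: "state_inv (restricted F) \<sigma> c ev" unfolding state_inv_def using v ok by simp
  have "initial_marking F Ms p = state_marking c ev p" for p
    by (cases p) (auto simp: initial_marking_def Ms' c_def)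
  then have init: "initial (net F Ms) = state_marking c ev" by (simp add: net_def fun_eq_iff)
  have "map (\<lambda>i. msubst (init_map F i) (init_thread F i)) [0..<?n] = threads \<sigma> c"
    unfolding threads_def
  proof (rule map_cong[OF refl])
    fix i assume "i \<in> set [0..<?n]"
    then have i: "i < ?n" by simp
    have "msubst (init_map F i) (init_thread F i) = msubst \<sigma> (init_thread F i)"
    proof (rule subst_cong)
      fix x assume "x \<in> fn (init_thread F i)"
      then have "x \<in> live (c i)" by (simp add: c_def)
      then show "app_map (init_map F i) x = app_map \<sigma> x" using \<sigma>i[OF i] by (simp add: app_map_def)
    qed
    then show "msubst (init_map F i) (init_thread F i) = msubst \<sigma> (residual (fst (c i)))" by (simp add: c_def)
  qed
  then have "fcp_proc F = state_proc (restricted F) \<sigma> c" by (simp add: fcp_proc_def state_proc_def)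
  moreover have "stable_place F (c i)" if i: "i < ?n" for i
  proof (cases "init_thread F i")
    case (Call L xs)
    then have "(L, xs) \<in> calls (body F (init_ident F i))" by (simp add: init_thread_def)
    then show ?thesis using calls_body(3)[OF init_ident_dom[OF i]] Call by (simp add: c_def)
  qed (use init_thread_stable[OF i] in \<open>simp_all add: c_def\<close>)
  ultimately show thesis using that inv init by blast
qed

lemma bisim_rel_bisimulation:
  assumes cor: "corresponds F (set (restricted F)) (map_union (map (init_map F) [0..<nthreads F])) Ms"
  shows "bisimulation (fcp_tsys F) (stable_tsys F Ms) (bisim_rel F Ms)"
proof -
  obtain rs0 \<sigma>0 c0 ev0 where inv0: "state_inv rs0 \<sigma>0 c0 ev0" and init: "initial (net F Ms) = state_marking c0 ev0"
    and proc0: "fcp_proc F = state_proc rs0 \<sigma>0 c0" and st0: "\<And>i. i < nthreads F \<Longrightarrow> stable_place F (c0 i)"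
    using initial_state[OF cor] by blast
  have reach: "\<exists>rs \<sigma> c ev. M = state_marking c ev \<and> state_inv rs \<sigma> c ev"
    if M: "M \<in> reachable_markings (net F Ms)" for M
  proof -
    obtain ts where "fires (net F Ms) (state_marking c0 ev0) ts M"
      using M init unfolding reachable_markings_def by auto
    from fires_sound[OF this refl inv0] show ?thesis by blast
  qed
  have scong_cls: "scong G H" if "cls G = cls H" for G H :: "('k, 'n) proc"
    using that sc_refl[of H] unfolding cls_def by blast
  have start: "(cls (fcp_proc F), initial (net F Ms)) \<in> bisim_rel F Ms"
  proof -
    have "represents F (fcp_proc F) (initial (net F Ms))"
      unfolding init by (rule represents_state[OF inv0 st0]) (simp_all add: proc0 sc_refl)
    moreover have "fcp_proc F \<in> reachable_procs F" by (simp add: reachable_procs_def)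
    moreover have "initial (net F Ms) \<in> reachable_markings (net F Ms)"
      unfolding reachable_markings_def using fires_Nil by blast
    moreover have "stable F (initial (net F Ms))" unfolding init stable_state[OF inv0] using st0 by blast
    ultimately show ?thesis unfolding bisim_rel_def stable_reachable_def by blast
  qed
  have sub: "bisim_rel F Ms \<subseteq> states (fcp_tsys F) \<times> states (stable_tsys F Ms)"
    by (auto simp: bisim_rel_def fcp_tsys_def stable_tsys_def)
  have reachI: "M' \<in> reachable_markings (net F Ms)"
    if "M \<in> reachable_markings (net F Ms)" "fires (net F Ms) M ts M'" for M ts M'
    using that fires_append unfolding reachable_markings_def by fast
  have sim: "(\<forall>s'. (s, s') \<in> steps (fcp_tsys F) \<longrightarrow>
        (\<exists>M'. (M, M') \<in> steps (stable_tsys F Ms) \<and> (s', M') \<in> bisim_rel F Ms)) \<and>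
      (\<forall>M'. (M, M') \<in> steps (stable_tsys F Ms) \<longrightarrow>
        (\<exists>s'. (s, s') \<in> steps (fcp_tsys F) \<and> (s', M') \<in> bisim_rel F Ms))"
    if R: "(s, M) \<in> bisim_rel F Ms" for s M
  proof -
    obtain G where s: "s = cls G" and G: "G \<in> reachable_procs F" and M: "M \<in> stable_reachable F Ms"
      and rep: "represents F G M"
      using R unfolding bisim_rel_def by blast
    have Mr: "M \<in> reachable_markings (net F Ms)" and Ms: "stable F M"
      using M by (simp_all add: stable_reachable_def)
    obtain rs1 \<sigma>1 c ev where Mc: "M = state_marking c ev" and inv1: "state_inv rs1 \<sigma>1 c ev"
      using reach[OF Mr] by blast
    obtain rs \<sigma> where inv: "state_inv rs \<sigma> c ev" and Gp: "scong G (state_proc rs \<sigma> c)"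
      using represents_stateE[OF inv1] rep Mc by blast
    have st: "stable_place F (c i)" if "i < nthreads F" for i
      using Ms that unfolding Mc stable_state[OF inv] by blast
    show ?thesis
    proof (intro conjI allI impI)
      fix s' assume "(s, s') \<in> steps (fcp_tsys F)"
      then obtain H H' where H: "s = cls H" "s' = cls H'" "H \<in> reachable_procs F" "react (eqs F) H H'"
        by (auto simp: fcp_tsys_def)
      \<comment> \<open>A step between classes may be witnessed by a representative other than
        \<open>G\<close>; equal classes make it congruent to the same state process.\<close>
      have HG: "scong H (state_proc rs \<sigma> c)"
        using sc_trans[OF scong_cls Gp] H(1) s by simp
      obtain ts rs' \<sigma>' c' ev' where C: "fires (net F Ms) (state_marking c ev) ts (state_marking c' ev')"
        "length (filter main_trans ts) = 1" "state_inv rs' \<sigma>' c' ev'"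
        "scong H' (state_proc rs' \<sigma>' c')" "\<And>i. i < nthreads F \<Longrightarrow> stable_place F (c' i)"
        by (rule complete_step[where Ms = Ms, OF inv st H(4) HG]) (assumption, rule that)
      let ?M = "state_marking c' ev'"
      have "represents F H' ?M" by (rule represents_state[OF C(3,5,4)])
      moreover have "?M \<in> stable_reachable F Ms"
        unfolding stable_reachable_def using reachI[OF Mr] C(1) stable_state[OF C(3)] C(5) Mc by simp
      moreover have "H' \<in> reachable_procs F"
        using H(3,4) unfolding reachable_procs_def by (auto intro: rtranclp.rtrancl_into_rtrancl)
      moreover have "stable_step F Ms M ?M"
        unfolding stable_step_def using Ms C(1,2) Mc calculation(2) by (auto simp: stable_reachable_def)
      ultimately show "\<exists>M'. (M, M') \<in> steps (stable_tsys F Ms) \<and> (s', M') \<in> bisim_rel F Ms"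
        using M H(2) unfolding stable_tsys_def bisim_rel_def by auto
    next
      fix M' assume "(M, M') \<in> steps (stable_tsys F Ms)"
      then have M': "M' \<in> stable_reachable F Ms" and step: "stable_step F Ms M M'"
        by (simp_all add: stable_tsys_def)
      then obtain ts where ts: "fires (net F Ms) M ts M'" "length (filter main_trans ts) = 1"
        by (auto simp: stable_step_def)
      obtain rs' \<sigma>' c' ev' where C: "M' = state_marking c' ev'" "state_inv rs' \<sigma>' c' ev'"
        "react (eqs F) (state_proc rs \<sigma> c) (state_proc rs' \<sigma>' c')"
        using fires_sound[OF ts(1) Mc inv] ts(2) by blast
      \<comment> \<open>The process denoted by the new state serves as the representative of the
        target class.\<close>
      let ?G = "state_proc rs' \<sigma>' c'"
      have "stable F M'" using M' by (simp add: stable_reachable_def)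
      then have "represents F ?G M'"
        unfolding C(1) stable_state[OF C(2)] by (intro represents_state[OF C(2)] sc_refl) simp
      moreover have r: "react (eqs F) G ?G" by (rule re_struct[OF Gp C(3) sc_refl])
      moreover have "?G \<in> reachable_procs F"
        using G r unfolding reachable_procs_def by (auto intro: rtranclp.rtrancl_into_rtrancl)
      ultimately show "\<exists>s'. (s, s') \<in> steps (fcp_tsys F) \<and> (s', M') \<in> bisim_rel F Ms"
        using G M' s unfolding fcp_tsys_def bisim_rel_def by auto
    qed
  qed
  have "start (fcp_tsys F) = cls (fcp_proc F)" "start (stable_tsys F Ms) = initial (net F Ms)"
    by (simp_all add: fcp_tsys_def stable_tsys_def)
  then have "(start (fcp_tsys F), start (stable_tsys F Ms)) \<in> bisim_rel F Ms" using start by simp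
  then show ?thesis
    unfolding bisimulation_def by (intro conjI[OF sub] conjI ballI case_prodI2 sim) simp_all
qed

end

theorem theorem6p2:
  fixes F :: "('k, 'n::{infinite,linorder}) fcp_spec"
    and Ms :: "('k, 'n) marking"
  assumes "normal_form F"
    and "corresponds F (set (restricted F)) (map_union (map (init_map F) [0..<nthreads F])) Ms"
  shows "bisimilar (fcp_tsys F) (stable_tsys F Ms) \<and>
         bisimulation (fcp_tsys F) (stable_tsys F Ms) (bisim_rel F Ms)"
proof -
  interpret fcp F using assms(1) by unfold_locales
  show ?thesis using bisim_rel_bisimulation[OF assms(2)] unfolding bisimilar_def by blast
qed

end
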